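(* Let $\mathfrak g$ be a real nilpotent Lie algebra of dimension $6$ that is non-decomposable (i.e. not isomorphic to a direct sum of two nonzero Lie algebras), let $G$ be the connected, simply connected Lie group with Lie algebra $\mathfrak g$, and let $\Gamma\backslash G$ be a nilmanifold, with $\Gamma\subset G$ a discrete subgroup. Then there is a left-invariant Riemannian metric for which $\Gamma\backslash G$ has a nonzero left-invariant harmonic spinor.
   Context: Clifford convention: $v\cdot v=-|v|^2$. For a left-invariant metric $g$ with left-invariant orthonormal frame $(e_1,\dots,e_n)$, fix an irreducible real representation $\rho:\mathrm{Cl}_n\to\mathrm{End}(W)$ (for $n=6$, $W=\mathbb R^8$). With the trivial spin structure on $\Gamma\backslash G$ (the quotient of $G\times\mathrm{Spin}(n)$ by $y\cdot(x,\tilde h)=(yx,\tilde h)$), spinors are $\Gamma$-invariant maps $\phi:G\to W$; left-invariant spinors are the constant ones. The Dirac operator is $D\phi=\sum_ie_i\nabla_{e_i}\phi$ with $\nabla_X\phi=d_X\phi+\frac12\sum_{j<k}g(\overline\nabla_Xe_j,e_k)e_je_k\phi$, $\overline\nabla$ the Levi-Civita connection. A spinor is harmonic if $D\phi=0$. *)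

theory Defs
  imports "HOL-Analysis.Analysis" "HOL-Algebra.Group"
begin

section \<open>Real Lie algebras\<close>

text \<open>A Lie algebra is a linear subspace \<open>V\<close> of a real vector space together with a bracket on \<open>V\<close>;
  values of the bracket outside \<open>V\<close> are irrelevant.\<close>

definition lie_algebra_on :: "'v::real_vector set \<Rightarrow> ('v \<Rightarrow> 'v \<Rightarrow> 'v) \<Rightarrow> bool" where
  "lie_algebra_on V br \<longleftrightarrow>
     subspace V \<and>
     (\<forall>x\<in>V. \<forall>y\<in>V. br x y \<in> V) \<and>
     (\<forall>x\<in>V. \<forall>y\<in>V. \<forall>z\<in>V. \<forall>a b. br (a *\<^sub>R x + b *\<^sub>R y) z = a *\<^sub>R br x z + b *\<^sub>R br y z) \<and>
     (\<forall>x\<in>V. \<forall>y\<in>V. \<forall>z\<in>V. \<forall>a b. br z (a *\<^sub>R x + b *\<^sub>R y) = a *\<^sub>R br z x + b *\<^sub>R br z y) \<and>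
     (\<forall>x\<in>V. br x x = 0) \<and>
     (\<forall>x\<in>V. \<forall>y\<in>V. \<forall>z\<in>V. br x (br y z) + br y (br z x) + br z (br x y) = 0)"

definition lie_isomorphic ::
  "'v::real_vector set \<Rightarrow> ('v \<Rightarrow> 'v \<Rightarrow> 'v) \<Rightarrow> 'w::real_vector set \<Rightarrow> ('w \<Rightarrow> 'w \<Rightarrow> 'w) \<Rightarrow> bool" where
  "lie_isomorphic V br W br' \<longleftrightarrow>
     (\<exists>f. bij_betw f V W \<and>
        (\<forall>x\<in>V. \<forall>y\<in>V. \<forall>a b. f (a *\<^sub>R x + b *\<^sub>R y) = a *\<^sub>R f x + b *\<^sub>R f y) \<and>
        (\<forall>x\<in>V. \<forall>y\<in>V. f (br x y) = br' (f x) (f y)))"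

definition direct_sum_bracket ::
  "('v \<Rightarrow> 'v \<Rightarrow> 'v) \<Rightarrow> ('w \<Rightarrow> 'w \<Rightarrow> 'w) \<Rightarrow> 'v \<times> 'w \<Rightarrow> 'v \<times> 'w \<Rightarrow> 'v \<times> 'w" where
  "direct_sum_bracket br br' = (\<lambda>(x, y) (x', y'). (br x x', br' y y'))"

text \<open>The summands of a decomposition have dimension at most that of the whole algebra, so every
  pair of summands can be realised, up to isomorphism, on subspaces of the type \<open>'v\<close>.\<close>

definition lie_decomposable :: "('v::real_vector \<Rightarrow> 'v \<Rightarrow> 'v) \<Rightarrow> bool" where
  "lie_decomposable br \<longleftrightarrow>
     (\<exists>(V::'v set) brV (W::'v set) brW.
        lie_algebra_on V brV \<and> lie_algebra_on W brW \<and> V \<noteq> {0} \<and> W \<noteq> {0} \<and>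
        lie_isomorphic UNIV br (V \<times> W) (direct_sum_bracket brV brW))"

primrec lower_central_series :: "('v::real_vector \<Rightarrow> 'v \<Rightarrow> 'v) \<Rightarrow> nat \<Rightarrow> 'v set" where
  "lower_central_series br 0 = UNIV"
| "lower_central_series br (Suc k) = span {br x y |x y. y \<in> lower_central_series br k}"

definition lie_nilpotent :: "('v::real_vector \<Rightarrow> 'v \<Rightarrow> 'v) \<Rightarrow> bool" where
  "lie_nilpotent br \<longleftrightarrow> (\<exists>k. lower_central_series br k = {0})"


section \<open>Smooth manifolds\<close>

primrec Ck_on :: "nat \<Rightarrow> 'e::euclidean_space set \<Rightarrow> ('e \<Rightarrow> 'f::real_normed_vector) \<Rightarrow> bool" where
  "Ck_on 0 S f \<longleftrightarrow> continuous_on S f"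
| "Ck_on (Suc k) S f \<longleftrightarrow>
     (\<forall>s\<in>S. f differentiable (at s)) \<and> (\<forall>v. Ck_on k S (\<lambda>s. frechet_derivative f (at s) v))"

definition smooth_on :: "'e::euclidean_space set \<Rightarrow> ('e \<Rightarrow> 'f::real_normed_vector) \<Rightarrow> bool" where
  "smooth_on S f \<longleftrightarrow> (\<forall>k. Ck_on k S f)"

text \<open>A chart is a pair of a domain and a coordinate map. The manifold is a whole type; an atlas
  need not be maximal.\<close>

type_synonym ('a, 'e) chart = "'a set \<times> ('a \<Rightarrow> 'e)"

definition is_chart :: "('a::topological_space, 'e::euclidean_space) chart \<Rightarrow> bool" where
  "is_chart c \<longleftrightarrow> (case c of (U, x) \<Rightarrow>
     open U \<and> open (x ` U) \<and> homeomorphism U (x ` U) x (inv_into U x))"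

definition smooth_atlas :: "('a::topological_space, 'e::euclidean_space) chart set \<Rightarrow> bool" where
  "smooth_atlas A \<longleftrightarrow>
     (\<forall>c\<in>A. is_chart c) \<and> (\<Union>(U, x)\<in>A. U) = UNIV \<and>
     (\<forall>(U, x)\<in>A. \<forall>(V, y)\<in>A. smooth_on (x ` (U \<inter> V)) (\<lambda>s. y (inv_into U x s)))"

definition product_atlas ::
  "('a, 'e) chart set \<Rightarrow> ('b, 'f) chart set \<Rightarrow> ('a \<times> 'b, 'e \<times> 'f) chart set" where
  "product_atlas A B = {(U \<times> V, map_prod x y) |U x V y. (U, x) \<in> A \<and> (V, y) \<in> B}"

definition smooth_map ::
  "('a::topological_space, 'e::euclidean_space) chart set \<Rightarrow>
   ('b::topological_space, 'f::euclidean_space) chart set \<Rightarrow> ('a \<Rightarrow> 'b) \<Rightarrow> bool" where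
  "smooth_map A B f \<longleftrightarrow> continuous_on UNIV f \<and>
     (\<forall>(U, x)\<in>A. \<forall>(V, y)\<in>B. smooth_on (x ` (U \<inter> f -` V)) (\<lambda>s. y (f (inv_into U x s))))"

definition smooth_fun ::
  "('a::topological_space, 'e::euclidean_space) chart set \<Rightarrow> ('a \<Rightarrow> 'w::euclidean_space) \<Rightarrow> bool" where
  "smooth_fun A f \<longleftrightarrow> smooth_map A {(UNIV, \<lambda>w. w)} f"


section \<open>Tangent vectors and vector fields\<close>

text \<open>A tangent vector is identified with the directional derivative it induces on smooth real
  functions. It is set to \<open>0\<close> on functions that are not smooth, so that equality of tangent vectors is
  equality of functions.\<close>

type_synonym 'a tangent = "('a \<Rightarrow> real) \<Rightarrow> real"
type_synonym 'a vector_field = "'a \<Rightarrow> 'a tangent"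

definition tangent_space ::
  "('a::topological_space, 'e::euclidean_space) chart set \<Rightarrow> 'a \<Rightarrow> 'a tangent set" where
  "tangent_space A p =
     {\<lambda>f. if smooth_fun A f then frechet_derivative (\<lambda>s. f (inv_into U x s)) (at (x p)) w else 0
      |U x w. (U, x) \<in> A \<and> p \<in> U}"

definition tangent_comb :: "real \<Rightarrow> 'a tangent \<Rightarrow> real \<Rightarrow> 'a tangent \<Rightarrow> 'a tangent" where
  "tangent_comb a u b v = (\<lambda>f. a * u f + b * v f)"

definition smooth_vector_field ::
  "('a::topological_space, 'e::euclidean_space) chart set \<Rightarrow> 'a vector_field \<Rightarrow> bool" where
  "smooth_vector_field A X \<longleftrightarrow>
     (\<forall>p. X p \<in> tangent_space A p) \<and>
     (\<forall>f. smooth_fun A f \<longrightarrow> smooth_fun A (\<lambda>p. X p f))"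

definition vf_comb ::
  "('a \<Rightarrow> real) \<Rightarrow> 'a vector_field \<Rightarrow> ('a \<Rightarrow> real) \<Rightarrow> 'a vector_field \<Rightarrow> 'a vector_field" where
  "vf_comb h X k Y = (\<lambda>p. tangent_comb (h p) (X p) (k p) (Y p))"

definition vf_bracket :: "'a vector_field \<Rightarrow> 'a vector_field \<Rightarrow> 'a vector_field" where
  "vf_bracket X Y = (\<lambda>p f. X p (\<lambda>q. Y q f) - Y p (\<lambda>q. X q f))"


section \<open>Lie groups\<close>

definition lie_group ::
  "('a::topological_space) monoid \<Rightarrow> ('a, 'e::euclidean_space) chart set \<Rightarrow> bool" where
  "lie_group G A \<longleftrightarrow>
     group G \<and> carrier G = UNIV \<and> smooth_atlas A \<and>
     smooth_map (product_atlas A A) A (\<lambda>(p, q). p \<otimes>\<^bsub>G\<^esub> q) \<and>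
     smooth_map A A (\<lambda>p. inv\<^bsub>G\<^esub> p)"

definition left_translate :: "'a monoid \<Rightarrow> 'a \<Rightarrow> 'a tangent \<Rightarrow> 'a tangent" where
  "left_translate G a u = (\<lambda>f. u (\<lambda>q. f (a \<otimes>\<^bsub>G\<^esub> q)))"

definition left_invariant_vf ::
  "('a::topological_space) monoid \<Rightarrow> ('a, 'e::euclidean_space) chart set \<Rightarrow> 'a vector_field \<Rightarrow> bool" where
  "left_invariant_vf G A X \<longleftrightarrow>
     smooth_vector_field A X \<and> (\<forall>a p. X (a \<otimes>\<^bsub>G\<^esub> p) = left_translate G a (X p))"

text \<open>\<open>br\<close> is isomorphic to the Lie algebra of left-invariant vector fields of \<open>G\<close>.\<close>

definition has_lie_algebra ::
  "('a::topological_space) monoid \<Rightarrow> ('a, 'e::euclidean_space) chart set \<Rightarrow>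
   ('v::real_vector \<Rightarrow> 'v \<Rightarrow> 'v) \<Rightarrow> bool" where
  "has_lie_algebra G A br \<longleftrightarrow>
     (\<exists>\<iota>. bij_betw \<iota> UNIV {X. left_invariant_vf G A X} \<and>
        (\<forall>u v a b. \<iota> (a *\<^sub>R u + b *\<^sub>R v) = vf_comb (\<lambda>_. a) (\<iota> u) (\<lambda>_. b) (\<iota> v)) \<and>
        (\<forall>u v. \<iota> (br u v) = vf_bracket (\<iota> u) (\<iota> v)))"


section \<open>Riemannian metrics and the Levi-Civita connection\<close>

type_synonym 'a metric = "'a \<Rightarrow> 'a tangent \<Rightarrow> 'a tangent \<Rightarrow> real"

definition riemannian_metric ::
  "('a::topological_space, 'e::euclidean_space) chart set \<Rightarrow> 'a metric \<Rightarrow> bool" where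
  "riemannian_metric A g \<longleftrightarrow>
     (\<forall>p. \<forall>u\<in>tangent_space A p. \<forall>v\<in>tangent_space A p.
        g p u v = g p v u \<and> (u \<noteq> (\<lambda>_. 0) \<longrightarrow> g p u u > 0) \<and>
        (\<forall>w\<in>tangent_space A p. \<forall>a b. g p (tangent_comb a u b v) w = a * g p u w + b * g p v w)) \<and>
     (\<forall>X Y. smooth_vector_field A X \<longrightarrow> smooth_vector_field A Y \<longrightarrow>
        smooth_fun A (\<lambda>p. g p (X p) (Y p)))"

definition left_invariant_metric ::
  "('a::topological_space) monoid \<Rightarrow> ('a, 'e::euclidean_space) chart set \<Rightarrow> 'a metric \<Rightarrow> bool" where
  "left_invariant_metric G A g \<longleftrightarrow>
     riemannian_metric A g \<and>
     (\<forall>a p. \<forall>u\<in>tangent_space A p. \<forall>v\<in>tangent_space A p.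
        g (a \<otimes>\<^bsub>G\<^esub> p) (left_translate G a u) (left_translate G a v) = g p u v)"

definition left_invariant_orthonormal_frame ::
  "('a::topological_space) monoid \<Rightarrow> ('a, real ^ 'n) chart set \<Rightarrow> 'a metric \<Rightarrow>
   ('n::finite \<Rightarrow> 'a vector_field) \<Rightarrow> bool" where
  "left_invariant_orthonormal_frame G A g e \<longleftrightarrow>
     (\<forall>i. left_invariant_vf G A (e i)) \<and>
     (\<forall>p i j. g p (e i p) (e j p) = (if i = j then 1 else 0))"

definition is_levi_civita ::
  "('a::topological_space, 'e::euclidean_space) chart set \<Rightarrow> 'a metric \<Rightarrow>
   ('a vector_field \<Rightarrow> 'a vector_field \<Rightarrow> 'a vector_field) \<Rightarrow> bool" where
  "is_levi_civita A g nabla \<longleftrightarrow>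
     (\<forall>X Y. smooth_vector_field A X \<longrightarrow> smooth_vector_field A Y \<longrightarrow>
        smooth_vector_field A (nabla X Y) \<and>
        vf_comb (\<lambda>_. 1) (nabla X Y) (\<lambda>_. -1) (nabla Y X) = vf_bracket X Y) \<and>
     (\<forall>X Y Z. smooth_vector_field A X \<longrightarrow> smooth_vector_field A Y \<longrightarrow> smooth_vector_field A Z \<longrightarrow>
        nabla (vf_comb (\<lambda>_. 1) X (\<lambda>_. 1) Y) Z = vf_comb (\<lambda>_. 1) (nabla X Z) (\<lambda>_. 1) (nabla Y Z) \<and>
        nabla X (vf_comb (\<lambda>_. 1) Y (\<lambda>_. 1) Z) = vf_comb (\<lambda>_. 1) (nabla X Y) (\<lambda>_. 1) (nabla X Z) \<and>
        (\<forall>p. X p (\<lambda>q. g q (Y q) (Z q)) = g p (nabla X Y p) (Z p) + g p (Y p) (nabla X Z p))) \<and>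
     (\<forall>h X Y. smooth_fun A h \<longrightarrow> smooth_vector_field A X \<longrightarrow> smooth_vector_field A Y \<longrightarrow>
        nabla (\<lambda>p f. h p * X p f) Y = (\<lambda>p f. h p * nabla X Y p f) \<and>
        nabla X (\<lambda>p f. h p * Y p f) = (\<lambda>p f. X p h * Y p f + h p * nabla X Y p f))"

text \<open>The Levi-Civita connection is unique on smooth vector fields; \<open>SOME\<close> only fixes irrelevant
  values outside them.\<close>

definition levi_civita ::
  "('a::topological_space, 'e::euclidean_space) chart set \<Rightarrow> 'a metric \<Rightarrow>
   'a vector_field \<Rightarrow> 'a vector_field \<Rightarrow> 'a vector_field" where
  "levi_civita A g = (SOME nabla. is_levi_civita A g nabla)"


section \<open>The Clifford algebra\<close>

text \<open>\<open>Cl\<^sub>n\<close> with \<open>v \<cdot> v = - \<bar>v\<bar>\<^sup>2\<close>, on its standard basis \<open>e\<^sub>S = e\<^sub>i\<^sub>1 \<dots> e\<^sub>i\<^sub>r\<close> for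
  \<open>S = {i\<^sub>1 < \<dots> < i\<^sub>r}\<close>. In \<open>e\<^sub>S e\<^sub>T\<close> sorting the factors costs one sign for each pair
  \<open>i \<in> S\<close>, \<open>j \<in> T\<close> with \<open>j < i\<close>, and each index in \<open>S \<inter> T\<close> then contributes \<open>e\<^sub>i e\<^sub>i = -1\<close>.\<close>

type_synonym 'n clifford = "real ^ 'n set"

definition clifford_sign :: "'n::{finite,linorder} set \<Rightarrow> 'n set \<Rightarrow> real" where
  "clifford_sign S T = (-1) ^ (card {(i, j). i \<in> S \<and> j \<in> T \<and> j < i} + card (S \<inter> T))"

definition clifford_mult ::
  "'n::{finite,linorder} clifford \<Rightarrow> 'n clifford \<Rightarrow> 'n clifford" where
  "clifford_mult a b =
     (\<Sum>S\<in>UNIV. \<Sum>T\<in>UNIV. (clifford_sign S T * (a $ S) * (b $ T)) *\<^sub>R axis ((S - T) \<union> (T - S)) 1)"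

definition clifford_one :: "'n::{finite,linorder} clifford" where
  "clifford_one = axis {} 1"

definition clifford_gen :: "'n \<Rightarrow> 'n::{finite,linorder} clifford" where
  "clifford_gen i = axis {i} 1"

lemma clifford_mult_axis:
  "clifford_mult (axis S 1) (axis T 1) =
     clifford_sign S T *\<^sub>R axis ((S - T) \<union> (T - S)) (1::real)"
proof -
  have axis_eq: "axis S (1::real) $ S' = (if S' = S then 1 else 0)" for S S' :: "'a set"
    by (simp add: axis_def)
  have if_scale: "(c * (if P then 1 else 0) * (if Q then 1 else 0)) *\<^sub>R x =
      (if Q then if P then c *\<^sub>R x else 0 else 0)" for c :: real and P Q and x :: "'a clifford"
    by simp
  show ?thesis
    unfolding clifford_mult_def axis_eq if_scale by (simp add: sum.delta)
qed

lemma clifford_relation: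
  "clifford_mult (clifford_gen i) (clifford_gen j) + clifford_mult (clifford_gen j) (clifford_gen i) =
     (if i = j then - 2 else 0) *\<^sub>R clifford_one"
proof -
  have *: "{(k, l). k = a \<and> l = b \<and> l < k} = (if b < a then {(a, b)} else {})" for a b :: 'a
    by auto
  show ?thesis
  proof (cases "i = j")
    case True
    have "- c - c = - (2 *\<^sub>R c)" for c :: "'a clifford"
      by (simp add: scaleR_2)
    then show ?thesis using True
      by (simp add: clifford_gen_def clifford_one_def clifford_mult_axis clifford_sign_def * )
  next
    case False
    have "{i} - {j} \<union> ({j} - {i}) = {i, j}" "{j} - {i} \<union> ({i} - {j}) = {i, j}"
      using False by auto
    then show ?thesis using False
      by (auto simp: clifford_gen_def clifford_mult_axis clifford_sign_def * )
  qed
qed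

definition clifford_representation ::
  "('n::{finite,linorder} clifford \<Rightarrow> 'w::real_normed_vector \<Rightarrow>\<^sub>L 'w) \<Rightarrow> bool" where
  "clifford_representation \<rho> \<longleftrightarrow>
     linear \<rho> \<and> \<rho> clifford_one = id_blinfun \<and>
     (\<forall>a b. \<rho> (clifford_mult a b) = \<rho> a o\<^sub>L \<rho> b)"

definition irreducible_clifford_representation ::
  "('n::{finite,linorder} clifford \<Rightarrow> 'w::real_normed_vector \<Rightarrow>\<^sub>L 'w) \<Rightarrow> bool" where
  "irreducible_clifford_representation \<rho> \<longleftrightarrow>
     clifford_representation \<rho> \<and> (UNIV :: 'w set) \<noteq> {0} \<and>
     (\<forall>S. subspace S \<and> (\<forall>a. \<forall>w\<in>S. blinfun_apply (\<rho> a) w \<in> S) \<longrightarrow> S = {0} \<or> S = UNIV)"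


section \<open>Spinors and the Dirac operator\<close>

text \<open>For the trivial spin structure, spinors on the quotient of \<open>G\<close> by \<open>\<Gamma>\<close> are the
  \<open>\<Gamma>\<close>-invariant smooth maps on \<open>G\<close>.\<close>

definition spinor ::
  "('a::topological_space) monoid \<Rightarrow> ('a, 'e::euclidean_space) chart set \<Rightarrow> 'a set \<Rightarrow>
   ('a \<Rightarrow> 'w::euclidean_space) \<Rightarrow> bool" where
  "spinor G A \<Gamma> \<phi> \<longleftrightarrow>
     smooth_fun A \<phi> \<and> (\<forall>\<gamma>\<in>\<Gamma>. \<forall>p. \<phi> (\<gamma> \<otimes>\<^bsub>G\<^esub> p) = \<phi> p)"

definition left_invariant_spinor :: "('a \<Rightarrow> 'w) \<Rightarrow> bool" where
  "left_invariant_spinor \<phi> \<longleftrightarrow> (\<exists>w. \<forall>p. \<phi> p = w)"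

definition spinor_derivative ::
  "'a vector_field \<Rightarrow> ('a \<Rightarrow> 'w::euclidean_space) \<Rightarrow> 'a \<Rightarrow> 'w" where
  "spinor_derivative X \<phi> p = (\<Sum>b\<in>Basis. X p (\<lambda>q. \<phi> q \<bullet> b) *\<^sub>R b)"

text \<open>In the frame \<open>e\<close>, Clifford multiplication by \<open>e i\<close> is the action of the \<open>i\<close>-th generator.\<close>

definition spinor_connection ::
  "('a::topological_space, real ^ 'n::{finite,linorder}) chart set \<Rightarrow> 'a metric \<Rightarrow>
   ('n \<Rightarrow> 'a vector_field) \<Rightarrow>
   ('n clifford \<Rightarrow> 'w::euclidean_space \<Rightarrow>\<^sub>L 'w) \<Rightarrow>
   'a vector_field \<Rightarrow> ('a \<Rightarrow> 'w) \<Rightarrow> 'a \<Rightarrow> 'w" where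
  "spinor_connection A g e \<rho> X \<phi> p =
     spinor_derivative X \<phi> p +
     (1 / 2) *\<^sub>R (\<Sum>(j, k) | j < k.
        g p (levi_civita A g X (e j) p) (e k p) *\<^sub>R
          \<rho> (clifford_gen j) (\<rho> (clifford_gen k) (\<phi> p)))"

definition dirac ::
  "('a::topological_space, real ^ 'n::{finite,linorder}) chart set \<Rightarrow> 'a metric \<Rightarrow>
   ('n \<Rightarrow> 'a vector_field) \<Rightarrow>
   ('n clifford \<Rightarrow> 'w::euclidean_space \<Rightarrow>\<^sub>L 'w) \<Rightarrow> ('a \<Rightarrow> 'w) \<Rightarrow> 'a \<Rightarrow> 'w" where
  "dirac A g e \<rho> \<phi> p =
     (\<Sum>i\<in>UNIV. \<rho> (clifford_gen i) (spinor_connection A g e \<rho> (e i) \<phi> p))"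

definition harmonic_spinor ::
  "('a::topological_space, real ^ 'n::{finite,linorder}) chart set \<Rightarrow> 'a metric \<Rightarrow>
   ('n \<Rightarrow> 'a vector_field) \<Rightarrow>
   ('n clifford \<Rightarrow> 'w::euclidean_space \<Rightarrow>\<^sub>L 'w) \<Rightarrow> ('a \<Rightarrow> 'w) \<Rightarrow> bool" where
  "harmonic_spinor A g e \<rho> \<phi> \<longleftrightarrow> (\<forall>p. dirac A g e \<rho> \<phi> p = 0)"

end

(*
  On constant spinors the Dirac operator of a left-invariant metric is, up to a factor, Clifford
  multiplication by the 3-form H = sum_k e^k /\ de^k; the remaining terms are traces of ad(e_k),
      which
  vanish for a nilpotent Lie algebra.  Every spinor in dimension 6 is pure, hence determined by an
  SU(3)-structure, and H annihilates it iff H is primitive of type (2,1)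
      + (1,2): eight linear equations
  on the coefficients of H.  So one looks for a basis of the Lie algebra satisfying these equations.

  Nilpotency provides a basis of the dual with triangular structure equations.  Successive
  normalisation by the Jacobi identity leads to fourteen families of structure equations, each
      with an
  explicit solution.  Indecomposability enters only through the fact that the centre is contained
  in the commutator ideal.
*)

theory Submission
  imports Defs
begin


section \<open>Coframes of a six-dimensional Lie algebra\<close>

text \<open>Declaring a basis of the Lie algebra orthonormal is choosing the metric, so every change
  of coframe is allowed, rescalings included, and these are what solve the equations. Since Spin(6)
  = SU(4) is transitive on unit spinors, fixing one pure spinor loses nothing. Structure equations
  are stated for \<open>f (br x y)\<close> instead of df = \<open>- f (br x y)\<close>; the sign is
  harmless because the equations of \<open>pure_frame\<close> are linear and homogeneous in the
  bracket. The families keep real parameters: normalising them further would mean sign distinctions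
  and roots over the reals, while the solutions mostly depend rationally on the parameters. The
  price is exceptional values at which a form of the new coframe would degenerate; constants defined
  by \<open>if\<close> rescale these away. Square roots remain only in
  \<open>two_step_orthogonal\<close> and \<open>common_factor_diagonal\<close>. On the geometric
  side the obstacle is that \<open>levi_civita\<close> is given by \<open>SOME\<close> and tangent
  vectors are functionals on functions. So a Levi-Civita connection has to be constructed, and for
  that the coefficients of a smooth field in the frame must be shown to be smooth.\<close>

definition wedge :: "('v \<Rightarrow> real) \<Rightarrow> ('v \<Rightarrow> real) \<Rightarrow> 'v \<Rightarrow> 'v \<Rightarrow> real" where
  "wedge f g x y = f x * g y - g x * f y"

abbreviation (input) form3 where
  "form3 f1 f2 f3 s12 s13 s23 x y \<equiv>
     s12 * wedge f1 f2 x y + s13 * wedge f1 f3 x y + s23 * wedge f2 f3 x y"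

abbreviation (input) form4 where
  "form4 f1 f2 f3 f4 s12 s13 s14 s23 s24 s34 x y \<equiv>
     s12 * wedge f1 f2 x y + s13 * wedge f1 f3 x y + s14 * wedge f1 f4 x y + s23 * wedge f2 f3 x y
         + s24 * wedge f2 f4 x y + s34 * wedge f3 f4 x y"

abbreviation (input) form5 where
  "form5 f1 f2 f3 f4 f5 s12 s13 s14 s15 s23 s24 s25 s34 s35 s45 x y \<equiv>
     s12 * wedge f1 f2 x y + s13 * wedge f1 f3 x y + s14 * wedge f1 f4 x y + s15 * wedge f1 f5 x y
         + s23 * wedge f2 f3 x y + s24 * wedge f2 f4 x y + s25 * wedge f2 f5 x y
         + s34 * wedge f3 f4 x y + s35 * wedge f3 f5 x y + s45 * wedge f4 f5 x y"

text \<open>In dimension 6 a trivial common kernel makes six functionals a basis of the dual space,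
  and after a change of coframe it is the easiest form of that condition to check.\<close>

definition coframe :: "('v::real_vector \<Rightarrow> real) \<Rightarrow> ('v \<Rightarrow> real) \<Rightarrow> ('v \<Rightarrow> real) \<Rightarrow> ('v \<Rightarrow> real) \<Rightarrow>
    ('v \<Rightarrow> real) \<Rightarrow> ('v \<Rightarrow> real) \<Rightarrow> bool" where
  "coframe f1 f2 f3 f4 f5 f6 \<longleftrightarrow>
     linear f1 \<and> linear f2 \<and> linear f3 \<and> linear f4 \<and> linear f5 \<and> linear f6 \<and>
     (\<forall>x. f1 x = 0 \<longrightarrow> f2 x = 0 \<longrightarrow> f3 x = 0 \<longrightarrow> f4 x = 0 \<longrightarrow> f5 x = 0 \<longrightarrow> f6 x = 0 \<longrightarrow> x = 0)"

definition dual_frame :: "('v::real_vector \<Rightarrow> real) \<Rightarrow> ('v \<Rightarrow> real) \<Rightarrow> ('v \<Rightarrow> real) \<Rightarrow> ('v \<Rightarrow> real) \<Rightarrow>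
    ('v \<Rightarrow> real) \<Rightarrow> ('v \<Rightarrow> real) \<Rightarrow> 'v \<Rightarrow> 'v \<Rightarrow> 'v \<Rightarrow> 'v \<Rightarrow> 'v \<Rightarrow> 'v \<Rightarrow> bool" where
  "dual_frame f1 f2 f3 f4 f5 f6 b1 b2 b3 b4 b5 b6 \<longleftrightarrow>
     f1 b1 = 1 \<and> f1 b2 = 0 \<and> f1 b3 = 0 \<and> f1 b4 = 0 \<and> f1 b5 = 0 \<and> f1 b6 = 0 \<and>
     f2 b1 = 0 \<and> f2 b2 = 1 \<and> f2 b3 = 0 \<and> f2 b4 = 0 \<and> f2 b5 = 0 \<and> f2 b6 = 0 \<and>
     f3 b1 = 0 \<and> f3 b2 = 0 \<and> f3 b3 = 1 \<and> f3 b4 = 0 \<and> f3 b5 = 0 \<and> f3 b6 = 0 \<and>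
     f4 b1 = 0 \<and> f4 b2 = 0 \<and> f4 b3 = 0 \<and> f4 b4 = 1 \<and> f4 b5 = 0 \<and> f4 b6 = 0 \<and>
     f5 b1 = 0 \<and> f5 b2 = 0 \<and> f5 b3 = 0 \<and> f5 b4 = 0 \<and> f5 b5 = 1 \<and> f5 b6 = 0 \<and>
     f6 b1 = 0 \<and> f6 b2 = 0 \<and> f6 b3 = 0 \<and> f6 b4 = 0 \<and> f6 b5 = 0 \<and> f6 b6 = 1"

text \<open>If \<open>f, g, h\<close> are dual to \<open>x, y, z\<close>, then \<open>cyc\<close> is, up to sign, the coefficient of
  \<open>f \<and> g \<and> h\<close> in \<open>\<Sum> f\<^sub>k \<and> df\<^sub>k\<close>, since \<open>df (x, y) = - f [x, y]\<close>.\<close>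

definition cyc :: "('v \<Rightarrow> 'v \<Rightarrow> 'v) \<Rightarrow> ('v \<Rightarrow> real) \<Rightarrow> ('v \<Rightarrow> real) \<Rightarrow> ('v \<Rightarrow> real) \<Rightarrow>
    'v \<Rightarrow> 'v \<Rightarrow> 'v \<Rightarrow> real" where
  "cyc br f g h x y z = f (br y z) + g (br z x) + h (br x y)"

text \<open>The sum is the trace of \<open>ad x\<close>, tested on a basis. These traces are the
  part of the Dirac operator that is not seen by the 3-form.\<close>

definition unimodular_frame where
  "unimodular_frame br f1 f2 f3 f4 f5 f6 b1 b2 b3 b4 b5 b6 \<longleftrightarrow>
     (\<forall>x\<in>{b1, b2, b3, b4, b5, b6}.
       f1 (br x b1) + f2 (br x b2) + f3 (br x b3) + f4 (br x b4) + f5 (br x b5)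
           + f6 (br x b6) = (0::real))"

text \<open>The equations say that \<open>\<Sum> f\<^sub>k \<and> df\<^sub>k\<close> annihilates the pure spinor with Kaehler form
  \<open>12 + 34 + 56\<close> and complex volume form \<open>(1 + i 2)(3 + i 4)(5 + i 6)\<close>.\<close>

definition pure_frame where
  "pure_frame br f1 f2 f3 f4 f5 f6 b1 b2 b3 b4 b5 b6 \<longleftrightarrow>
     cyc br f1 f3 f4 b1 b3 b4 + cyc br f1 f5 f6 b1 b5 b6 = 0 \<and>
     cyc br f2 f3 f4 b2 b3 b4 + cyc br f2 f5 f6 b2 b5 b6 = 0 \<and>
     cyc br f1 f2 f3 b1 b2 b3 + cyc br f3 f5 f6 b3 b5 b6 = 0 \<and>
     cyc br f1 f2 f4 b1 b2 b4 + cyc br f4 f5 f6 b4 b5 b6 = 0 \<and>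
     cyc br f1 f2 f5 b1 b2 b5 + cyc br f3 f4 f5 b3 b4 b5 = 0 \<and>
     cyc br f1 f2 f6 b1 b2 b6 + cyc br f3 f4 f6 b3 b4 b6 = 0 \<and>
     cyc br f1 f3 f5 b1 b3 b5 - cyc br f1 f4 f6 b1 b4 b6
       - cyc br f2 f3 f6 b2 b3 b6 - cyc br f2 f4 f5 b2 b4 b5 = 0 \<and>
     cyc br f1 f3 f6 b1 b3 b6 + cyc br f1 f4 f5 b1 b4 b5
       + cyc br f2 f3 f5 b2 b3 b5 - cyc br f2 f4 f6 b2 b4 b6 = 0"

definition has_pure_frame :: "('v::real_vector \<Rightarrow> 'v \<Rightarrow> 'v) \<Rightarrow> bool" where
  "has_pure_frame br \<longleftrightarrow> (\<exists>f1 f2 f3 f4 f5 f6 b1 b2 b3 b4 b5 b6.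
     coframe f1 f2 f3 f4 f5 f6 \<and> dual_frame f1 f2 f3 f4 f5 f6 b1 b2 b3 b4 b5 b6 \<and>
     unimodular_frame br f1 f2 f3 f4 f5 f6 b1 b2 b3 b4 b5 b6 \<and>
     pure_frame br f1 f2 f3 f4 f5 f6 b1 b2 b3 b4 b5 b6)"

section \<open>Linear functionals and dual frames\<close>

lemma linear_cmult: "linear (f :: 'v::real_vector \<Rightarrow> real) \<Longrightarrow> linear (\<lambda>x. c * f x :: real)"
  using linear_compose_scale_right[of f c] by simp

lemma linear_multc: "linear (f :: 'v::real_vector \<Rightarrow> real) \<Longrightarrow> linear (\<lambda>x. f x * c :: real)"
  using linear_cmult[of f c] by (simp add: mult.commute)

lemma linear_divc: "linear (f :: 'v::real_vector \<Rightarrow> real) \<Longrightarrow> linear (\<lambda>x. f x / c :: real)"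
  using linear_multc[of f "1/c"] by simp

lemmas linear_rules = linear_compose_add linear_compose_sub linear_compose_neg
  linear_cmult linear_multc linear_divc

lemma coframeI:
  assumes "linear f1" "linear f2" "linear f3" "linear f4" "linear f5" "linear f6"
    and "\<And>x. f1 x = 0 \<Longrightarrow> f2 x = 0 \<Longrightarrow> f3 x = 0 \<Longrightarrow> f4 x = 0 \<Longrightarrow> f5 x = 0 \<Longrightarrow> f6 x = 0 \<Longrightarrow> x = 0"
  shows "coframe f1 f2 f3 f4 f5 f6"
  using assms by (simp add: coframe_def)

lemma coframeD:
  assumes "coframe f1 f2 f3 f4 f5 f6"
  shows "linear f1" "linear f2" "linear f3" "linear f4" "linear f5" "linear f6"
    and "\<And>x. f1 x = 0 \<Longrightarrow> f2 x = 0 \<Longrightarrow> f3 x = 0 \<Longrightarrow> f4 x = 0 \<Longrightarrow> f5 x = 0 \<Longrightarrow> f6 x = 0 \<Longrightarrow> x = 0"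
  using assms by (simp_all add: coframe_def)

lemma dual_frameD:
  assumes "dual_frame f1 f2 f3 f4 f5 f6 b1 b2 b3 b4 b5 b6"
  shows "f1 b1 = 1" "f1 b2 = 0" "f1 b3 = 0" "f1 b4 = 0" "f1 b5 = 0" "f1 b6 = 0"
    and "f2 b1 = 0" "f2 b2 = 1" "f2 b3 = 0" "f2 b4 = 0" "f2 b5 = 0" "f2 b6 = 0"
    and "f3 b1 = 0" "f3 b2 = 0" "f3 b3 = 1" "f3 b4 = 0" "f3 b5 = 0" "f3 b6 = 0"
    and "f4 b1 = 0" "f4 b2 = 0" "f4 b3 = 0" "f4 b4 = 1" "f4 b5 = 0" "f4 b6 = 0"
    and "f5 b1 = 0" "f5 b2 = 0" "f5 b3 = 0" "f5 b4 = 0" "f5 b5 = 1" "f5 b6 = 0"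
    and "f6 b1 = 0" "f6 b2 = 0" "f6 b3 = 0" "f6 b4 = 0" "f6 b5 = 0" "f6 b6 = 1"
  using assms by (simp_all add: dual_frame_def)

text \<open>The six functionals together form an injective linear map into six-dimensional space,
  which is onto because the dimensions agree; the dual vectors are preimages of the unit
  vectors.\<close>

lemma ex_dual_frame:
  fixes f1 :: "'v::real_vector \<Rightarrow> real"
  assumes dim: "dim (UNIV :: 'v set) = 6" and cf: "coframe f1 f2 f3 f4 f5 f6"
  shows "\<exists>b1 b2 b3 b4 b5 b6. dual_frame f1 f2 f3 f4 f5 f6 b1 b2 b3 b4 b5 b6"
proof -
  define F where "F x = (f1 x, f2 x, f3 x, f4 x, f5 x, f6 x)" for x
  note l = coframeD[OF cf]
  have lin: "linear F"
    unfolding F_def by (intro linearI) (simp_all add: l linear_add linear_scale)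
  have inj: "inj F"
    using l(7) unfolding linear_injective_0[OF lin] by (simp add: F_def zero_prod_def)
  obtain B :: "'v set" where B: "independent B" "card B = 6"
    using basis_exists[of "UNIV :: 'v set"] dim by metis
  have "finite B" using B(2) by (metis card.infinite zero_neq_numeral)
  have ind: "independent (F ` B)"
    using linear_independent_injective_image[OF lin B(1)] inj inj_on_subset by blast
  have "card (F ` B) = 6"
    using B(2) inj by (simp add: card_image inj_on_subset)
  moreover have "DIM(real \<times> real \<times> real \<times> real \<times> real \<times> real) = 6" by simp
  ultimately have "span (F ` B) = UNIV"
    using ind card_ge_dim_independent[of "F ` B" UNIV] by (auto simp: dim_UNIV)
  then have surj: "y \<in> range F" for y
    using linear_span_image[OF lin, of B] by blast
  have ex: "\<exists>x. F x = y" for y using surj[of y] by auto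
  obtain b1 where "F b1 = (1,0,0,0,0,0)" using ex by blast
  moreover obtain b2 where "F b2 = (0,1,0,0,0,0)" using ex by blast
  moreover obtain b3 where "F b3 = (0,0,1,0,0,0)" using ex by blast
  moreover obtain b4 where "F b4 = (0,0,0,1,0,0)" using ex by blast
  moreover obtain b5 where "F b5 = (0,0,0,0,1,0)" using ex by blast
  moreover obtain b6 where "F b6 = (0,0,0,0,0,1)" using ex by blast
  ultimately have "dual_frame f1 f2 f3 f4 f5 f6 b1 b2 b3 b4 b5 b6"
    by (simp add: dual_frame_def F_def)
  then show ?thesis by blast
qed

section \<open>Six-dimensional Lie algebras and their central factors\<close>

locale lie_algebra6 =
  fixes br :: "'v::real_vector \<Rightarrow> 'v \<Rightarrow> 'v"
  assumes lie: "lie_algebra_on UNIV br" and dim6: "dim (UNIV :: 'v set) = 6"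
begin

lemma br_add_left: "br (x + y) z = br x z + br y z"
proof -
  have "br (1 *\<^sub>R x + 1 *\<^sub>R y) z = 1 *\<^sub>R br x z + 1 *\<^sub>R br y z"
    using lie unfolding lie_algebra_on_def by blast
  then show ?thesis by simp
qed

lemma br_add_right: "br z (x + y) = br z x + br z y"
proof -
  have "br z (1 *\<^sub>R x + 1 *\<^sub>R y) = 1 *\<^sub>R br z x + 1 *\<^sub>R br z y"
    using lie unfolding lie_algebra_on_def by blast
  then show ?thesis by simp
qed

lemma br_scale_left: "br (a *\<^sub>R x) z = a *\<^sub>R br x z"
proof -
  have "br (a *\<^sub>R x + 0 *\<^sub>R x) z = a *\<^sub>R br x z + 0 *\<^sub>R br x z"
    using lie unfolding lie_algebra_on_def by blast
  then show ?thesis by simp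
qed

lemma br_scale_right: "br z (a *\<^sub>R x) = a *\<^sub>R br z x"
proof -
  have "br z (a *\<^sub>R x + 0 *\<^sub>R x) = a *\<^sub>R br z x + 0 *\<^sub>R br z x"
    using lie unfolding lie_algebra_on_def by blast
  then show ?thesis by simp
qed

lemma br_self: "br x x = 0"
  using lie unfolding lie_algebra_on_def by blast

lemma br_anti: "br y x = - br x y"
proof -
  have "br (x + y) (x + y) = br x y + br y x"
    unfolding br_add_left br_add_right by (simp add: br_self)
  then have "br y x + br x y = 0" unfolding br_self by (simp add: add.commute)
  then show ?thesis by (simp add: add_eq_0_iff2)
qed

lemma jacobi: "br x (br y z) + br y (br z x) + br z (br x y) = 0"
  using lie unfolding lie_algebra_on_def by blast

text \<open>This is d(df) = 0 for the 1-form \<open>f\<close>. On triples of dual vectors it yields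
  the relations among structure coefficients that drive all later normalisations.\<close>

lemma jacobi_functional:
  assumes "linear f"
  shows "f (br x (br y z)) + f (br y (br z x)) + f (br z (br x y)) = 0"
  using arg_cong[OF jacobi[of x y z], of f] assms by (simp add: linear_add linear_0)

text \<open>A dual frame is only known to exist, so the equations are required on every one; a
  verification then uses nothing but the values of the functionals on it.\<close>

lemma has_pure_frameI:
  assumes cf: "coframe f1 f2 f3 f4 f5 f6"
    and "\<And>b1 b2 b3 b4 b5 b6. dual_frame f1 f2 f3 f4 f5 f6 b1 b2 b3 b4 b5 b6 \<Longrightarrow>
      unimodular_frame br f1 f2 f3 f4 f5 f6 b1 b2 b3 b4 b5 b6 \<and>
      pure_frame br f1 f2 f3 f4 f5 f6 b1 b2 b3 b4 b5 b6"
  shows "has_pure_frame br"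
  using assms ex_dual_frame[OF dim6 cf] unfolding has_pure_frame_def by meson

text \<open>A closed form kills all brackets, so its kernel is an ideal, and a central
  \<open>z\<close> outside the kernel spans a complementary ideal. \<open>k\<close> and
  \<open>h\<close> are the projections to the two summands.\<close>

lemma decomposable_if_central_factor:
  fixes f :: "'v \<Rightarrow> real"
  assumes f: "linear f" "\<And>x y. f (br x y) = 0" and z: "f z \<noteq> 0" "\<And>y. br z y = 0"
  shows "lie_decomposable br"
proof -
  define k where "k x = x - (f x / f z) *\<^sub>R z" for x
  define h where "h x = (f x / f z) *\<^sub>R z" for x
  define V where "V = {x. f x = 0}"
  define W where "W = span {z}"
  have fk: "f (k x) = 0" for x
    using z(1) by (simp add: k_def f(1) linear_diff linear_scale)
  have brz: "br y z = 0" for y using br_anti[of y z] z(2) by simp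
  have kh: "k x + h x = x" for x by (simp add: k_def h_def)
  have hW: "h x \<in> W" for x by (simp add: W_def h_def span_base span_scale)
  have W: "\<exists>a. w = a *\<^sub>R z" if "w \<in> W" for w
    using that by (auto simp: W_def span_singleton)
  have lk: "k (a *\<^sub>R x + b *\<^sub>R y) = a *\<^sub>R k x + b *\<^sub>R k y" for a b x y
    using z(1) by (simp add: k_def f(1) linear_add linear_scale algebra_simps add_divide_distrib)
  have lh: "h (a *\<^sub>R x + b *\<^sub>R y) = a *\<^sub>R h x + b *\<^sub>R h y" for a b x y
    by (simp add: h_def f(1) linear_add linear_scale algebra_simps add_divide_distrib)
  have fW: "h w = w" if w: "w \<in> W" for w
    using W[OF that] z(1) by (auto simp: h_def f(1) linear_scale)
  have hV: "h v = 0" if "v \<in> V" for v using that by (simp add: h_def V_def)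
  have V: "subspace V" unfolding V_def subspace_def using f(1) by (simp add: linear_0 linear_add
      linear_scale)
  have V1: "lie_algebra_on V br"
    unfolding lie_algebra_on_def using V f(2)
    by (auto simp: V_def br_add_left br_add_right br_scale_left br_scale_right br_self jacobi)
  have W1: "lie_algebra_on W (\<lambda>_ _. 0)"
    unfolding lie_algebra_on_def W_def by (simp add: span_zero)
  have z0: "z \<noteq> 0" using z(1) f(1) by (auto simp: linear_0)
  then have W0: "W \<noteq> {0}" unfolding W_def using span_base[of z "{z}"] by blast
  have V0: "V \<noteq> {0}"
  proof
    assume "V = {0}"
    have "x \<in> span {z}" for x
    proof -
      have "k x \<in> V" by (simp add: V_def fk)
      then have "k x = 0" using \<open>V = {0}\<close> by blast
      then show ?thesis using kh[of x] hW[of x] by (simp add: W_def)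
    qed
    then have "dim (UNIV :: 'v set) \<le> card {z}" by (intro dim_le_card) auto
    then show False using dim6 by simp
  qed
  have "bij_betw (\<lambda>x. (k x, h x)) UNIV (V \<times> W)"
  proof (rule bij_betw_byWitness[where f' = "\<lambda>(v, w). v + w"])
    show "\<forall>p\<in>V \<times> W. (k (case p of (v, w) \<Rightarrow> v + w), h (case p of (v, w) \<Rightarrow> v + w)) = p"
    proof safe
      fix v w assume vw: "v \<in> V" "w \<in> W"
      have "h (v + w) = w" using lh[of 1 v 1 w] hV[OF vw(1)] fW[OF vw(2)] by simp
      moreover then have "k (v + w) = v" using kh[of "v + w"] by simp
      ultimately show "k (v + w) = v" "h (v + w) = w" by simp_all
    qed
  qed (auto simp: kh hW V_def fk)
  moreover have "(k (br x y), h (br x y)) = direct_sum_bracket br (\<lambda>_ _. 0) (k x, h x) (k y, h y)"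
      for x y
  proof -
    have "br (k x) (k y) = br x y"
      using br_add_left[of "k x" "- h x" "k y"]
      unfolding k_def diff_conv_add_uminus scaleR_minus_left[symmetric] br_add_left br_add_right
        br_scale_left br_scale_right by (simp add: z(2) brz)
    then show ?thesis by (simp add: direct_sum_bracket_def k_def h_def f(2))
  qed
  ultimately have "lie_isomorphic UNIV br (V \<times> W) (direct_sum_bracket br (\<lambda>_ _. 0))"
    unfolding lie_isomorphic_def
    by (intro exI[of _ "\<lambda>x. (k x, h x)"]) (auto simp: lk lh)
  then show ?thesis
    unfolding lie_decomposable_def using V1 W1 V0 W0 by blast
qed

end

locale indecomposable_lie_algebra6 = lie_algebra6 br
  for br :: "'v::real_vector \<Rightarrow> 'v \<Rightarrow> 'v" +
  assumes indecomposable: "\<not> lie_decomposable br"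
begin

lemma no_central_factor:
  fixes g :: "'v \<Rightarrow> real"
  assumes cf: "coframe f1 f2 f3 f4 f5 f6"
    and z: "\<And>y. f1 (br z y) = 0" "\<And>y. f2 (br z y) = 0" "\<And>y. f3 (br z y) = 0"
      "\<And>y. f4 (br z y) = 0" "\<And>y. f5 (br z y) = 0" "\<And>y. f6 (br z y) = 0"
    and g: "linear g" "\<And>x y. g (br x y) = 0" "g z \<noteq> 0"
  shows False
proof -
  have "br z y = 0" for y using coframeD(7)[OF cf] z by blast
  then show False using decomposable_if_central_factor[OF g(1,2,3)] indecomposable by blast
qed

text \<open>If the closed form \<open>f1\<close> enters no differential, its dual vector
  \<open>b1\<close> is central although \<open>f1 b1 = 1\<close>, and \<open>b1\<close> splits off.
  This is how indecomposability is used on structure equations.\<close>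

lemma no_unused_closed_form:
  assumes cf: "coframe f1 f2 f3 f4 f5 f6"
    and closed: "\<And>x y. f1 (br x y) = 0"
    and unused: "\<And>x y. f2 x = 0 \<Longrightarrow> f3 x = 0 \<Longrightarrow> f4 x = 0 \<Longrightarrow> f5 x = 0 \<Longrightarrow> f6 x = 0 \<Longrightarrow>
      f2 (br x y) = 0 \<and> f3 (br x y) = 0 \<and> f4 (br x y) = 0 \<and> f5 (br x y) = 0 \<and> f6 (br x y) = 0"
  shows False
proof -
  obtain b1 b2 b3 b4 b5 b6 where "dual_frame f1 f2 f3 f4 f5 f6 b1 b2 b3 b4 b5 b6"
    using ex_dual_frame[OF dim6 cf] by blast
  note D = dual_frameD[OF this]
  show False
    by (rule no_central_factor[OF cf, where z = b1 and g = f1])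
      (use closed unused[of b1] D coframeD[OF cf] in auto)
qed

section \<open>Explicit solutions\<close>

text \<open>Lemma names list the differentials of the non-closed forms, e.g. \<open>12_15p34\<close> for
  \<open>de\<^sub>5 = 12\<close>, \<open>de\<^sub>6 = 15 + 34\<close>, with \<open>p\<close> and \<open>m\<close> for plus and minus. The new coframe is listed in
  the order of the three pairs of \<open>pure_frame\<close>.\<close>

lemma pure_frame_12_15p34:
  assumes cf: "coframe f1 f2 f3 f4 f5 f6"
    and d: "\<And>x y. f1 (br x y) = 0"
      "\<And>x y. f2 (br x y) = 0"
      "\<And>x y. f3 (br x y) = 0"
      "\<And>x y. f4 (br x y) = 0"
      "\<And>x y. f5 (br x y) = wedge f1 f2 x y"
      "\<And>x y. f6 (br x y) = wedge f1 f5 x y + wedge f3 f4 x y"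
  shows "has_pure_frame br"
proof -
  note l = coframeD[OF cf]
  show ?thesis
  proof (rule has_pure_frameI[where ?f1.0 = f1 and ?f2.0 = f3 and ?f3.0 = f2 and ?f4.0 = f6 and
      ?f5.0 = f4 and ?f6.0 = "\<lambda>x. - f5 x - f4 x"], goal_cases)
    case 1
    show ?case by (rule coframeI) (auto intro!: linear_rules l)
  next
    case (2 b1 b3 b2 b6 b4 b5)
    note D = dual_frameD[OF 2]
    have v0: "f5 b5 = -1" using D by (simp add: field_simps)
    have v1: "f5 b4 = -1" using D by (simp add: field_simps)
    show ?case using D v0 v1
      by (simp add: unimodular_frame_def pure_frame_def cyc_def d wedge_def field_simps
          power2_eq_square)
  qed
qed

text \<open>In the new coframe the 3-form has only the coefficients 1, -2 and 1 at 136, 145 and 235;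
  the factor 2 makes the eighth equation of \<open>pure_frame\<close> hold.\<close>

lemma pure_frame_12_13_23:
  assumes cf: "coframe f1 f2 f3 f4 f5 f6"
    and d: "\<And>x y. f1 (br x y) = 0"
      "\<And>x y. f2 (br x y) = 0"
      "\<And>x y. f3 (br x y) = 0"
      "\<And>x y. f4 (br x y) = wedge f1 f2 x y"
      "\<And>x y. f5 (br x y) = wedge f1 f3 x y"
      "\<And>x y. f6 (br x y) = wedge f2 f3 x y"
  shows "has_pure_frame br"
proof -
  note l = coframeD[OF cf]
  show ?thesis
  proof (rule has_pure_frameI[where ?f1.0 = f1 and ?f2.0 = f6 and ?f3.0 = f2 and ?f4.0 =
      "\<lambda>x. 2 * f5 x" and ?f5.0 = f3 and ?f6.0 = f4], goal_cases)
    case 1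
    show ?case by (rule coframeI) (auto intro!: linear_rules l)
  next
    case (2 b1 b6 b2 b5 b3 b4)
    note D = dual_frameD[OF 2]
    have v0: "f5 b5 = 1 / 2" using D by (simp add: field_simps)
    show ?case using D v0
      by (simp add: unimodular_frame_def pure_frame_def cyc_def d wedge_def field_simps
          power2_eq_square)
  qed
qed

lemma pure_frame_12_13_14p23:
  assumes cf: "coframe f1 f2 f3 f4 f5 f6"
    and d: "\<And>x y. f1 (br x y) = 0"
      "\<And>x y. f2 (br x y) = 0"
      "\<And>x y. f3 (br x y) = 0"
      "\<And>x y. f4 (br x y) = wedge f1 f2 x y"
      "\<And>x y. f5 (br x y) = wedge f1 f3 x y"
      "\<And>x y. f6 (br x y) = wedge f1 f4 x y + s * wedge f2 f3 x y"
    and s: "s \<noteq> - 2"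
  shows "has_pure_frame br"
proof -
  \<comment> \<open>The seventh equation reads 2 t - 1 - s - 1 = 0 and forces \<open>t\<close>; the
    value \<open>s = - 2\<close> is excluded to keep it nonzero.\<close>
  define t where "t = 1 + s / 2"
  have t: "t \<noteq> 0" "s = 2 * t - 2" using s by (auto simp: t_def)
  note l = coframeD[OF cf]
  show ?thesis
  proof (rule has_pure_frameI[where ?f1.0 = "\<lambda>x. f1 x
      - t * f5 x" and ?f2.0 = f2 and ?f3.0 = f3 and ?f4.0 = f4 and ?f5.0 =
      "\<lambda>x. t * f5 x" and ?f6.0 = f6], goal_cases)
    case 1
    show ?case by (rule coframeI) (auto intro!: linear_rules l simp: t)
  next
    case (2 b1 b2 b3 b4 b5 b6)
    note D = dual_frameD[OF 2]
    have v0: "f5 b5 = 1 / t" using D t by (simp add: field_simps)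
    have v1: "f1 b5 = 1" using D t by (simp add: field_simps)
    show ?case using D v0 v1 t
      by (simp add: unimodular_frame_def pure_frame_def cyc_def d wedge_def field_simps
          power2_eq_square)
  qed
qed

lemma pure_frame_12_13_24p15:
  assumes cf: "coframe f1 f2 f3 f4 f5 f6"
    and d: "\<And>x y. f1 (br x y) = 0"
      "\<And>x y. f2 (br x y) = 0"
      "\<And>x y. f3 (br x y) = 0"
      "\<And>x y. f4 (br x y) = wedge f1 f2 x y"
      "\<And>x y. f5 (br x y) = wedge f1 f3 x y"
      "\<And>x y. f6 (br x y) = wedge f2 f4 x y + wedge f1 f5 x y"
  shows "has_pure_frame br"
proof -
  note l = coframeD[OF cf]
  \<comment> \<open>The summand \<open>- f3\<close> creates the coefficient at 356 that cancels the
    one at 123; \<open>- f2\<close> creates the one at 136 that cancels 145.\<close>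
  show ?thesis
  proof (rule has_pure_frameI[where ?f1.0 = f1 and ?f2.0 = "\<lambda>x. f4 x
      - f3 x" and ?f3.0 = f2 and ?f4.0 = "\<lambda>x. f5 x
      - f2 x" and ?f5.0 = f3 and ?f6.0 = f6], goal_cases)
    case 1
    show ?case by (rule coframeI) (auto intro!: linear_rules l)
  next
    case (2 b1 b4 b2 b5 b3 b6)
    note D = dual_frameD[OF 2]
    have v0: "f4 b3 = 1" using D by (simp add: field_simps)
    have v1: "f5 b2 = 1" using D by (simp add: field_simps)
    show ?case using D v0 v1
      by (simp add: unimodular_frame_def pure_frame_def cyc_def d wedge_def field_simps
          power2_eq_square)
  qed
qed

lemma pure_frame_12_14p23_15m34:
  assumes cf: "coframe f1 f2 f3 f4 f5 f6"
    and d: "\<And>x y. f1 (br x y) = 0"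
      "\<And>x y. f2 (br x y) = 0"
      "\<And>x y. f3 (br x y) = 0"
      "\<And>x y. f4 (br x y) = wedge f1 f2 x y"
      "\<And>x y. f5 (br x y) = wedge f1 f4 x y + wedge f2 f3 x y"
      "\<And>x y. f6 (br x y) = wedge f1 f5 x y - wedge f3 f4 x y"
  shows "has_pure_frame br"
proof -
  note l = coframeD[OF cf]
  show ?thesis
  proof (rule has_pure_frameI[where ?f1.0 = f1 and ?f2.0 = f3 and ?f3.0 = f2 and ?f4.0 =
      "\<lambda>x. f4 x / 2" and ?f5.0 = f5 and ?f6.0 = "\<lambda>x. - (f6 x / 2)"], goal_cases)
    case 1
    show ?case by (rule coframeI) (auto intro!: linear_rules l)
  next
    case (2 b1 b3 b2 b4 b5 b6)
    note D = dual_frameD[OF 2]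
    have v0: "f4 b4 = 2" using D by (simp add: field_simps)
    have v1: "f6 b6 = -2" using D by (simp add: field_simps)
    show ?case using D v0 v1
      by (simp add: unimodular_frame_def pure_frame_def cyc_def d wedge_def field_simps
          power2_eq_square)
  qed
qed

lemma pure_frame_12_14_15p24p23:
  assumes cf: "coframe f1 f2 f3 f4 f5 f6"
    and d: "\<And>x y. f1 (br x y) = 0"
      "\<And>x y. f2 (br x y) = 0"
      "\<And>x y. f3 (br x y) = 0"
      "\<And>x y. f4 (br x y) = wedge f1 f2 x y"
      "\<And>x y. f5 (br x y) = wedge f1 f4 x y"
      "\<And>x y. f6 (br x y) = wedge f1 f5 x y + v * wedge f2 f4 x y + z * wedge f2 f3 x y"
    and z: "z \<noteq> 0"
  shows "has_pure_frame br"
proof -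
  note l = coframeD[OF cf]
  \<comment> \<open>The summand \<open>v * f4\<close> of the second form makes the coefficients at
    123 and 356 opposite; the summand \<open>f4\<close> of the last form gives the coefficient 1 at
    136 that cancels -1 at 145.\<close>
  show ?thesis
  proof (rule has_pure_frameI[where ?f1.0 = f1 and ?f2.0 = "\<lambda>x. 2 * z * f3 x
      + v * f4 x" and ?f3.0 = f2 and ?f4.0 = f5 and ?f5.0 = f4 and ?f6.0 = "\<lambda>x. 2 * f6 x
      + f4 x"], goal_cases)
    case 1
    show ?case by (rule coframeI) (auto intro!: linear_rules l simp: z)
  next
    case (2 b1 b3 b2 b5 b4 b6)
    note D = dual_frameD[OF 2]
    have v0: "f3 b3 = 1 / (2 * z)" using D z by (simp add: field_simps)
    have v1: "f3 b4 = - v / (2 * z)" using D z by (simp add: field_simps)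
    have v2: "f6 b6 = 1 / 2" using D z by (simp add: field_simps)
    have v3: "f6 b4 = - 1 / 2" using D z by (simp add: field_simps)
    show ?case using D v0 v1 v2 v3 z
      by (simp add: unimodular_frame_def pure_frame_def cyc_def d wedge_def field_simps
          power2_eq_square)
  qed
qed

lemma pure_frame_12_14p23_24p13:
  assumes cf: "coframe f1 f2 f3 f4 f5 f6"
    and d: "\<And>x y. f1 (br x y) = 0"
      "\<And>x y. f2 (br x y) = 0"
      "\<And>x y. f3 (br x y) = 0"
      "\<And>x y. f4 (br x y) = wedge f1 f2 x y"
      "\<And>x y. f5 (br x y) = wedge f1 f4 x y + y' * wedge f2 f3 x y"
      "\<And>x y. f6 (br x y) = wedge f2 f4 x y + z * wedge f1 f3 x y"
    and y': "y' \<noteq> 0"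
  shows "has_pure_frame br"
proof -
  \<comment> \<open>The eighth equation is t/c + z/c^2 + y' = 0, which determines \<open>t\<close>.
    The scale \<open>c\<close> of \<open>f1\<close> is changed only when \<open>c = 1\<close> would
    give \<open>t = 0\<close>.\<close>
  define c :: real where "c = (if y' + z = 0 then 2 else 1)"
  define t where "t = - (c * (y' + z / c\<^sup>2))"
  have ct: "c \<noteq> 0" "t \<noteq> 0" using y' by (auto simp: c_def t_def add_eq_0_iff)
  note l = coframeD[OF cf]
  show ?thesis
  proof (rule has_pure_frameI[where ?f1.0 = "\<lambda>x. c * f1 x" and ?f2.0 = f5 and ?f3.0 = f2 and ?f4.0
      = "\<lambda>x. - (f6 x / c)" and ?f5.0 = f3 and ?f6.0 = "\<lambda>x. t * f4 x"], goal_cases)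
    case 1
    show ?case by (rule coframeI) (auto intro!: linear_rules l simp: ct)
  next
    case (2 b1 b5 b2 b6 b3 b4)
    note D = dual_frameD[OF 2]
    have v0: "f1 b1 = 1 / c" using D ct by (simp add: field_simps)
    have v1: "f4 b4 = 1 / t" using D ct by (simp add: field_simps)
    have v2: "f6 b6 = - c" using D ct by (simp add: field_simps)
    show ?case using D v0 v1 v2 ct
      by (simp add: unimodular_frame_def pure_frame_def cyc_def d wedge_def)
        (simp add: t_def field_simps power2_eq_square)
  qed
qed

lemma pure_frame_12_13_23_14p25:
  assumes cf: "coframe f1 f2 f3 f4 f5 f6"
    and d: "\<And>x y. f1 (br x y) = 0"
      "\<And>x y. f2 (br x y) = 0"
      "\<And>x y. f3 (br x y) = wedge f1 f2 x y"
      "\<And>x y. f4 (br x y) = wedge f1 f3 x y"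
      "\<And>x y. f5 (br x y) = wedge f2 f3 x y"
      "\<And>x y. f6 (br x y) = l * wedge f1 f4 x y + m * wedge f2 f5 x y"
    and l: "l \<noteq> 0"
  shows "has_pure_frame br"
proof -
  \<comment> \<open>The seventh equation is (t - l)/c + m c = 0, which determines \<open>t\<close>;
    for \<open>l = m\<close> the scale \<open>c = 2\<close> keeps \<open>t\<close> nonzero.\<close>
  define c :: real where "c = (if l = m then 2 else 1)"
  define t where "t = l - m * c\<^sup>2"
  have ct: "c \<noteq> 0" "t \<noteq> 0" using l by (auto simp: c_def t_def)
  note l = coframeD[OF cf]
  show ?thesis
  proof (rule has_pure_frameI[where ?f1.0 = "\<lambda>x. c * f1 x" and ?f2.0 =
      "\<lambda>x. f5 x / c" and ?f3.0 = f2 and ?f4.0 = f4 and ?f5.0 =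
      "\<lambda>x. t * f3 x" and ?f6.0 = f6], goal_cases)
    case 1
    show ?case by (rule coframeI) (auto intro!: linear_rules l simp: ct)
  next
    case (2 b1 b5 b2 b4 b3 b6)
    note D = dual_frameD[OF 2]
    have v0: "f1 b1 = 1 / c" using D ct by (simp add: field_simps)
    have v1: "f5 b5 = c" using D ct by (simp add: field_simps)
    have v2: "f3 b3 = 1 / t" using D ct by (simp add: field_simps)
    show ?case using D v0 v1 v2 ct
      by (simp add: unimodular_frame_def pure_frame_def cyc_def d wedge_def)
        (simp add: t_def field_simps power2_eq_square)
  qed
qed

lemma pure_frame_12_13_14p23_25m34:
  assumes cf: "coframe f1 f2 f3 f4 f5 f6"
    and d: "\<And>x y. f1 (br x y) = 0"
      "\<And>x y. f2 (br x y) = 0"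
      "\<And>x y. f3 (br x y) = wedge f1 f2 x y"
      "\<And>x y. f4 (br x y) = wedge f1 f3 x y"
      "\<And>x y. f5 (br x y) = wedge f1 f4 x y + q * wedge f2 f3 x y"
      "\<And>x y. f6 (br x y) = wedge f2 f5 x y - wedge f3 f4 x y"
  shows "has_pure_frame br"
proof -
  note l = coframeD[OF cf]
  \<comment> \<open>With these factors the seventh equation becomes 1 - 1/2 - 1/3 - 1/6 = 0 and the
    eighth 3 - 2 - 1 = 0; the summand \<open>q * f3\<close> balances 123 against 356.\<close>
  show ?thesis
  proof (rule has_pure_frameI[where ?f1.0 = f1 and ?f2.0 = "\<lambda>x. f6 x / 3
      + q * f3 x" and ?f3.0 = f2 and ?f4.0 = "\<lambda>x. 2 * f4 x" and ?f5.0 = f3 and ?f6.0 = "\<lambda>x. f5 x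
      + 3 * f3 x"], goal_cases)
    case 1
    show ?case by (rule coframeI) (auto intro!: linear_rules l)
  next
    case (2 b1 b6 b2 b4 b3 b5)
    note D = dual_frameD[OF 2]
    have v0: "f4 b4 = 1 / 2" using D by (simp add: field_simps)
    have v1: "f5 b3 = - 3" using D by (simp add: field_simps)
    have v2: "f6 b6 = 3" using D by (simp add: field_simps)
    have v3: "f6 b3 = - 3 * q" using D by (simp add: field_simps)
    show ?case using D v0 v1 v2 v3
      by (simp add: unimodular_frame_def pure_frame_def cyc_def d wedge_def field_simps
          power2_eq_square)
  qed
qed

lemma pure_frame_12_13_14p23_15p24:
  assumes cf: "coframe f1 f2 f3 f4 f5 f6"
    and d: "\<And>x y. f1 (br x y) = 0"
      "\<And>x y. f2 (br x y) = 0"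
      "\<And>x y. f3 (br x y) = wedge f1 f2 x y"
      "\<And>x y. f4 (br x y) = wedge f1 f3 x y"
      "\<And>x y. f5 (br x y) = wedge f1 f4 x y + q * wedge f2 f3 x y"
      "\<And>x y. f6 (br x y) = wedge f1 f5 x y + q * wedge f2 f4 x y"
    and q: "q \<noteq> 0"
  shows "has_pure_frame br"
proof -
  \<comment> \<open>Adding a multiple of the closed form \<open>f1\<close> to the fourth form does
    not change its differential but puts - q s at 136; the eighth equation - q s - 1 - q^2 = 0 then
    gives \<open>s\<close>.\<close>
  define s where "s = - (1 + q\<^sup>2) / q"
  note l = coframeD[OF cf]
  show ?thesis
  proof (rule has_pure_frameI[where ?f1.0 = f1 and ?f2.0 = "\<lambda>x.
      - q * f6 x" and ?f3.0 = f2 and ?f4.0 = "\<lambda>x. - f3 x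
      + s * f1 x" and ?f5.0 = f4 and ?f6.0 = f5], goal_cases)
    case 1
    show ?case by (rule coframeI) (auto intro!: linear_rules l simp: q)
  next
    case (2 b1 b6 b2 b3 b4 b5)
    note D = dual_frameD[OF 2]
    have v0: "f3 b3 = - 1" using D q by (simp add: field_simps)
    have v1: "f3 b1 = s" using D q by (simp add: field_simps)
    have v2: "f6 b6 = - 1 / q" using D q by (simp add: field_simps)
    show ?case using D v0 v1 v2 q
      by (simp add: unimodular_frame_def pure_frame_def cyc_def d wedge_def)
        (simp add: s_def field_simps power2_eq_square)
  qed
qed

lemma pure_frame_12_13_14_15p23:
  assumes cf: "coframe f1 f2 f3 f4 f5 f6"
    and d: "\<And>x y. f1 (br x y) = 0"
      "\<And>x y. f2 (br x y) = 0"
      "\<And>x y. f3 (br x y) = wedge f1 f2 x y"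
      "\<And>x y. f4 (br x y) = wedge f1 f3 x y"
      "\<And>x y. f5 (br x y) = wedge f1 f4 x y"
      "\<And>x y. f6 (br x y) = wedge f1 f5 x y + z * wedge f2 f3 x y"
  shows "has_pure_frame br"
proof -
  \<comment> \<open>\<open>k\<close> is the coefficient at 123, opposite to the one at 356, and also
    the scale of \<open>f4\<close>, so \<open>t\<close> is chosen to keep it nonzero. The multiple
    of \<open>f3\<close> in the fourth form settles the fourth and eighth equations.\<close>
  define t :: real where "t = (if 1 + z = 0 then 2 else 1)"
  define k where "k = 1 + z * t"
  have kt: "t \<noteq> 0" "k \<noteq> 0" by (auto simp: k_def t_def)
  note l = coframeD[OF cf]
  show ?thesis
  proof (rule has_pure_frameI[where ?f1.0 = "\<lambda>x. f1 x
      + t * f6 x" and ?f2.0 = f2 and ?f3.0 = f3 and ?f4.0 = "\<lambda>x. t * f5 x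
      - t / k * f3 x" and ?f5.0 = "\<lambda>x. k * f4 x" and ?f6.0 = "\<lambda>x. t * f6 x"], goal_cases)
    case 1
    show ?case by (rule coframeI) (auto intro!: linear_rules l simp: kt)
  next
    case (2 b1 b2 b3 b5 b4 b6)
    note D = dual_frameD[OF 2]
    have v0: "f6 b6 = 1 / t" using D kt by (simp add: field_simps)
    have v1: "f1 b6 = - 1" using D kt by (simp add: field_simps)
    have v2: "f4 b4 = 1 / k" using D kt by (simp add: field_simps)
    have v3: "f5 b5 = 1 / t" using D kt by (simp add: field_simps)
    have v4: "f5 b3 = 1 / k" using D kt by (simp add: field_simps)
    show ?case using D v0 v1 v2 v3 v4 kt
      by (simp add: unimodular_frame_def pure_frame_def cyc_def d wedge_def)
        (simp add: k_def field_simps power2_eq_square)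
  qed
qed

lemma pure_frame_12_34:
  assumes cf: "coframe f1 f2 f3 f4 f5 f6"
    and d: "\<And>x y. f1 (br x y) = 0"
      "\<And>x y. f2 (br x y) = 0"
      "\<And>x y. f3 (br x y) = 0"
      "\<And>x y. f4 (br x y) = 0"
      "\<And>x y. f5 (br x y) = wedge f1 f2 x y"
      "\<And>x y. f6 (br x y) = wedge f3 f4 x y"
  shows "has_pure_frame br"
proof -
  note l = coframeD[OF cf]
  \<comment> \<open>Without the two shears the seventh equation would fail. They produce the
    coefficient 1/2 at 146 and at 236, so that it becomes 1 - 1/2 - 1/2 = 0.\<close>
  show ?thesis
  proof (rule has_pure_frameI[where ?f1.0 = f1 and ?f2.0 = "\<lambda>x. f4 x
      + f1 x" and ?f3.0 = f2 and ?f4.0 = "\<lambda>x. f3 x + f2 x" and ?f5.0 = f5 and ?f6.0 =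
      "\<lambda>x. f6 x / 2"], goal_cases)
    case 1
    show ?case by (rule coframeI) (auto intro!: linear_rules l)
  next
    case (2 b1 b4 b2 b3 b5 b6)
    note D = dual_frameD[OF 2]
    have v0: "f3 b2 = -1" using D by (simp add: field_simps)
    have v1: "f4 b1 = -1" using D by (simp add: field_simps)
    have v2: "f6 b6 = 2" using D by (simp add: field_simps)
    show ?case using D v0 v1 v2
      by (simp add: unimodular_frame_def pure_frame_def cyc_def d wedge_def field_simps
          power2_eq_square)
  qed
qed

lemma pure_frame_symplectic:
  assumes cf: "coframe f1 f2 f3 f4 f5 f6"
    and d: "\<And>x y. f1 (br x y) = 0"
      "\<And>x y. f2 (br x y) = 0"
      "\<And>x y. f3 (br x y) = 0"
      "\<And>x y. f4 (br x y) = 0"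
      "\<And>x y. f5 (br x y) = wedge f1 f2 x y + wedge f3 f4 x y"
      "\<And>x y. f6 (br x y) = p * (wedge f1 f2 x y - wedge f3 f4 x y)
         + q * wedge f1 f3 x y
         + r * (wedge f1 f4 x y - wedge f2 f3 x y)
         + s * wedge f2 f4 x y"
    and qs: "q \<noteq> s"
  shows "has_pure_frame br"
proof -
  \<comment> \<open>The differentials of \<open>f5\<close> and of the rescaled \<open>f6\<close>
    contribute 2 and - 2 (q - s)/m to the seventh equation, hence this \<open>m\<close>.\<close>
  define m where "m = q - s"
  have m: "m \<noteq> 0" "q = s + m" using qs by (simp_all add: m_def)
  note l = coframeD[OF cf]
  show ?thesis
  proof (rule has_pure_frameI[where ?f1.0 = f1 and ?f2.0 = f4 and ?f3.0 = f2 and ?f4.0 = f3 and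
      ?f5.0 = f5 and ?f6.0 = "\<lambda>x. 2 / m * f6 x"], goal_cases)
    case 1
    show ?case by (rule coframeI) (auto intro!: linear_rules l simp: m)
  next
    case (2 b1 b4 b2 b3 b5 b6)
    note D = dual_frameD[OF 2]
    have v0: "f6 b6 = m / 2" using D m by (simp add: field_simps)
    show ?case using D v0 m
      by (simp add: unimodular_frame_def pure_frame_def cyc_def d wedge_def field_simps
          power2_eq_square)
  qed
qed

lemma pure_frame_12_13_24p35:
  assumes cf: "coframe f1 f2 f3 f4 f5 f6"
    and d: "\<And>x y. f1 (br x y) = 0"
      "\<And>x y. f2 (br x y) = 0"
      "\<And>x y. f3 (br x y) = 0"
      "\<And>x y. f4 (br x y) = wedge f1 f2 x y"
      "\<And>x y. f5 (br x y) = wedge f1 f3 x y"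
      "\<And>x y. f6 (br x y) = wedge f2 f4 x y + k * wedge f3 f5 x y"
    and vt: "v \<noteq> 0" "t \<noteq> 0"
    and eq: "v\<^sup>2 * (1 - v) + t\<^sup>2 * k * (k - v) = 0"
  shows "has_pure_frame br"
proof -
  \<comment> \<open>The eighth equation gives \<open>s\<close>. The seventh then becomes
    \<open>eq\<close>, a relation between the free scales \<open>v\<close> and \<open>t\<close> that
    is solved later according to the sign of \<open>k\<close>.\<close>
  define s where "s = t * (k / v - 1)"
  note l = coframeD[OF cf]
  show ?thesis
  proof (rule has_pure_frameI[where ?f1.0 = f1 and ?f2.0 =
      "\<lambda>x. t * f6 x" and ?f3.0 = f2 and ?f4.0 = f3 and ?f5.0 = f4 and ?f6.0 = "\<lambda>x. v * f5 x
      + s * f4 x"], goal_cases)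
    case 1
    show ?case by (rule coframeI) (auto intro!: linear_rules l simp: vt)
  next
    case (2 b1 b6 b2 b3 b4 b5)
    note D = dual_frameD[OF 2]
    have v0: "f5 b5 = 1 / v" using D vt by (simp add: field_simps)
    have v1: "f5 b4 = - s / v" using D vt by (simp add: field_simps)
    have v2: "f6 b6 = 1 / t" using D vt by (simp add: field_simps)
    show ?case using D v0 v1 v2 vt
      using eq by (simp add: unimodular_frame_def pure_frame_def cyc_def d wedge_def)
        (simp add: s_def field_simps power2_eq_square)
  qed
qed

section \<open>At least four independent closed forms\<close>

lemma two_step_orthogonal:
  assumes cf: "coframe f1 f2 f3 f4 f5 f6"
    and d: "\<And>x y. f1 (br x y) = 0" "\<And>x y. f2 (br x y) = 0"
      "\<And>x y. f3 (br x y) = 0" "\<And>x y. f4 (br x y) = 0"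
      "\<And>x y. f5 (br x y) = wedge f1 f2 x y + wedge f3 f4 x y"
      "\<And>x y. f6 (br x y) = p * (wedge f1 f2 x y - wedge f3 f4 x y) + q * wedge f1 f3 x y
         + r * wedge f1 f4 x y + t * wedge f2 f3 x y + u * wedge f2 f4 x y"
    and ne: "q \<noteq> u \<or> r \<noteq> - t"
  shows "has_pure_frame br"
proof -
  \<comment> \<open>Under rotations of (f3, f4), which preserve 34, the pair (q - u, r + t) rotates
    like a plane vector of length \<open>R\<close>. Turning it onto the positive first axis gives
    the shape required by \<open>pure_frame_symplectic\<close>.\<close>
  define R where "R = sqrt ((q - u)\<^sup>2 + (r + t)\<^sup>2)"
  have R: "R \<noteq> 0" "R\<^sup>2 = (q - u)\<^sup>2 + (r + t)\<^sup>2"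
    using ne by (auto simp: R_def add_nonneg_eq_0_iff)
  define c s where "c = (q - u) / R" and "s = (r + t) / R"
  have cs': "c * (q - u) + s * (r + t) = R"
    using R by (simp add: c_def s_def add_divide_distrib[symmetric] power2_eq_square[symmetric]
        divide_eq_eq)
  have rot: "s * (q - u) = c * (r + t)" by (simp add: c_def s_def)
  have "c * R = q - u" "s * R = r + t" using R(1) by (simp_all add: c_def s_def)
  then have "(c * c + s * s) * R\<^sup>2 = R\<^sup>2" using R(2) by algebra
  then have cs: "c * c + s * s = 1" using R(1) by simp
  note l = coframeD[OF cf]
  have "q * c + r * s \<noteq> u * c - t * s"
    using cs' R(1) by (auto simp: algebra_simps)
  moreover have "coframe f1 f2 (\<lambda>x. c * f3 x + s * f4 x) (\<lambda>x. c * f4 x - s * f3 x) f5 f6"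
  proof (rule coframeI)
    fix x assume z: "f1 x = 0" "f2 x = 0" "c * f3 x + s * f4 x = 0" "c * f4 x - s * f3 x = 0"
        "f5 x = 0" "f6 x = 0"
    have "f3 x = 0" using z(3,4) cs by algebra
    moreover have "f4 x = 0" using z(3,4) cs by algebra
    ultimately show "x = 0" using z by (intro l) simp_all
  qed (auto intro!: linear_rules l)
  ultimately show ?thesis
  proof (rule pure_frame_symplectic[rotated -1, where p = p and r = "r * c - q * s"], goal_cases)
    case (5 x y)
    show ?case unfolding d wedge_def using cs by algebra
  next
    case (6 x y)
    show ?case unfolding d wedge_def using cs rot by algebra
  qed (simp_all add: d)
qed

lemma two_step_darboux:
  assumes cf: "coframe f1 f2 f3 f4 f5 f6"
    and d: "\<And>x y. f1 (br x y) = 0" "\<And>x y. f2 (br x y) = 0"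
      "\<And>x y. f3 (br x y) = 0" "\<And>x y. f4 (br x y) = 0"
      "\<And>x y. f5 (br x y) = wedge f1 f2 x y + wedge f3 f4 x y"
      "\<And>x y. f6 (br x y) = form4 f1 f2 f3 f4 s12 s13 s14 s23 s24 s34 x y"
  shows "has_pure_frame br"
proof -
  define p where "p = (s12 - s34) / 2"
  \<comment> \<open>This multiple of \<open>f5\<close> makes the coefficients at 12 and 34 opposite,
    so the two differentials become orthogonal for the wedge pairing.\<close>
  define g6 where "g6 x = f6 x - (s12 + s34) / 2 * f5 x" for x
  note l = coframeD[OF cf]
  have lin: "linear g6" unfolding g6_def by (intro linear_rules l)
  have d6: "g6 (br x y) = p * (wedge f1 f2 x y - wedge f3 f4 x y) + s13 * wedge f1 f3 x y
         + s14 * wedge f1 f4 x y + s23 * wedge f2 f3 x y + s24 * wedge f2 f4 x y" for x y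
    unfolding g6_def d p_def by (simp add: field_simps)
  have cf': "coframe f1 f2 f3 f4 f5 g6"
    by (rule coframeI) (auto intro!: linear_rules lin l simp: g6_def)
  consider "s13 \<noteq> s24 \<or> s14 \<noteq> - s23" | "s13 = s24" "s14 = - s23" "s13 \<noteq> 0 \<or> s14 \<noteq> 0"
    | "s13 = 0" "s24 = 0" "s14 = 0" "s23 = 0" "p \<noteq> 0"
    | "s13 = 0" "s24 = 0" "s14 = 0" "s23 = 0" "p = 0" by force
  then show ?thesis
  proof cases
    case 1
    show ?thesis by (rule two_step_orthogonal[OF cf' d(1-5) d6 1])
  next
    case 2
    \<comment> \<open>Here the vector to be rotated vanishes. Scaling \<open>f1\<close> and
      \<open>f2\<close> by inverse factors preserves 12 and 34 but scales 13, 14 and 23, 24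
      oppositely, which makes it nonzero.\<close>
    show ?thesis
    proof (rule two_step_orthogonal[of "\<lambda>x. f1 x / 2" "\<lambda>x. 2 * f2 x" f3 f4 f5 g6 p
          "2 * s13" "2 * s14" "s23 / 2" "s24 / 2"], goal_cases)
      case 1
      show ?case by (rule coframeI) (auto intro!: linear_rules lin l simp: g6_def)
    qed (use 2 in \<open>auto simp: d d6 wedge_def field_simps\<close>)
  next
    case 3
    show ?thesis
    proof (rule pure_frame_12_34[of f1 f2 f3 f4 "\<lambda>x. (f5 x + g6 x / p) / 2" "\<lambda>x. (f5 x
        - g6 x / p) / 2"], goal_cases)
      case 1
      have half: "a = 0 \<and> b = 0" if "(a + b / p) / 2 = 0" "(a - b / p) / 2 = 0" for a b :: real
        using that 3 by auto
      show ?case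
      proof (rule coframeI)
        fix x assume "f1 x = 0" "f2 x = 0" "f3 x = 0" "f4 x = 0"
          "(f5 x + g6 x / p) / 2 = 0" "(f5 x - g6 x / p) / 2 = 0"
        then show "x = 0" using half[of "f5 x" "g6 x"] by (intro coframeD(7)[OF cf']) auto
      qed (auto intro!: linear_rules lin l)
    qed (use 3 in \<open>auto simp: d d6 field_simps\<close>)
  next
    case 4
    have "coframe g6 f1 f2 f3 f4 f5" using cf' by (auto simp: coframe_def)
    then have False
      by (rule no_unused_closed_form) (use 4 in \<open>auto simp: d d6 wedge_def\<close>)
    then show ?thesis ..
  qed
qed

text \<open>Splitting off the product \<open>g1\<close>, \<open>g2\<close> at the pivot
  \<open>a12\<close> leaves only a multiple of 34. Its coefficient is the Pfaffian over
  \<open>a12\<close>, so the Pfaffian decides whether the 2-form is a single product.\<close>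

lemma two_form_normal_form:
  assumes cf: "coframe f1 f2 f3 f4 f5 f6"
    and d: "\<And>x y. f1 (br x y) = 0" "\<And>x y. f2 (br x y) = 0"
      "\<And>x y. f3 (br x y) = 0" "\<And>x y. f4 (br x y) = 0"
      "\<And>x y. f5 (br x y) = form4 f1 f2 f3 f4 a12 a13 a14 a23 a24 a34 x y"
      "\<And>x y. f6 (br x y) = form4 f1 f2 f3 f4 s12 s13 s14 s23 s24 s34 x y"
    and a: "a12 \<noteq> 0"
  obtains g1 g2 t12 t13 t14 t23 t24 t34 where "coframe g1 g2 f3 f4 f5 f6"
    "\<And>x y. g1 (br x y) = 0" "\<And>x y. g2 (br x y) = 0"
    "\<And>x y. f5 (br x y) = wedge g1 g2 x y + (a12 * a34 - a13 * a24
        + a14 * a23) / a12 * wedge f3 f4 x y"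
    "\<And>x y. f6 (br x y) = form4 g1 g2 f3 f4 t12 t13 t14 t23 t24 t34 x y"
proof
  define g1 where "g1 x = a12 * f1 x - a23 * f3 x - a24 * f4 x" for x
  define g2 where "g2 x = f2 x + a13 / a12 * f3 x + a14 / a12 * f4 x" for x
  note l = coframeD[OF cf]
  have f1: "f1 x = (g1 x + a23 * f3 x + a24 * f4 x) / a12" for x using a by (simp add: g1_def)
  have f2: "f2 x = g2 x - a13 / a12 * f3 x - a14 / a12 * f4 x" for x by (simp add: g2_def)
  show "coframe g1 g2 f3 f4 f5 f6"
  proof (rule coframeI)
    fix x assume "g1 x = 0" "g2 x = 0" "f3 x = 0" "f4 x = 0" "f5 x = 0" "f6 x = 0"
    then show "x = 0" by (intro l) (simp_all add: f1 f2)
  qed (auto simp: g1_def[abs_def] g2_def[abs_def] intro!: linear_rules l)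
  show "g1 (br x y) = 0" "g2 (br x y) = 0" for x y by (simp_all add: g1_def g2_def d)
  show "f5 (br x y) = wedge g1 g2 x y + (a12 * a34 - a13 * a24
      + a14 * a23) / a12 * wedge f3 f4 x y" for x y
    unfolding d wedge_def g1_def g2_def using a by (simp add: field_simps)
  show "f6 (br x y) = s12 / a12 * wedge g1 g2 x y + (s13 / a12
      - s12 * a13 / (a12 * a12)) * wedge g1 f3 x y
      + (s14 / a12 - s12 * a14 / (a12 * a12)) * wedge g1 f4 x y + (s23
          - s12 * a23 / a12) * wedge g2 f3 x y
      + (s24 - s12 * a24 / a12) * wedge g2 f4 x y
      + (s34 + (s14 * a23 - s13 * a24 + s23 * a14 - s24 * a13) / a12
          + s12 * (a13 * a24 - a14 * a23) / (a12 * a12)) * wedge f3 f4 x y" for x y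
    unfolding d wedge_def f1[of x] f1[of y] f2[of x] f2[of y] using a by (simp add: field_simps)
qed

lemma two_step_nondegenerate:
  assumes cf: "coframe f1 f2 f3 f4 f5 f6"
    and d: "\<And>x y. f1 (br x y) = 0" "\<And>x y. f2 (br x y) = 0"
      "\<And>x y. f3 (br x y) = 0" "\<And>x y. f4 (br x y) = 0"
      "\<And>x y. f5 (br x y) = form4 f1 f2 f3 f4 a12 a13 a14 a23 a24 a34 x y"
      "\<And>x y. f6 (br x y) = form4 f1 f2 f3 f4 s12 s13 s14 s23 s24 s34 x y"
    and a: "a12 \<noteq> 0" and pf: "a12 * a34 - a13 * a24 + a14 * a23 \<noteq> 0"
  shows "has_pure_frame br"
proof -
  define c where "c = (a12 * a34 - a13 * a24 + a14 * a23) / a12"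
  have c: "c \<noteq> 0" using a pf by (simp add: c_def)
  obtain g1 g2 t12 t13 t14 t23 t24 t34 where g: "coframe g1 g2 f3 f4 f5 f6"
    "\<And>x y. g1 (br x y) = 0" "\<And>x y. g2 (br x y) = 0"
    "\<And>x y. f5 (br x y) = wedge g1 g2 x y + c * wedge f3 f4 x y"
    "\<And>x y. f6 (br x y) = form4 g1 g2 f3 f4 t12 t13 t14 t23 t24 t34 x y"
    unfolding c_def by (rule two_form_normal_form[OF cf d a]) blast
  note l = coframeD[OF g(1)]
  show ?thesis
  proof (rule two_step_darboux[of g1 g2 "\<lambda>x. c * f3 x" f4 f5 f6 t12 "t13 / c" t14 "t23 / c" t24
      "t34 / c"], goal_cases)
    case 1
    show ?case by (rule coframeI) (use c in \<open>auto intro!: linear_rules l\<close>)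
  qed (use c in \<open>auto simp: g d wedge_def field_simps\<close>)
qed

lemma two_step_split:
  assumes cf: "coframe f1 f2 f3 f4 f5 f6"
    and d: "\<And>x y. f1 (br x y) = 0" "\<And>x y. f2 (br x y) = 0"
      "\<And>x y. f3 (br x y) = 0" "\<And>x y. f4 (br x y) = 0"
      "\<And>x y. f5 (br x y) = wedge f1 f2 x y"
      "\<And>x y. f6 (br x y) = form4 f1 f2 f3 f4 s12 s13 s14 s23 s24 s34 x y"
  shows "has_pure_frame br"
proof (cases "s34 = 0 \<and> s13 * s24 = s14 * s23")
  case False
  \<comment> \<open>\<open>P t\<close> is the Pfaffian of the differential of
    \<open>f6 + t f5\<close>. It is affine in \<open>t\<close> and not identically zero, so one of
    the two values of \<open>t\<close> that make the leading coefficient 1 or 2 is not a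
    root.\<close>
  define P where "P t = (s12 + t) * s34 - s13 * s24 + s14 * s23" for t
  define t where "t = (if P (1 - s12) = 0 then 2 - s12 else 1 - s12)"
  have t: "s12 + t \<noteq> 0" "P t \<noteq> 0" using False by (auto simp: t_def P_def)
  note l = coframeD[OF cf]
  show ?thesis
  proof (rule two_step_nondegenerate[of f1 f2 f3 f4 "\<lambda>x. f6 x + t * f5 x" f5 "s12
      + t" s13 s14 s23 s24 s34
        1 0 0 0 0 0], goal_cases)
    case 1
    show ?case by (rule coframeI) (auto intro!: linear_rules l)
  qed (use t in \<open>auto simp: d P_def algebra_simps\<close>)
next
  case True
  \<comment> \<open>The singular block of coefficients pairing (f1, f2) with (f3, f4) has a kernel
    vector (u, v). Then \<open>u b3 + v b4\<close> is central and detected by \<open>f3\<close> or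
    \<open>f4\<close>.\<close>
  obtain u v where uv: "s13 * u + s14 * v = 0" "s23 * u + s24 * v = 0" "u \<noteq> 0 \<or> v \<noteq> 0"
  proof (cases "s13 = 0 \<and> s14 = 0")
    case True
    show ?thesis
    proof (cases "s23 = 0 \<and> s24 = 0")
      case True
      then show ?thesis using \<open>s13 = 0 \<and> s14 = 0\<close> that[of 1 0] by simp
    next
      case False
      then show ?thesis using True that[of s24 "- s23"] by (auto simp: algebra_simps)
    qed
  next
    case False
    then show ?thesis using True that[of s14 "- s13"] by (auto simp: algebra_simps)
  qed
  obtain b1 b2 b3 b4 b5 b6 where "dual_frame f1 f2 f3 f4 f5 f6 b1 b2 b3 b4 b5 b6"
    using ex_dual_frame[OF dim6 cf] by blast
  note D = dual_frameD[OF this]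
  note l = coframeD[OF cf]
  define z where "z = u *\<^sub>R b3 + v *\<^sub>R b4"
  have z: "f1 z = 0" "f2 z = 0" "f3 z = u" "f4 z = v"
    by (simp_all add: z_def l linear_add linear_scale D)
  have k: "s13 * (u * a) + s14 * (v * a) = 0" "s23 * (u * a) + s24 * (v * a) = 0" for a
    using uv(1,2) by algebra+
  have "f6 (br z y) = 0" for y
    using k[of "f1 y"] k[of "f2 y"] True by (simp add: d wedge_def z)
  note zz = no_central_factor[OF cf, of z, OF _ _ _ _ _ this]
  have False
  proof (cases "u = 0")
    case True
    then show ?thesis using uv(3) by (intro zz[of f4]) (auto simp: d wedge_def z l)
  next
    case False
    then show ?thesis by (intro zz[of f3]) (auto simp: d wedge_def z l)
  qed
  then show ?thesis ..
qed

lemma two_step_leading: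
  assumes cf: "coframe f1 f2 f3 f4 f5 f6"
    and d: "\<And>x y. f1 (br x y) = 0" "\<And>x y. f2 (br x y) = 0"
      "\<And>x y. f3 (br x y) = 0" "\<And>x y. f4 (br x y) = 0"
      "\<And>x y. f5 (br x y) = form4 f1 f2 f3 f4 a12 a13 a14 a23 a24 a34 x y"
      "\<And>x y. f6 (br x y) = form4 f1 f2 f3 f4 s12 s13 s14 s23 s24 s34 x y"
    and a: "a12 \<noteq> 0"
  shows "has_pure_frame br"
proof (cases "a12 * a34 - a13 * a24 + a14 * a23 = 0")
  case False
  show ?thesis by (rule two_step_nondegenerate[OF cf d a False])
next
  case True
  obtain g1 g2 t12 t13 t14 t23 t24 t34 where g: "coframe g1 g2 f3 f4 f5 f6"
    "\<And>x y. g1 (br x y) = 0" "\<And>x y. g2 (br x y) = 0"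
    "\<And>x y. f5 (br x y) = wedge g1 g2 x y + (a12 * a34 - a13 * a24
        + a14 * a23) / a12 * wedge f3 f4 x y"
    "\<And>x y. f6 (br x y) = form4 g1 g2 f3 f4 t12 t13 t14 t23 t24 t34 x y"
    by (rule two_form_normal_form[OF cf d a]) blast
  have "f5 (br x y) = wedge g1 g2 x y" for x y using g(4) True by simp
  then show ?thesis by (rule two_step_split[OF g(1-3) d(3,4) _ g(5)])
qed

lemma two_step:
  assumes cf: "coframe f1 f2 f3 f4 f5 f6"
    and d: "\<And>x y. f1 (br x y) = 0" "\<And>x y. f2 (br x y) = 0"
      "\<And>x y. f3 (br x y) = 0" "\<And>x y. f4 (br x y) = 0"
      "\<And>x y. f5 (br x y) = form4 f1 f2 f3 f4 a12 a13 a14 a23 a24 a34 x y"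
      "\<And>x y. f6 (br x y) = form4 f1 f2 f3 f4 s12 s13 s14 s23 s24 s34 x y"
  shows "has_pure_frame br"
proof -
  consider "a12 \<noteq> 0" | "a13 \<noteq> 0" | "a14 \<noteq> 0" | "a23 \<noteq> 0" | "a24 \<noteq> 0" | "a34 \<noteq> 0"
    | "a12 = 0" "a13 = 0" "a14 = 0" "a23 = 0" "a24 = 0" "a34 = 0" by blast
  then show ?thesis
  proof cases
    case 1
    show ?thesis
      by (rule two_step_leading[of f1 f2 f3 f4 f5 f6
        a12 a13 a14 a23 a24 a34
        s12 s13 s14 s23 s24 s34])
        (use 1 cf in \<open>auto simp: d wedge_def coframe_def algebra_simps\<close>)
  next
    case 2
    show ?thesis
      by (rule two_step_leading[of f1 f3 f2 f4 f5 f6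
        a13 a12 a14 "- a23" a34 a24
        s13 s12 s14 "- s23" s34 s24])
        (use 2 cf in \<open>auto simp: d wedge_def coframe_def algebra_simps\<close>)
  next
    case 3
    show ?thesis
      by (rule two_step_leading[of f1 f4 f2 f3 f5 f6
        a14 a12 a13 "- a24" "- a34" a23
        s14 s12 s13 "- s24" "- s34" s23])
        (use 3 cf in \<open>auto simp: d wedge_def coframe_def algebra_simps\<close>)
  next
    case 4
    show ?thesis
      by (rule two_step_leading[of f2 f3 f1 f4 f5 f6
        a23 "- a12" a24 "- a13" a34 a14
        s23 "- s12" s24 "- s13" s34 s14])
        (use 4 cf in \<open>auto simp: d wedge_def coframe_def algebra_simps\<close>)
  next
    case 5
    show ?thesis
      by (rule two_step_leading[of f2 f4 f1 f3 f5 f6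
        a24 "- a12" a23 "- a14" "- a34" a13
        s24 "- s12" s23 "- s14" "- s34" s13])
        (use 5 cf in \<open>auto simp: d wedge_def coframe_def algebra_simps\<close>)
  next
    case 6
    show ?thesis
      by (rule two_step_leading[of f3 f4 f1 f2 f5 f6
        a34 "- a13" "- a23" "- a14" "- a24" a12
        s34 "- s13" "- s23" "- s14" "- s24" s12])
        (use 6 cf in \<open>auto simp: d wedge_def coframe_def algebra_simps\<close>)
  next
    case 7
    have "coframe f5 f1 f2 f3 f4 f6" using cf by (auto simp: coframe_def)
    then have False
      by (rule no_unused_closed_form) (use 7 in \<open>auto simp: d wedge_def\<close>)
    then show ?thesis ..
  qed
qed

section \<open>Three-step algebras with four closed forms\<close>

lemma three_step_leading:
  assumes cf: "coframe f1 f2 f3 f4 f5 f6"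
    and d: "\<And>x y. f1 (br x y) = 0" "\<And>x y. f2 (br x y) = 0"
      "\<And>x y. f3 (br x y) = 0" "\<And>x y. f4 (br x y) = 0"
      "\<And>x y. f5 (br x y) = a12 * wedge f1 f2 x y + a13 * wedge f1 f3 x y + a14 * wedge f1 f4 x y"
      "\<And>x y. f6 (br x y) = wedge f1 f5 x y + s23 * wedge f2 f3 x y + s24 * wedge f2 f4 x y
          + s34 * wedge f3 f4 x y"
    and s: "s34 \<noteq> 0"
  shows "has_pure_frame br"
\<comment> \<open>The 2-form in \<open>f2\<close>, \<open>f3\<close>, \<open>f4\<close> has the
  kernel vector (s34, - s24, s23), and the tested expression is the value there of the linear factor
  of the differential of \<open>f5\<close>. If it is nonzero, that factor completes a coframe with
  the two factors of the 2-form; otherwise the kernel vector is central.\<close>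
proof (cases "a12 * s34 - a13 * s24 + a14 * s23 = 0")
  case False
  note l = coframeD[OF cf]
  show ?thesis
  proof (rule pure_frame_12_15p34[of f1 "\<lambda>x. a12 * f2 x + a13 * f3 x + a14 * f4 x" "\<lambda>x. s34 * f3 x
      + s24 * f2 x"
        "\<lambda>x. f4 x - s23 / s34 * f2 x" f5 f6], goal_cases)
    case 1
    show ?case
    proof (rule coframeI)
      fix x assume z: "f1 x = 0" "a12 * f2 x + a13 * f3 x + a14 * f4 x = 0" "s34 * f3 x
          + s24 * f2 x = 0"
        "f4 x - s23 / s34 * f2 x = 0" "f5 x = 0" "f6 x = 0"
      then have e: "f3 x = - s24 / s34 * f2 x"
          "f4 x = s23 / s34 * f2 x" using s by (simp_all add: field_simps)
      have "(a12 * s34 - a13 * s24 + a14 * s23) * f2 x = 0"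
        using z(2) s unfolding e by (simp add: field_simps)
      then show "x = 0" using z e False by (intro l) auto
    qed (auto intro!: linear_rules l)
  qed (use s in \<open>auto simp: d wedge_def field_simps\<close>)
next
  case True
  obtain b1 b2 b3 b4 b5 b6 where "dual_frame f1 f2 f3 f4 f5 f6 b1 b2 b3 b4 b5 b6"
    using ex_dual_frame[OF dim6 cf] by blast
  note D = dual_frameD[OF this]
  note l = coframeD[OF cf]
  define z where "z = s34 *\<^sub>R b2 - s24 *\<^sub>R b3 + s23 *\<^sub>R b4"
  have z: "f1 z = 0" "f2 z = s34" "f3 z = - s24" "f4 z = s23" "f5 z = 0"
    by (simp_all add: z_def l linear_add linear_diff linear_scale D)
  have "a12 * (f1 y * s34) + a14 * (f1 y * s23) = a13 * (f1 y * s24)" for y using True by algebra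
  then have False
    by (intro no_central_factor[OF cf, of z f2]) (use s in \<open>auto simp: d wedge_def z l
        algebra_simps\<close>)
  then show ?thesis ..
qed

lemma three_step_reduced:
  assumes cf: "coframe f1 f2 f3 f4 f5 f6"
    and d: "\<And>x y. f1 (br x y) = 0" "\<And>x y. f2 (br x y) = 0"
      "\<And>x y. f3 (br x y) = 0" "\<And>x y. f4 (br x y) = 0"
      "\<And>x y. f5 (br x y) = a12 * wedge f1 f2 x y + a13 * wedge f1 f3 x y + a14 * wedge f1 f4 x y"
      "\<And>x y. f6 (br x y) = wedge f1 f5 x y + s23 * wedge f2 f3 x y + s24 * wedge f2 f4 x y
          + s34 * wedge f3 f4 x y"
  shows "has_pure_frame br"
proof -
  consider "s34 \<noteq> 0" | "s24 \<noteq> 0" | "s23 \<noteq> 0" | "s23 = 0" "s24 = 0" "s34 = 0" by blast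
  then show ?thesis
  proof cases
    case 1
    show ?thesis by (rule three_step_leading[OF cf d 1])
  next
    case 2
    show ?thesis
      by (rule three_step_leading[of f1 f3 f2 f4 f5 f6 a13 a12 a14 "- s23" s34 s24])
        (use 2 cf in \<open>auto simp: d wedge_def coframe_def algebra_simps\<close>)
  next
    case 3
    show ?thesis
      by (rule three_step_leading[of f1 f4 f2 f3 f5 f6 a14 a12 a13 "- s24" "- s34" s23])
        (use 3 cf in \<open>auto simp: d wedge_def coframe_def algebra_simps\<close>)
  next
    case 4
    obtain b1 b2 b3 b4 b5 b6 where "dual_frame f1 f2 f3 f4 f5 f6 b1 b2 b3 b4 b5 b6"
      using ex_dual_frame[OF dim6 cf] by blast
    note D = dual_frameD[OF this]
    note l = coframeD[OF cf]
    \<comment> \<open>A vector in the span of \<open>b2\<close> and \<open>b3\<close> killed by the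
      linear form a12 f2 + a13 f3 is central.\<close>
    have False
    proof (cases "a12 = 0")
      case True
      then show False
        by (intro no_central_factor[OF cf, of b2 f2]) (use 4 in \<open>auto simp: d wedge_def D l\<close>)
    next
      case False
      define z where "z = a13 *\<^sub>R b2 - a12 *\<^sub>R b3"
      have z: "f1 z = 0" "f2 z = a13" "f3 z = - a12" "f4 z = 0" "f5 z = 0"
        by (simp_all add: z_def l linear_diff linear_scale D)
      show False
        by (intro no_central_factor[OF cf, of z f3]) (use 4 False in \<open>auto simp: d wedge_def z l\<close>)
    qed
    then show ?thesis ..
  qed
qed

text \<open>Let x be the closed form multiplied with \<open>f5\<close> in the differential of
  \<open>f6\<close>. The Jacobi identity says that x wedged with the differential of
  \<open>f5\<close> is 0, so the latter is divisible by x, which becomes \<open>g1\<close>. The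
  terms of the differential of \<open>f6\<close> divisible by \<open>g1\<close> are absorbed into
  \<open>g5\<close>.\<close>

lemma three_step_pivot:
  assumes cf: "coframe f1 f2 f3 f4 f5 f6"
    and d: "\<And>x y. f1 (br x y) = 0" "\<And>x y. f2 (br x y) = 0"
      "\<And>x y. f3 (br x y) = 0" "\<And>x y. f4 (br x y) = 0"
      "\<And>x y. f5 (br x y) = form4 f1 f2 f3 f4 a12 a13 a14 a23 a24 a34 x y"
      "\<And>x y. f6 (br x y) = form4 f1 f2 f3 f4 s12 s13 s14 s23 s24 s34 x y + x1 * wedge f1 f5 x y
          + x2 * wedge f2 f5 x y
         + x3 * wedge f3 f5 x y + x4 * wedge f4 f5 x y"
    and x1: "x1 \<noteq> 0"
  shows "has_pure_frame br"
proof -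
  obtain b1 b2 b3 b4 b5 b6 where "dual_frame f1 f2 f3 f4 f5 f6 b1 b2 b3 b4 b5 b6"
    using ex_dual_frame[OF dim6 cf] by blast
  note D = dual_frameD[OF this]
  note l = coframeD[OF cf]
  have j: "x1 * a23 - x2 * a13 + x3 * a12 = 0" "x1 * a24 - x2 * a14 + x4 * a12 = 0"
    "x1 * a34 - x3 * a14 + x4 * a13 = 0"
    using jacobi_functional[OF l(6), of b1 b2 b3] jacobi_functional[OF l(6), of b1 b2 b4]
      jacobi_functional[OF l(6), of b1 b3 b4]
    by (simp_all add: d wedge_def D)
  define t where "t = 1 / x1"
  define g1 where "g1 x = x1 * f1 x + x2 * f2 x + x3 * f3 x + x4 * f4 x" for x
  define s23' where "s23' = s23 + t * (x3 * s12 - x2 * s13)"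
  define s24' where "s24' = s24 + t * (x4 * s12 - x2 * s14)"
  define s34' where "s34' = s34 + t * (x4 * s13 - x3 * s14)"
  define g5 where "g5 x = f5 x + t * (s12 * f2 x + s13 * f3 x + s14 * f4 x)" for x
  have t: "t * x1 = 1" using x1 by (simp add: t_def)
  show ?thesis
  proof (rule three_step_reduced[of g1 f2 f3 f4 g5 f6 "t * a12" "t * a13"
      "t * a14" s23' s24' s34'], goal_cases)
    case 1
    show ?case by (rule coframeI) (use x1 in \<open>auto simp: g1_def[abs_def] g5_def[abs_def] intro!:
        linear_rules l\<close>)
  next
    case (6 x y)
    have "g5 (br x y) = f5 (br x y)" by (simp add: g5_def d)
    then show ?case unfolding d wedge_def g1_def using j t by algebra
  next
    case (7 x y)
    show ?case unfolding d wedge_def g1_def g5_def s23'_def s24'_def s34'_def using t by algebra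
  qed (simp_all add: g1_def d)
qed

lemma four_closed_forms:
  assumes cf: "coframe f1 f2 f3 f4 f5 f6"
    and d: "\<And>x y. f1 (br x y) = 0" "\<And>x y. f2 (br x y) = 0"
      "\<And>x y. f3 (br x y) = 0" "\<And>x y. f4 (br x y) = 0"
      "\<And>x y. f5 (br x y) = form4 f1 f2 f3 f4 a12 a13 a14 a23 a24 a34 x y"
      "\<And>x y. f6 (br x y) = form4 f1 f2 f3 f4 s12 s13 s14 s23 s24 s34 x y + x1 * wedge f1 f5 x y
          + x2 * wedge f2 f5 x y
         + x3 * wedge f3 f5 x y + x4 * wedge f4 f5 x y"
  shows "has_pure_frame br"
proof -
  consider "x1 \<noteq> 0" | "x2 \<noteq> 0" | "x3 \<noteq> 0" | "x4 \<noteq> 0" | "x1 = 0" "x2 = 0" "x3 = 0" "x4 = 0" by blast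
  then show ?thesis
  proof cases
    case 1
    show ?thesis by (rule three_step_pivot[OF cf d 1])
  next
  case 2
    show ?thesis
      by (rule three_step_pivot[of f2 f1 f3 f4 f5 f6
        "- a12" a23 a24 a13 a14 a34
        "- s12" s23 s24 s13 s14 s34 x2 x1 x3 x4])
        (use 2 cf in \<open>auto simp: d wedge_def coframe_def algebra_simps\<close>)
  next
    case 3
    show ?thesis
      by (rule three_step_pivot[of f3 f1 f2 f4 f5 f6
        "- a13" "- a23" a34 a12 a14 a24
        "- s13" "- s23" s34 s12 s14 s24 x3 x1 x2 x4])
        (use 3 cf in \<open>auto simp: d wedge_def coframe_def algebra_simps\<close>)
  next
    case 4
    show ?thesis
      by (rule three_step_pivot[of f4 f1 f2 f3 f5 f6
        "- a14" "- a24" "- a34" a12 a13 a23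
        "- s14" "- s24" "- s34" s12 s13 s23 x4 x1 x2 x3])
        (use 4 cf in \<open>auto simp: d wedge_def coframe_def algebra_simps\<close>)
  next
    case 5
    show ?thesis
      by (rule two_step[OF cf d(1-5), of s12 s13 s14 s23 s24 s34]) (simp add: d 5)
  qed
qed

section \<open>Three independent closed forms\<close>

lemma common_factor_diagonal:
  assumes cf: "coframe f1 f2 f3 f4 f5 f6"
    and d: "\<And>x y. f1 (br x y) = 0" "\<And>x y. f2 (br x y) = 0" "\<And>x y. f3 (br x y) = 0"
      "\<And>x y. f4 (br x y) = wedge f1 f2 x y" "\<And>x y. f5 (br x y) = wedge f1 f3 x y"
      "\<And>x y. f6 (br x y) = wedge f2 f4 x y + k * wedge f3 f5 x y"
  shows "has_pure_frame br"
proof -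
  consider "k > 0" | "k = 0" | "k < 0" by linarith
  then show ?thesis
  proof cases
    case 1
    \<comment> \<open>With t^2 k = v^2 the relation becomes v^2 (1 + k - 2 v) = 0.\<close>
    define v where "v = (1 + k) / 2"
    have v: "v \<noteq> 0" "v / sqrt k \<noteq> 0" using 1 by (auto simp: v_def)
    have "v\<^sup>2 * (1 - v) + (v / sqrt k)\<^sup>2 * k * (k - v) = 0"
    proof -
      have "(v / sqrt k)\<^sup>2 * k = v\<^sup>2" using 1 by (simp add: power_divide)
      moreover have "1 + k = 2 * v" by (simp add: v_def)
      ultimately show ?thesis by algebra
    qed
    then show ?thesis by (rule pure_frame_12_13_24p35[OF cf d v])
  next
    case 2
    show ?thesis by (rule pure_frame_12_13_24p35[OF cf d, of 1 1]) (simp_all add: 2)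
  next
    case 3
    \<comment> \<open>With v = 2 the relation becomes t^2 (k^2 - 2 k) = 4, which is solvable because
      k is negative.\<close>
    define t where "t = 2 / sqrt (k\<^sup>2 - 2 * k)"
    have k: "k\<^sup>2 - 2 * k > 0" using 3 zero_le_power2[of k] by linarith
    have t: "t \<noteq> 0" "t\<^sup>2 * (k\<^sup>2 - 2 * k) = 4" using k by (simp_all add: t_def power_divide
        divide_simps)
    show ?thesis by (rule pure_frame_12_13_24p35[OF cf d _ t(1), of 2]) (use t(2) in \<open>simp_all
        add: algebra_simps power2_eq_square\<close>)
  qed
qed

text \<open>A linear change of (f2, f3) acts in the same way on (f4, f5), so \<open>q\<close>,
  \<open>m\<close>, \<open>n\<close> transform as a quadratic form. Completing the square at the
  pivot \<open>q\<close> removes \<open>m\<close>; the summand of \<open>g2\<close> in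
  \<open>f1\<close> removes \<open>p\<close>, and that of \<open>g4\<close> in \<open>f3\<close>
  removes \<open>s\<close>.\<close>

lemma common_factor_pivot:
  assumes cf: "coframe f1 f2 f3 f4 f5 f6"
    and d: "\<And>x y. f1 (br x y) = 0" "\<And>x y. f2 (br x y) = 0" "\<And>x y. f3 (br x y) = 0"
      "\<And>x y. f4 (br x y) = wedge f1 f2 x y" "\<And>x y. f5 (br x y) = wedge f1 f3 x y"
      "\<And>x y. f6 (br x y) = s * wedge f2 f3 x y + p * wedge f1 f4 x y + r * wedge f1 f5 x y
         + q * wedge f2 f4 x y + m * (wedge f3 f4 x y + wedge f2 f5 x y) + n * wedge f3 f5 x y"
    and q: "q \<noteq> 0"
  shows "has_pure_frame br"
proof -
  note l = coframeD[OF cf]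
  define t where "t = 1 / q"
  have t: "q * t = 1" using q by (simp add: t_def)
  define k where "k = t * (n - m * m * t)"
  define r' where "r' = t * (r - p * m * t)"
  define s' where "s' = t * s"
  define g2 where "g2 x = f2 x + t * m * f3 x + t * p * f1 x" for x
  define g4 where "g4 x = f4 x + t * m * f5 x + s' * f3 x" for x
  define g6 where "g6 x = t * f6 x + (s' * t * p) * f5 x" for x
  have d4: "g4 (br x y) = wedge f1 g2 x y" for x y
    unfolding g4_def d wedge_def g2_def by algebra
  have d6: "g6 (br x y) = wedge g2 g4 x y + k * wedge f3 f5 x y + r' * wedge f1 f5 x y" for x y
    unfolding g6_def d wedge_def g2_def g4_def k_def r'_def s'_def using t by algebra
  have g2: "g2 (br x y) = 0" for x y by (simp add: g2_def d)
  have cf': "coframe f1 g2 f3 g4 f5 g6"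
    by (rule coframeI)
      (use t in \<open>auto simp: g2_def[abs_def] g4_def[abs_def] g6_def[abs_def] intro!: linear_rules l\<close>)
  note l' = coframeD[OF cf']
  consider "k \<noteq> 0" | "k = 0" "r' = 0" | "k = 0" "r' \<noteq> 0" by blast
  then show ?thesis
  proof cases
    case 1
    show ?thesis
    proof (rule common_factor_diagonal[of f1 g2 "\<lambda>x. f3 x + r' / k * f1 x" g4 f5 g6 k], goal_cases)
      case 1
      show ?case by (rule coframeI) (auto intro!: linear_rules l')
    qed (use 1 in \<open>simp_all add: d d4 d6 g2 wedge_def field_simps\<close>)
  next
    case 2
    show ?thesis
      by (rule common_factor_diagonal[OF cf' d(1) g2 d(3) d4 d(5), of 0]) (simp add: d6 2)
  next
    case 3
    show ?thesis
    proof (rule pure_frame_12_13_24p15[of f1 g2 "\<lambda>x. r' * f3 x" g4 "\<lambda>x. r' * f5 x" g6], goal_cases)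
      case 1
      show ?case by (rule coframeI) (use 3 in \<open>auto intro!: linear_rules l'\<close>)
    qed (simp_all add: d d4 d6 g2 3 wedge_def algebra_simps)
  qed
qed

lemma common_factor:
  assumes cf: "coframe f1 f2 f3 f4 f5 f6"
    and d: "\<And>x y. f1 (br x y) = 0" "\<And>x y. f2 (br x y) = 0" "\<And>x y. f3 (br x y) = 0"
      "\<And>x y. f4 (br x y) = wedge f1 f2 x y" "\<And>x y. f5 (br x y) = wedge f1 f3 x y"
      "\<And>x y. f6 (br x y) = form5 f1 f2 f3 f4 f5 s12 s13 s14 s15 s23 s24 s25 s34 s35 s45 x y"
  shows "has_pure_frame br"
proof -
  obtain b1 b2 b3 b4 b5 b6 where "dual_frame f1 f2 f3 f4 f5 f6 b1 b2 b3 b4 b5 b6"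
    using ex_dual_frame[OF dim6 cf] by blast
  note D = dual_frameD[OF this]
  note l = coframeD[OF cf]
  \<comment> \<open>The Jacobi identity makes the block pairing (f2, f3) with (f4, f5) symmetric;
    this is the quadratic form for which a pivot is sought.\<close>
  have j: "s45 = 0" "s25 = s34"
    using jacobi_functional[OF l(6), of b1 b2 b3] jacobi_functional[OF l(6), of b1 b2 b5]
    by (simp_all add: d wedge_def D)
  define g6 where "g6 x = f6 x - s12 * f4 x - s13 * f5 x" for x
  have d6: "g6 (br x y) = s23 * wedge f2 f3 x y + s14 * wedge f1 f4 x y + s15 * wedge f1 f5 x y
       + s24 * wedge f2 f4 x y + s34 * (wedge f3 f4 x y + wedge f2 f5 x y)
           + s35 * wedge f3 f5 x y" for x y
    unfolding g6_def d j by (simp add: algebra_simps)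
  have cf': "coframe f1 f2 f3 f4 f5 g6"
    by (rule coframeI) (auto simp: g6_def[abs_def] intro!: linear_rules l)
  note l' = coframeD[OF cf']
  consider "s24 \<noteq> 0" | "s35 \<noteq> 0" | "s24 = 0" "s35 = 0" "s34 \<noteq> 0"
    | "s24 = 0" "s35 = 0" "s34 = 0" "s14 \<noteq> 0" | "s24 = 0" "s35 = 0" "s34 = 0" "s14 = 0" "s15 \<noteq> 0"
    | "s24 = 0" "s35 = 0" "s34 = 0" "s14 = 0" "s15 = 0" "s23 \<noteq> 0"
    | "s24 = 0" "s35 = 0" "s34 = 0" "s14 = 0" "s15 = 0" "s23 = 0" by blast
  then show ?thesis
  proof cases
    case 1
    show ?thesis by (rule common_factor_pivot[OF cf' d(1-5) d6 1])
  next
    case 2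
    show ?thesis
      by (rule common_factor_pivot[of f1 f3 f2 f5 f4 g6 "- s23" s15 s14 s35 s34 s24])
        (use 2 cf' in \<open>auto simp: d d6 wedge_def coframe_def algebra_simps\<close>)
  next
    case 3
    \<comment> \<open>A hyperbolic form has no diagonal pivot; the shear creates the pivot
      \<open>2 * s34\<close>.\<close>
    show ?thesis
    proof (rule common_factor_pivot[of f1 f2 "\<lambda>x. f3 x - f2 x" f4 "\<lambda>x. f5 x - f4 x" g6
          s23 "s14 + s15" s15 "2 * s34" s34 0], goal_cases)
      case 1
      show ?case by (rule coframeI) (auto intro!: linear_rules l')
    qed (use 3 in \<open>auto simp: d d6 wedge_def algebra_simps\<close>)
  next
    case 4
    \<comment> \<open>Rescaling \<open>f3\<close> by \<open>c\<close> moves the parameter off the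
      excluded value -2.\<close>
    define c where "c = (if s23 / s14 = - 2 then 2 else 1 :: real)"
    have c: "c \<noteq> 0" "s23 / (s14 * c) \<noteq> - 2" using 4 by (auto simp: c_def field_simps)
    show ?thesis
    proof (rule pure_frame_12_13_14p23[of f1 "\<lambda>x. s14 * f2 x + s15 * f3 x" "\<lambda>x. c * f3 x"
        "\<lambda>x. s14 * f4 x + s15 * f5 x"
          "\<lambda>x. c * f5 x" g6 "s23 / (s14 * c)"], goal_cases)
      case 1
      show ?case by (rule coframeI) (use 4 c in \<open>auto intro!: linear_rules l'\<close>)
    qed (use 4 c in \<open>auto simp: d d6 wedge_def field_simps\<close>)
  next
    case 5
    define c where "c = (if - s23 / s15 = - 2 then 2 else 1 :: real)"
    have c: "c \<noteq> 0" "- s23 / (s15 * c) \<noteq> - 2" using 5 by (auto simp: c_def field_simps)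
    show ?thesis
    proof (rule pure_frame_12_13_14p23[of f1 "\<lambda>x. s15 * f3 x" "\<lambda>x. c * f2 x" "\<lambda>x. s15 * f5 x"
          "\<lambda>x. c * f4 x" g6 "- s23 / (s15 * c)"], goal_cases)
      case 1
      show ?case by (rule coframeI) (use 5 c in \<open>auto intro!: linear_rules l'\<close>)
    qed (use 5 c in \<open>auto simp: d d6 wedge_def field_simps\<close>)
  next
    case 6
    show ?thesis
    proof (rule pure_frame_12_13_23[of f1 f2 f3 f4 f5 "\<lambda>x. g6 x / s23"], goal_cases)
      case 1
      show ?case by (rule coframeI) (use 6 in \<open>auto intro!: linear_rules l'\<close>)
    qed (use 6 in \<open>simp_all add: d d6\<close>)
  next
    case 7
    show ?thesis
      by (rule four_closed_forms[of f1 f2 f3 g6 f4 f5 1 0 0 0 0 0 0 1 0 0 0 0 0 0 0 0])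
        (use 7 cf' in \<open>auto simp: d d6 coframe_def\<close>)
  qed
qed

text \<open>Any two 2-forms in three variables share a linear factor; once the multiple of 12 is
  removed from the second, the factor is a13 f1 + a23 f2. If the forms are proportional, a fourth
  closed form appears instead.\<close>

lemma two_forms_in_three_variables:
  assumes cf: "coframe f1 f2 f3 f4 f5 f6"
    and d: "\<And>x y. f1 (br x y) = 0" "\<And>x y. f2 (br x y) = 0" "\<And>x y. f3 (br x y) = 0"
      "\<And>x y. f4 (br x y) = wedge f1 f2 x y"
      "\<And>x y. f5 (br x y) = form3 f1 f2 f3 a12 a13 a23 x y"
      "\<And>x y. f6 (br x y) = form5 f1 f2 f3 f4 f5 s12 s13 s14 s15 s23 s24 s25 s34 s35 s45 x y"
  shows "has_pure_frame br"
proof -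
  note l = coframeD[OF cf]
  define g5 where "g5 x = f5 x - a12 * f4 x" for x
  have f5: "f5 x = g5 x + a12 * f4 x" for x by (simp add: g5_def)
  have d5: "g5 (br x y) = a13 * wedge f1 f3 x y + a23 * wedge f2 f3 x y" for x y
    by (simp add: g5_def d)
  have cf': "coframe f1 f2 f3 f4 g5 f6"
    by (rule coframeI) (auto simp: g5_def[abs_def] intro!: linear_rules l)
  note l' = coframeD[OF cf']
  consider "a13 \<noteq> 0" | "a13 = 0" "a23 \<noteq> 0" | "a13 = 0" "a23 = 0" by blast
  then show ?thesis
  proof cases
    case 1
    define t where "t = 1 / a13"
    have t: "a13 * t = 1" using 1 by (simp add: t_def)
    define g1 where "g1 x = a13 * f1 x + a23 * f2 x" for x
    show ?thesis
    proof (rule common_factor[of g1 "\<lambda>x. t * f2 x" f3 f4 g5 f6 s12 "t * s13" "t * (s14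
        + a12 * s15)" "t * s15"
          "a13 * s23 - a23 * s13" "a13 * (s24 + a12 * s25) - a23 * (s14 + a12 * s15)" "a13 * s25
              - a23 * s15"
          "s34 + a12 * s35" s35 s45], goal_cases)
      case 1
      show ?case by (rule coframeI) (use t in \<open>auto simp: g1_def[abs_def] intro!: linear_rules l'\<close>)
    next
      case (5 x y)
      show ?case unfolding d wedge_def g1_def using t by algebra
    next
      case (6 x y)
      show ?case unfolding d5 wedge_def g1_def by (simp add: algebra_simps)
    next
      case (7 x y)
      show ?case unfolding d wedge_def g1_def f5 using t by algebra
    qed (simp_all add: g1_def d)
  next
    case 2
    define t where "t = 1 / a23"
    have t: "a23 * t = 1" using 2 by (simp add: t_def)
    show ?thesis
    proof (rule common_factor[of "\<lambda>x. a23 * f2 x" "\<lambda>x. - (t * f1 x)" f3 f4 g5 f6 s12 "t * s23"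
        "t * (s24 + a12 * s25)" "t * s25"
          "- a23 * s13" "- a23 * (s14 + a12 * s15)" "- a23 * s15"
          "s34 + a12 * s35" s35 s45], goal_cases)
      case 1
      show ?case by (rule coframeI) (use t in \<open>auto intro!: linear_rules l'\<close>)
    next
      case (5 x y)
      show ?case unfolding d wedge_def using t by algebra
    next
      case (6 x y)
      show ?case unfolding d5 wedge_def using t 2 by algebra
    next
      case (7 x y)
      show ?case unfolding d wedge_def f5 using t by algebra
    qed (simp_all add: d)
  next
    case 3
    show ?thesis
      by (rule four_closed_forms[of f1 f2 f3 g5 f4 f6 1 0 0 0 0 0 s12 s13 s15 s23 s25 s35
            "s14 + a12 * s15" "s24 + a12 * s25" "s34 + a12 * s35" "- s45"])
        (use 3 cf' in \<open>auto simp: d d5 f5 coframe_def wedge_def algebra_simps\<close>)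
  qed
qed

section \<open>Three closed forms, with \<open>f4\<close> occurring in later differentials\<close>

lemma traceless_pivot:
  assumes cf: "coframe f1 f2 f3 f4 f5 f6"
    and d: "\<And>x y. f1 (br x y) = 0" "\<And>x y. f2 (br x y) = 0" "\<And>x y. f3 (br x y) = 0"
      "\<And>x y. f4 (br x y) = wedge f1 f2 x y"
      "\<And>x y. f5 (br x y) = wedge f1 f4 x y + p * wedge f1 f3 x y + q * wedge f2 f3 x y"
      "\<And>x y. f6 (br x y) = wedge f2 f4 x y + r * wedge f1 f3 x y - p * wedge f2 f3 x y"
    and q: "q \<noteq> 0"
  shows "has_pure_frame br"
proof -
  note l = coframeD[OF cf]
  \<comment> \<open>With p f1 + q f2 as second form the trace-free matrix of \<open>p\<close>,
    \<open>q\<close>, \<open>r\<close> becomes off-diagonal, with entries \<open>q\<close> and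
    \<open>q\<close> times its negative determinant p^2 + q r.\<close>
  show ?thesis
  proof (rule pure_frame_12_14p23_24p13[of f1 "\<lambda>x. p * f1 x + q * f2 x" f3 "\<lambda>x. q * f4 x"
      "\<lambda>x. q * f5 x"
        "\<lambda>x. q * (p * f5 x + q * f6 x)" q "q * (p\<^sup>2 + q * r)"], goal_cases)
    case 1
    show ?case by (rule coframeI) (use q in \<open>auto intro!: linear_rules l\<close>)
  qed (use q in \<open>simp_all add: d wedge_def algebra_simps power2_eq_square\<close>)
qed

text \<open>Under changes of (f1, f2) the coefficients \<open>p\<close>, \<open>q\<close>,
  \<open>r\<close> behave as a trace-free 2x2 matrix. A nonzero one is not scalar, so some vector is
  not an eigenvector and \<open>q\<close> can be made nonzero; if the matrix is zero,
  \<open>f3\<close> occurs in no differential.\<close>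

lemma traceless:
  assumes cf: "coframe f1 f2 f3 f4 f5 f6"
    and d: "\<And>x y. f1 (br x y) = 0" "\<And>x y. f2 (br x y) = 0" "\<And>x y. f3 (br x y) = 0"
      "\<And>x y. f4 (br x y) = wedge f1 f2 x y"
      "\<And>x y. f5 (br x y) = wedge f1 f4 x y + p * wedge f1 f3 x y + q * wedge f2 f3 x y"
      "\<And>x y. f6 (br x y) = wedge f2 f4 x y + r * wedge f1 f3 x y - p * wedge f2 f3 x y"
  shows "has_pure_frame br"
proof -
  note l = coframeD[OF cf]
  consider "q \<noteq> 0" | "r \<noteq> 0" | "q = 0" "r = 0" "p \<noteq> 0" | "q = 0" "r = 0" "p = 0" by blast
  then show ?thesis
  proof cases
    case 1
    show ?thesis by (rule traceless_pivot[OF cf d 1])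
  next
    case 2
    show ?thesis
    proof (rule traceless_pivot[of f2 f1 f3 "\<lambda>x. - f4 x" "\<lambda>x. - f6 x" "\<lambda>x. - f5 x" p "- r"
        "- q"], goal_cases)
      case 1
      show ?case by (rule coframeI) (auto intro!: linear_rules l)
    qed (use 2 in \<open>simp_all add: d wedge_def algebra_simps\<close>)
  next
    case 3
    show ?thesis
    proof (rule traceless_pivot[of "\<lambda>x. f1 x + f2 x" f2 f3 f4 "\<lambda>x. f5 x + f6 x" f6 p
        "- 2 * p" 0], goal_cases)
      case 1
      show ?case by (rule coframeI) (auto intro!: linear_rules l)
    qed (use 3 in \<open>simp_all add: d wedge_def algebra_simps\<close>)
  next
    case 4
    have "coframe f3 f1 f2 f4 f5 f6" using cf by (auto simp: coframe_def)
    then have False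
      by (rule no_unused_closed_form) (use 4 in \<open>auto simp: d wedge_def\<close>)
    then show ?thesis ..
  qed
qed

lemma filiform_tail:
  assumes cf: "coframe f1 f2 f3 f4 f5 f6"
    and d: "\<And>x y. f1 (br x y) = 0" "\<And>x y. f2 (br x y) = 0" "\<And>x y. f3 (br x y) = 0"
      "\<And>x y. f4 (br x y) = wedge f1 f2 x y"
      "\<And>x y. f5 (br x y) = wedge f1 f4 x y + q * wedge f2 f3 x y"
      "\<And>x y. f6 (br x y) = wedge f1 f5 x y - q * wedge f3 f4 x y + v * wedge f2 f4 x y
          + z * wedge f2 f3 x y"
  shows "has_pure_frame br"
proof -
  note l = coframeD[OF cf]
  consider "q \<noteq> 0" | "q = 0" "z \<noteq> 0" | "q = 0" "z = 0" "v \<noteq> 0" | "q = 0" "z = 0" "v = 0" by blast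
  then show ?thesis
  proof cases
    case 1
    \<comment> \<open>The multiple of \<open>f2\<close> in the new third form absorbs the 24 term.
      The shifts by \<open>q * a\<close> change the coefficient at 23 by 2 q^2 a in total, which has
      to equal \<open>z\<close>.\<close>
    define a where "a = z / (2 * q\<^sup>2)"
    have a: "z = 2 * q * q * a" using 1 by (simp add: a_def power2_eq_square)
    show ?thesis
    proof (rule pure_frame_12_14p23_15m34[of f1 f2 "\<lambda>x. q * f3 x - v * f2 x + q * a * f1 x"
        "\<lambda>x. f4 x + q * a * f2 x" f5
          "\<lambda>x. f6 x - q * a * f5 x - q * q * a * a * f4 x"], goal_cases)
      case 1
      show ?case by (rule coframeI) (use \<open>q \<noteq> 0\<close> in \<open>auto intro!: linear_rules l\<close>)
    qed (simp_all add: d wedge_def a algebra_simps)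
  next
    case 2
    show ?thesis by (rule pure_frame_12_14_15p24p23[OF cf d(1-4), of v z]) (simp_all add: d 2)
  next
    case 3
    have "coframe f3 f1 f2 f4 f5 f6" using cf by (auto simp: coframe_def)
    then have False
      by (rule no_unused_closed_form) (use 3 in \<open>auto simp: d wedge_def\<close>)
    then show ?thesis ..
  next
    case 4
    have "coframe f3 f1 f2 f4 f5 f6" using cf by (auto simp: coframe_def)
    then have False
      by (rule no_unused_closed_form) (use 4 in \<open>auto simp: d wedge_def\<close>)
    then show ?thesis ..
  qed
qed

lemma three_closed_forms_reduced:
  assumes cf: "coframe f1 f2 f3 f4 f5 f6"
    and d: "\<And>x y. f1 (br x y) = 0" "\<And>x y. f2 (br x y) = 0" "\<And>x y. f3 (br x y) = 0"
      "\<And>x y. f4 (br x y) = wedge f1 f2 x y"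
      "\<And>x y. f5 (br x y) = wedge f1 f4 x y + q * wedge f2 f3 x y"
      "\<And>x y. f6 (br x y) = form5 f1 f2 f3 f4 f5 s12 s13 s14 s15 s23 s24 s25 s34 s35 s45 x y"
  shows "has_pure_frame br"
proof -
  obtain b1 b2 b3 b4 b5 b6 where "dual_frame f1 f2 f3 f4 f5 f6 b1 b2 b3 b4 b5 b6"
    using ex_dual_frame[OF dim6 cf] by blast
  note D = dual_frameD[OF this]
  note l = coframeD[OF cf]
  have j: "s25 = 0" "s35 = 0" "s45 = 0" and "s15 * q + s34 = 0"
    using jacobi_functional[OF l(6), of b1 b2 b3] jacobi_functional[OF l(6), of b1 b2 b4]
      jacobi_functional[OF l(6), of b1 b2 b5] jacobi_functional[OF l(6), of b1 b3 b4]
    by (simp_all add: d wedge_def D)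
  then have j4: "s34 = - (q * s15)" by algebra
  define g6 where "g6 x = f6 x - s12 * f4 x - s14 * f5 x" for x
  define z where "z = s23 - q * s14"
  have d6: "g6 (br x y) = s15 * (wedge f1 f5 x y - q * wedge f3 f4 x y) + s13 * wedge f1 f3 x y
      + z * wedge f2 f3 x y + s24 * wedge f2 f4 x y" for x y
    unfolding g6_def d j j4 z_def by (simp add: algebra_simps)
  have cf': "coframe f1 f2 f3 f4 f5 g6"
    by (rule coframeI) (auto simp: g6_def[abs_def] intro!: linear_rules l)
  note l' = coframeD[OF cf']
  consider "s15 \<noteq> 0" | "s15 = 0" "s24 = 0" | "s15 = 0" "s24 \<noteq> 0" by blast
  then show ?thesis
  proof cases
    case 1
    show ?thesis
    proof (rule filiform_tail[of f1 f2 f3 f4 "\<lambda>x. f5 x + s13 / s15 * f3 x" "\<lambda>x. g6 x / s15" q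
        "s24 / s15" "z / s15"], goal_cases)
      case 1
      show ?case by (rule coframeI) (use \<open>s15 \<noteq> 0\<close> in \<open>auto intro!: linear_rules l'\<close>)
    qed (use 1 in \<open>simp_all add: d d6 wedge_def field_simps\<close>)
  next
    case 2
    show ?thesis
      by (rule two_forms_in_three_variables[of f1 f2 f3 f4 g6 f5 0 s13 z 0 0 1 0 q 0 0 0 0 0])
        (use 2 cf' in \<open>auto simp: d d6 coframe_def\<close>)
  next
    case 3
    \<comment> \<open>Shifting \<open>f4\<close> by \<open>h * f3\<close> subtracts h from both
      diagonal entries of the matrix of \<open>f3\<close>-coefficients, so half its trace makes it
      trace-free.\<close>
    define h where "h = z / s24 / 2"
    have h: "z = 2 * h * s24" using 3 by (simp add: h_def)
    show ?thesis
    proof (rule traceless[of f1 f2 f3 "\<lambda>x. f4 x + h * f3 x" f5 "\<lambda>x. g6 x / s24" "- h" q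
        "s13 / s24"], goal_cases)
      case 1
      show ?case by (rule coframeI) (use 3 in \<open>auto intro!: linear_rules l'\<close>)
    qed (use 3 in \<open>simp_all add: d d6 h wedge_def field_simps\<close>)
  qed
qed

lemma three_closed_forms_pivot:
  assumes cf: "coframe f1 f2 f3 f4 f5 f6"
    and d: "\<And>x y. f1 (br x y) = 0" "\<And>x y. f2 (br x y) = 0" "\<And>x y. f3 (br x y) = 0"
      "\<And>x y. f4 (br x y) = wedge f1 f2 x y"
      "\<And>x y. f5 (br x y) = form4 f1 f2 f3 f4 a12 a13 a14 a23 a24 a34 x y"
      "\<And>x y. f6 (br x y) = form5 f1 f2 f3 f4 f5 s12 s13 s14 s15 s23 s24 s25 s34 s35 s45 x y"
    and a14: "a14 \<noteq> 0"
  shows "has_pure_frame br"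
proof -
  obtain b1 b2 b3 b4 b5 b6 where "dual_frame f1 f2 f3 f4 f5 f6 b1 b2 b3 b4 b5 b6"
    using ex_dual_frame[OF dim6 cf] by blast
  note D = dual_frameD[OF this]
  note l = coframeD[OF cf]
  have j: "a34 = 0"
    using jacobi_functional[OF l(5), of b1 b2 b3] by (simp add: d wedge_def D)
  define t where "t = 1 / a14"
  have t: "t * a14 = 1" using a14 by (simp add: t_def)
  \<comment> \<open>\<open>g1\<close> collects all factors of \<open>f4\<close> in the differential
    of \<open>f5\<close>; the shift in \<open>g4\<close> absorbs the terms at 12 and 13.\<close>
  define g1 where "g1 x = a14 * f1 x + a24 * f2 x" for x
  define g2 where "g2 x = t * f2 x" for x
  define b where "b = t * a13"
  define g4 where "g4 x = f4 x + a12 * g2 x + b * f3 x" for x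
  show ?thesis
  proof (rule three_closed_forms_reduced[of g1 g2 f3 g4 f5 f6 "a14 * a23 - a24 * a13"
        "s12 - t * a12 * s14" "t * s13 - t * b * s14" "t * s14" "t * s15"
        "a14 * s23 - a24 * s13 + a24 * b * s14 - a14 * b * s24 + a12 * s34"
        "a14 * s24 - a24 * s14" "a14 * s25 - a24 * s15 - a12 * s45" s34 "s35
            - b * s45" s45], goal_cases)
    case 1
    show ?case
      by (rule coframeI) (use t in \<open>auto simp: g1_def[abs_def] g2_def[abs_def] g4_def[abs_def]
          intro!: linear_rules l\<close>)
  next
    case (5 x y)
    show ?case unfolding g4_def d wedge_def g1_def g2_def using t by simp algebra
  next
    case (6 x y)
    show ?case unfolding g4_def d wedge_def g1_def g2_def j b_def using t by algebra
  next
    case (7 x y)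
    show ?case unfolding g4_def d wedge_def g1_def g2_def b_def using t by algebra
  qed (simp_all add: g1_def g2_def d)
qed

lemma three_closed_forms_normalized:
  assumes cf: "coframe f1 f2 f3 f4 f5 f6"
    and d: "\<And>x y. f1 (br x y) = 0" "\<And>x y. f2 (br x y) = 0" "\<And>x y. f3 (br x y) = 0"
      "\<And>x y. f4 (br x y) = wedge f1 f2 x y"
      "\<And>x y. f5 (br x y) = form4 f1 f2 f3 f4 a12 a13 a14 a23 a24 a34 x y"
      "\<And>x y. f6 (br x y) = form5 f1 f2 f3 f4 f5 s12 s13 s14 s15 s23 s24 s25 s34 s35 s45 x y"
  shows "has_pure_frame br"
proof -
  obtain b1 b2 b3 b4 b5 b6 where "dual_frame f1 f2 f3 f4 f5 f6 b1 b2 b3 b4 b5 b6"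
    using ex_dual_frame[OF dim6 cf] by blast
  note D = dual_frameD[OF this]
  note l = coframeD[OF cf]
  have j: "a34 = 0"
    using jacobi_functional[OF l(5), of b1 b2 b3] by (simp add: d wedge_def D)
  consider "a14 \<noteq> 0" | "a24 \<noteq> 0" | "a14 = 0" "a24 = 0" by blast
  then show ?thesis
  proof cases
    case 1
    show ?thesis by (rule three_closed_forms_pivot[OF cf d 1])
  next
    case 2
    show ?thesis
    proof (rule three_closed_forms_pivot[of f2 f1 f3 "\<lambda>x. - f4 x" f5 f6 "- a12" a23 "- a24" a13
        "- a14" "- a34"
        "- s12" s23 "- s24" s25 s13 "- s14" s15 "- s34" s35 "- s45"], goal_cases)
      case 1
      show ?case by (rule coframeI) (auto intro!: linear_rules l)
    qed (use 2 in \<open>simp_all add: d wedge_def algebra_simps\<close>)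
  next
    case 3
    show ?thesis
      by (rule two_forms_in_three_variables[OF cf d(1-4) _ d(6), of a12 a13 a23]) (simp add: d 3 j)
  qed
qed

lemma three_closed_forms_leading:
  assumes cf: "coframe f1 f2 f3 f4 f5 f6"
    and d: "\<And>x y. f1 (br x y) = 0" "\<And>x y. f2 (br x y) = 0" "\<And>x y. f3 (br x y) = 0"
      "\<And>x y. f4 (br x y) = form3 f1 f2 f3 p12 p13 p23 x y"
      "\<And>x y. f5 (br x y) = form4 f1 f2 f3 f4 a12 a13 a14 a23 a24 a34 x y"
      "\<And>x y. f6 (br x y) = form5 f1 f2 f3 f4 f5 s12 s13 s14 s15 s23 s24 s25 s34 s35 s45 x y"
    and p12: "p12 \<noteq> 0"
  shows "has_pure_frame br"
proof -
  note l = coframeD[OF cf]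
  define t where "t = 1 / p12"
  have t: "t * p12 = 1" using p12 by (simp add: t_def)
  define g1 where "g1 x = p12 * f1 x - p23 * f3 x" for x
  define g2 where "g2 x = f2 x + t * p13 * f3 x" for x
  show ?thesis
  proof (rule three_closed_forms_normalized[of g1 g2 f3 f4 f5 f6
        "t * a12" "t * a13 - t * t * p13 * a12" "t * a14" "a23 - t * p23 * a12" a24 "a34
            + t * p23 * a14 - t * p13 * a24"
        "t * s12" "t * s13 - t * t * p13 * s12" "t * s14" "t * s15" "s23 - t * p23 * s12" s24 s25
        "s34 + t * p23 * s14 - t * p13 * s24" "s35 + t * p23 * s15
            - t * p13 * s25" s45], goal_cases)
    case 1
    show ?case
      by (rule coframeI) (use p12 in \<open>auto simp: g1_def[abs_def] g2_def[abs_def] intro!: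
          linear_rules l\<close>)
  next
    case (5 x y)
    show ?case unfolding d wedge_def g1_def g2_def using t by algebra
  next
    case (6 x y)
    show ?case unfolding d wedge_def g1_def g2_def using t by algebra
  next
    case (7 x y)
    show ?case unfolding d wedge_def g1_def g2_def using t by algebra
  qed (simp_all add: g1_def g2_def d)
qed

lemma three_closed_forms:
  assumes cf: "coframe f1 f2 f3 f4 f5 f6"
    and d: "\<And>x y. f1 (br x y) = 0" "\<And>x y. f2 (br x y) = 0" "\<And>x y. f3 (br x y) = 0"
      "\<And>x y. f4 (br x y) = form3 f1 f2 f3 p12 p13 p23 x y"
      "\<And>x y. f5 (br x y) = form4 f1 f2 f3 f4 a12 a13 a14 a23 a24 a34 x y"
      "\<And>x y. f6 (br x y) = form5 f1 f2 f3 f4 f5 s12 s13 s14 s15 s23 s24 s25 s34 s35 s45 x y"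
  shows "has_pure_frame br"
proof -
  consider "p12 \<noteq> 0" | "p13 \<noteq> 0" | "p23 \<noteq> 0" | "p12 = 0" "p13 = 0" "p23 = 0" by blast
  then show ?thesis
  proof cases
    case 1
    show ?thesis by (rule three_closed_forms_leading[OF cf d 1])
  next
    case 2
    show ?thesis
      by (rule three_closed_forms_leading[of f1 f3 f2 f4 f5 f6
        p13 p12 "- p23"
        a13 a12 a14 "- a23" a34 a24
        s13 s12 s14 s15 "- s23" s34 s35 s24 s25 s45])
        (use 2 cf in \<open>auto simp: d wedge_def coframe_def algebra_simps\<close>)
  next
    case 3
    show ?thesis
      by (rule three_closed_forms_leading[of f2 f3 f1 f4 f5 f6
        p23 "- p12" "- p13"
        a23 "- a12" a24 "- a13" a34 a14
        s23 "- s12" s24 s25 "- s13" s34 s35 s14 s15 s45])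
        (use 3 cf in \<open>auto simp: d wedge_def coframe_def algebra_simps\<close>)
  next
    case 4
    have "f4 (br x y) = 0" for x y by (simp add: d 4)
    then show ?thesis
      by (rule four_closed_forms[OF cf d(1-3) _ d(5), of s12 s13 s14 s23 s24 s34 s15 s25 s35 s45])
          (simp add: d)
  qed
qed

section \<open>Two generators\<close>

lemma free_three_step_pivot:
  assumes cf: "coframe f1 f2 f3 f4 f5 f6"
    and d: "\<And>x y. f1 (br x y) = 0" "\<And>x y. f2 (br x y) = 0"
      "\<And>x y. f3 (br x y) = wedge f1 f2 x y" "\<And>x y. f4 (br x y) = wedge f1 f3 x y"
      "\<And>x y. f5 (br x y) = wedge f2 f3 x y"
      "\<And>x y. f6 (br x y) = p * wedge f1 f4 x y + r * (wedge f2 f4 x y + wedge f1 f5 x y)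
          + s * wedge f2 f5 x y"
    and p: "p \<noteq> 0"
  shows "has_pure_frame br"
proof -
  note l = coframeD[OF cf]
  show ?thesis
  \<comment> \<open>A change of (f1, f2) acts in the same way on (f4, f5), so \<open>p\<close>,
    \<open>r\<close>, \<open>s\<close> form a quadratic form, here diagonalised by completing the
    square at \<open>p\<close>.\<close>
  proof (rule pure_frame_12_13_23_14p25[of "\<lambda>x. f1 x + r / p * f2 x" f2 f3 "\<lambda>x. f4 x
      + r / p * f5 x" f5 f6 p "s - r * r / p"], goal_cases)
    case 1
    show ?case by (rule coframeI) (auto intro!: linear_rules l)
  qed (use p in \<open>simp_all add: d wedge_def field_simps\<close>)
qed

lemma free_three_step:
  assumes cf: "coframe f1 f2 f3 f4 f5 f6"
    and d: "\<And>x y. f1 (br x y) = 0" "\<And>x y. f2 (br x y) = 0"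
      "\<And>x y. f3 (br x y) = wedge f1 f2 x y" "\<And>x y. f4 (br x y) = wedge f1 f3 x y"
      "\<And>x y. f5 (br x y) = wedge f2 f3 x y"
      "\<And>x y. f6 (br x y) = form5 f1 f2 f3 f4 f5 s12 s13 s14 s15 s23 s24 s25 s34 s35 s45 x y"
  shows "has_pure_frame br"
proof -
  obtain b1 b2 b3 b4 b5 b6 where "dual_frame f1 f2 f3 f4 f5 f6 b1 b2 b3 b4 b5 b6"
    using ex_dual_frame[OF dim6 cf] by blast
  note D = dual_frameD[OF this]
  note l = coframeD[OF cf]
  have j: "s34 = 0" "s35 = 0" "s45 = 0" "s15 = s24"
    using jacobi_functional[OF l(6), of b1 b2 b3] jacobi_functional[OF l(6), of b1 b2 b4]
      jacobi_functional[OF l(6), of b1 b2 b5] jacobi_functional[OF l(6), of b1 b3 b5]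
    by (simp_all add: d wedge_def D)
  define g6 where "g6 x = f6 x - s12 * f3 x - s13 * f4 x - s23 * f5 x" for x
  have d6: "g6 (br x y) = s14 * wedge f1 f4 x y + s24 * (wedge f2 f4 x y + wedge f1 f5 x y)
      + s25 * wedge f2 f5 x y" for x y
    unfolding g6_def d j by (simp add: algebra_simps)
  have cf': "coframe f1 f2 f3 f4 f5 g6"
    by (rule coframeI) (auto simp: g6_def[abs_def] intro!: linear_rules l)
  note l' = coframeD[OF cf']
  consider "s14 \<noteq> 0" | "s25 \<noteq> 0" | "s14 = 0" "s25 = 0" "s24 \<noteq> 0" | "s14 = 0" "s25 = 0"
      "s24 = 0" by blast
  then show ?thesis
  proof cases
    case 1
    show ?thesis by (rule free_three_step_pivot[OF cf' d(1-5) d6 1])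
  next
    case 2
    show ?thesis
    proof (rule free_three_step_pivot[of f2 f1 "\<lambda>x. - f3 x" "\<lambda>x. - f5 x" "\<lambda>x. - f4 x" g6 "- s25"
        "- s24" "- s14"], goal_cases)
      case 1
      show ?case by (rule coframeI) (auto intro!: linear_rules l')
    qed (use 2 in \<open>simp_all add: d d6 wedge_def algebra_simps\<close>)
  next
    case 3
    show ?thesis
    \<comment> \<open>As in the case of a hyperbolic form before, a shear creates a diagonal
      pivot.\<close>
    proof (rule free_three_step_pivot[of f1 "\<lambda>x. f2 x - f1 x" f3 f4 "\<lambda>x. f5 x - f4 x" g6
        "2 * s24" s24 0], goal_cases)
      case 1
      show ?case by (rule coframeI) (auto intro!: linear_rules l')
    qed (use 3 in \<open>simp_all add: d d6 wedge_def algebra_simps\<close>)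
  next
    case 4
    show ?thesis
      by (rule three_closed_forms[of f1 f2 g6 f3 f4 f5 1 0 0 0 0 1 0 0 0 0 0 0 0 0 1 0 0 0 0])
        (use 4 cf' in \<open>auto simp: d d6 coframe_def\<close>)
  qed
qed

section \<open>Two generators: general structure equations\<close>

lemma two_generators_degenerate:
  assumes cf: "coframe f1 f2 f3 f4 f5 f6"
    and d: "\<And>x y. f1 (br x y) = 0" "\<And>x y. f2 (br x y) = 0"
      "\<And>x y. f3 (br x y) = wedge f1 f2 x y" "\<And>x y. f4 (br x y) = wedge f1 f3 x y"
      "\<And>x y. f5 (br x y) = q * wedge f2 f3 x y"
      "\<And>x y. f6 (br x y) = form5 f1 f2 f3 f4 f5 s12 s13 s14 s15 s23 s24 s25 s34 s35 s45 x y"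
  shows "has_pure_frame br"
proof (cases "q = 0")
  case True
  show ?thesis
    by (rule three_closed_forms[of f1 f2 f5 f3 f4 f6 1 0 0 0 0 1 0 0 0
        s12 s15 s13 s14 s25 s23 s24 "- s35" "- s45" s34])
      (use True cf in \<open>auto simp: d wedge_def coframe_def algebra_simps\<close>)
next
  case False
  note l = coframeD[OF cf]
  show ?thesis
  proof (rule free_three_step[of f1 f2 f3 f4 "\<lambda>x. f5 x / q" f6 s12 s13 s14 "q * s15" s23 s24
      "q * s25" s34 "q * s35" "q * s45"], goal_cases)
    case 1
    show ?case by (rule coframeI) (use False in \<open>auto intro!: linear_rules l\<close>)
  qed (use False in \<open>simp_all add: d wedge_def field_simps\<close>)
qed

lemma two_generators_generic:
  assumes cf: "coframe f1 f2 f3 f4 f5 f6"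
    and d: "\<And>x y. f1 (br x y) = 0" "\<And>x y. f2 (br x y) = 0"
      "\<And>x y. f3 (br x y) = wedge f1 f2 x y" "\<And>x y. f4 (br x y) = wedge f1 f3 x y"
      "\<And>x y. f5 (br x y) = wedge f1 f4 x y + q * wedge f2 f3 x y"
      "\<And>x y. f6 (br x y) = form5 f1 f2 f3 f4 f5 s12 s13 s14 s15 s23 s24 s25 s34 s35 s45 x y"
  shows "has_pure_frame br"
proof -
  obtain b1 b2 b3 b4 b5 b6 where "dual_frame f1 f2 f3 f4 f5 f6 b1 b2 b3 b4 b5 b6"
    using ex_dual_frame[OF dim6 cf] by blast
  note D = dual_frameD[OF this]
  note l = coframeD[OF cf]
  \<comment> \<open>After these relations, and after subtracting multiples of \<open>f3\<close>,
    \<open>f4\<close>, \<open>f5\<close>, the last differential is a combination of 15 + q 24, 25 -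
    34 and 23. The vanishing of the first two coefficients and of \<open>q\<close> separates the
    final families.\<close>
  have j: "s35 = 0" "s45 = 0" and "s15 * q = s24" "- s25 = s34"
    using jacobi_functional[OF l(6), of b1 b2 b3] jacobi_functional[OF l(6), of b1 b2 b4]
      jacobi_functional[OF l(6), of b1 b2 b5] jacobi_functional[OF l(6), of b1 b3 b5]
    by (simp_all add: d wedge_def D)
  then have j': "s24 = q * s15" "s34 = - s25" by algebra+
  define g6 where "g6 x = f6 x - s12 * f3 x - s13 * f4 x - s14 * f5 x" for x
  define z where "z = s23 - q * s14"
  have d6: "g6 (br x y) = s15 * (wedge f1 f5 x y + q * wedge f2 f4 x y) + s25 * (wedge f2 f5 x y
      - wedge f3 f4 x y)
      + z * wedge f2 f3 x y" for x y
    unfolding g6_def d j j' z_def by (simp add: algebra_simps)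
  have cf': "coframe f1 f2 f3 f4 f5 g6"
    by (rule coframeI) (auto simp: g6_def[abs_def] intro!: linear_rules l)
  note l' = coframeD[OF cf']
  consider "s25 \<noteq> 0" | "s25 = 0" "s15 = 0" | "s25 = 0" "s15 \<noteq> 0" "q = 0" | "s25 = 0" "s15 \<noteq> 0"
      "q \<noteq> 0" by blast
  then show ?thesis
  proof cases
    case 1
    define t where "t = 1 / s25"
    have t: "t * s25 = 1" using 1 by (simp add: t_def)
    \<comment> \<open>Shifting \<open>f2\<close> by \<open>b * f1\<close> absorbs the part 15 + q
      24. The shifts of \<open>f4\<close> and \<open>f5\<close> by \<open>c\<close> contribute 2 c
      at 23, which must match what is left there, t z + b^2 q^2.\<close>
    define b where "b = t * s15"
    define c where "c = (t * z + b * b * q * q) / 2"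
    have c: "2 * c = t * z + b * b * q * q" by (simp add: c_def)
    define g2 where "g2 x = f2 x + b * f1 x" for x
    define g4 where "g4 x = f4 x + c * g2 x" for x
    define g5 where "g5 x = f5 x + q * b * f4 x + c * f3 x" for x
    define h6 where "h6 x = t * g6 x + b * b * q * (f5 x + q * b * f4 x) + t * z * b * f4 x" for x
    show ?thesis
    proof (rule pure_frame_12_13_14p23_25m34[of f1 g2 f3 g4 g5 h6 q], goal_cases)
      case 1
      show ?case
        by (rule coframeI)
          (use t in \<open>auto simp: g2_def[abs_def] g4_def[abs_def] g5_def[abs_def] h6_def[abs_def]
              intro!: linear_rules l'\<close>)
    next
      case (7 x y)
      show ?case unfolding h6_def d d6 wedge_def g2_def g4_def g5_def using t c b_def by algebra
    qed (simp_all add: g2_def g4_def g5_def d wedge_def algebra_simps)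
  next
    case 2
    show ?thesis
      by (rule two_generators_degenerate[of f1 f2 f3 f4 g6 f5 z 0 0 1 0 q 0 0 0 0 0])
        (use 2 cf' in \<open>auto simp: d d6 coframe_def\<close>)
  next
    case 3
    show ?thesis
    proof (rule pure_frame_12_13_14_15p23[of f1 f2 f3 f4 f5 "\<lambda>x. g6 x / s15" "z / s15"], goal_cases)
      case 1
      show ?case by (rule coframeI) (use 3 in \<open>auto intro!: linear_rules l'\<close>)
    qed (use 3 in \<open>simp_all add: d d6 wedge_def field_simps\<close>)
  next
    case 4
    define t where "t = 1 / s15"
    have t: "t * s15 = 1" using 4 by (simp add: t_def)
    \<comment> \<open>Shifting \<open>f2\<close> by \<open>a * f1\<close> forces
      \<open>2 * q * a * g5\<close> into the last form, whose differential has 2 q^2 a at 23; this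
      must cancel t z.\<close>
    define a where "a = - (t * z) / (2 * q * q)"
    have a: "t * z + 2 * q * q * a = 0" using 4 by (simp add: a_def)
    define g2 where "g2 x = f2 x + a * f1 x" for x
    define g5 where "g5 x = f5 x + q * a * f4 x" for x
    define h6 where "h6 x = t * g6 x + 2 * q * a * g5 x + t * z * a * f4 x" for x
    show ?thesis
    proof (rule pure_frame_12_13_14p23_15p24[of f1 g2 f3 f4 g5 h6 q], goal_cases)
      case 1
      show ?case
        by (rule coframeI)
          (use t in \<open>auto simp: g2_def[abs_def] g5_def[abs_def] h6_def[abs_def] intro!:
              linear_rules l'\<close>)
    next
      case (7 x y)
      show ?case unfolding h6_def g5_def d d6 wedge_def g2_def using t a 4(1) by algebra
    qed (use 4 in \<open>simp_all add: g2_def g5_def d wedge_def algebra_simps\<close>)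
  qed
qed

lemma two_generators_reduced:
  assumes cf: "coframe f1 f2 f3 f4 f5 f6"
    and d: "\<And>x y. f1 (br x y) = 0" "\<And>x y. f2 (br x y) = 0"
      "\<And>x y. f3 (br x y) = wedge f1 f2 x y" "\<And>x y. f4 (br x y) = wedge f1 f3 x y"
      "\<And>x y. f5 (br x y) = form4 f1 f2 f3 f4 a12 a13 a14 a23 a24 a34 x y"
      "\<And>x y. f6 (br x y) = form5 f1 f2 f3 f4 f5 s12 s13 s14 s15 s23 s24 s25 s34 s35 s45 x y"
  shows "has_pure_frame br"
proof -
  obtain b1 b2 b3 b4 b5 b6 where "dual_frame f1 f2 f3 f4 f5 f6 b1 b2 b3 b4 b5 b6"
    using ex_dual_frame[OF dim6 cf] by blast
  note D = dual_frameD[OF this]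
  note l = coframeD[OF cf]
  have j: "a24 = 0" "a34 = 0"
    using jacobi_functional[OF l(5), of b1 b2 b3] jacobi_functional[OF l(5), of b1 b2 b4]
    by (simp_all add: d wedge_def D)
  \<comment> \<open>One scale normalises the coefficient at 14 to 1 or leaves it 0; \<open>u\<close>
    is the inverse of \<open>t\<close> in both cases.\<close>
  define t where "t = (if a14 = 0 then 1 else 1 / a14)"
  have t: "t \<noteq> 0" "t * a14 = (if a14 = 0 then 0 else 1)" by (simp_all add: t_def)
  define u where "u = (if a14 = 0 then 1 else a14)"
  have u: "t * u = 1" by (simp add: t_def u_def)
  define g5 where "g5 x = t * (f5 x - a12 * f3 x - a13 * f4 x)" for x
  have f5: "f5 x = u * g5 x + a12 * f3 x + a13 * f4 x" for x
    unfolding g5_def using u by algebra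
  have d5: "g5 (br x y) = (t * a14) * wedge f1 f4 x y + (t * a23) * wedge f2 f3 x y" for x y
    unfolding g5_def d j by (simp add: algebra_simps)
  have cf': "coframe f1 f2 f3 f4 g5 f6"
    by (rule coframeI) (use t in \<open>auto simp: g5_def[abs_def] intro!: linear_rules l\<close>)
  have d6: "f6 (br x y) = s12 * wedge f1 f2 x y + (s13 + a12 * s15) * wedge f1 f3 x y
      + (s14 + a13 * s15) * wedge f1 f4 x y + u * s15 * wedge f1 g5 x y
      + (s23 + a12 * s25) * wedge f2 f3 x y + (s24 + a13 * s25) * wedge f2 f4 x y
          + u * s25 * wedge f2 g5 x y
      + (s34 + a13 * s35 - a12 * s45) * wedge f3 f4 x y + u * s35 * wedge f3 g5 x y
      + u * s45 * wedge f4 g5 x y" for x y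
    unfolding d wedge_def f5 by (simp add: algebra_simps)
  show ?thesis
  proof (cases "a14 = 0")
    case True
    then show ?thesis
      by (intro two_generators_degenerate[OF cf' d(1-4) _ d6, of "t * a23"]) (simp add: d5 t)
  next
    case False
    then show ?thesis
      by (intro two_generators_generic[OF cf' d(1-4) _ d6, of "t * a23"]) (simp add: d5 t)
  qed
qed

lemma two_generators_pivot:
  assumes cf: "coframe f1 f2 f3 f4 f5 f6"
    and d: "\<And>x y. f1 (br x y) = 0" "\<And>x y. f2 (br x y) = 0"
      "\<And>x y. f3 (br x y) = wedge f1 f2 x y"
      "\<And>x y. f4 (br x y) = form3 f1 f2 f3 p12 p13 p23 x y"
      "\<And>x y. f5 (br x y) = form4 f1 f2 f3 f4 a12 a13 a14 a23 a24 a34 x y"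
      "\<And>x y. f6 (br x y) = form5 f1 f2 f3 f4 f5 s12 s13 s14 s15 s23 s24 s25 s34 s35 s45 x y"
    and p13: "p13 \<noteq> 0"
  shows "has_pure_frame br"
proof -
  note l = coframeD[OF cf]
  define t where "t = 1 / p13"
  have t: "t * p13 = 1" using p13 by (simp add: t_def)
  define g1 where "g1 x = p13 * f1 x + p23 * f2 x" for x
  define g2 where "g2 x = t * f2 x" for x
  define g4 where "g4 x = f4 x - p12 * f3 x" for x
  show ?thesis
  proof (rule two_generators_reduced[of g1 g2 f3 g4 f5 f6
      a12 "t * (a13 + p12 * a14)" "t * a14" "p13 * (a23 + p12 * a24) - p23 * (a13 + p12 * a14)"
          "p13 * a24 - p23 * a14" a34
      s12 "t * (s13 + p12 * s14)" "t * s14" "t * s15" "p13 * (s23 + p12 * s24) - p23 * (s13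
          + p12 * s14)"
      "p13 * s24 - p23 * s14" "p13 * s25 - p23 * s15" s34 "s35 + p12 * s45" s45], goal_cases)
    case 1
    show ?case
      by (rule coframeI)
        (use t in \<open>auto simp: g1_def[abs_def] g2_def[abs_def] g4_def[abs_def] intro!: linear_rules
            l\<close>)
  next
    case (4 x y)
    show ?case unfolding d wedge_def g1_def g2_def using t by algebra
  next
    case (5 x y)
    show ?case unfolding g4_def d wedge_def g1_def g2_def by (simp add: algebra_simps)
  next
    case (6 x y)
    show ?case unfolding g4_def d wedge_def g1_def g2_def using t by algebra
  next
    case (7 x y)
    show ?case unfolding g4_def d wedge_def g1_def g2_def using t by algebra
  qed (simp_all add: g1_def g2_def d)
qed

lemma two_generators_normalized:
  assumes cf: "coframe f1 f2 f3 f4 f5 f6"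
    and d: "\<And>x y. f1 (br x y) = 0" "\<And>x y. f2 (br x y) = 0"
      "\<And>x y. f3 (br x y) = wedge f1 f2 x y"
      "\<And>x y. f4 (br x y) = form3 f1 f2 f3 p12 p13 p23 x y"
      "\<And>x y. f5 (br x y) = form4 f1 f2 f3 f4 a12 a13 a14 a23 a24 a34 x y"
      "\<And>x y. f6 (br x y) = form5 f1 f2 f3 f4 f5 s12 s13 s14 s15 s23 s24 s25 s34 s35 s45 x y"
  shows "has_pure_frame br"
proof -
  note l = coframeD[OF cf]
  consider "p13 \<noteq> 0" | "p23 \<noteq> 0" | "p13 = 0" "p23 = 0" by blast
  then show ?thesis
  proof cases
    case 1
    show ?thesis by (rule two_generators_pivot[OF cf d 1])
  next
    case 2
    show ?thesis
    proof (rule two_generators_pivot[of f2 f1 "\<lambda>x. - f3 x" f4 f5 f6 "- p12" "- p23" "- p13"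
        "- a12" "- a23" a24 "- a13" a14 "- a34"
        "- s12" "- s23" s24 s25 "- s13" s14 s15 "- s34" "- s35" s45], goal_cases)
      case 1
      show ?case by (rule coframeI) (auto intro!: linear_rules l)
    qed (use 2 in \<open>simp_all add: d wedge_def algebra_simps\<close>)
  next
    case 3
    show ?thesis
    proof (rule three_closed_forms[of f1 f2 "\<lambda>x. f4 x - p12 * f3 x" f3 f5 f6 1 0 0
        a12 a14 "a13 + p12 * a14" a24 "a23 + p12 * a24" "- a34"
        s12 s14 "s13 + p12 * s14" s15 s24 "s23 + p12 * s24" s25 "- s34" s45 "s35
            + p12 * s45"], goal_cases)
      case 1
      show ?case by (rule coframeI) (auto intro!: linear_rules l)
    qed (use 3 in \<open>simp_all add: d wedge_def algebra_simps\<close>)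
  qed
qed

lemma triangular_coframe:
  assumes cf: "coframe f1 f2 f3 f4 f5 f6"
    and d: "\<And>x y. f1 (br x y) = 0" "\<And>x y. f2 (br x y) = 0"
      "\<And>x y. f3 (br x y) = c * wedge f1 f2 x y"
      "\<And>x y. f4 (br x y) = form3 f1 f2 f3 p12 p13 p23 x y"
      "\<And>x y. f5 (br x y) = form4 f1 f2 f3 f4 a12 a13 a14 a23 a24 a34 x y"
      "\<And>x y. f6 (br x y) = form5 f1 f2 f3 f4 f5 s12 s13 s14 s15 s23 s24 s25 s34 s35 s45 x y"
  shows "has_pure_frame br"
proof (cases "c = 0")
  case True
  then have "f3 (br x y) = 0" for x y by (simp add: d)
  then show ?thesis by (rule three_closed_forms[OF cf d(1,2) _ d(4-6)])
next
  case False
  note l = coframeD[OF cf]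
  show ?thesis
  proof (rule two_generators_normalized[of f1 f2 "\<lambda>x. f3 x / c" f4 f5 f6 p12 "c * p13" "c * p23"
        a12 "c * a13" a14 "c * a23" a24 "c * a34"
        s12 "c * s13" s14 s15 "c * s23" s24 s25 "c * s34" "c * s35" s45], goal_cases)
    case 1
    show ?case by (rule coframeI) (use False in \<open>auto intro!: linear_rules l\<close>)
  qed (use False in \<open>simp_all add: d wedge_def field_simps\<close>)
qed

section \<open>Triangular coframes of nilpotent Lie algebras\<close>

text \<open>The span of the brackets with \<open>I\<close> is a proper subspace of \<open>I\<close>:
  equality would place \<open>I\<close> inside every term of the lower central series. A functional
  that vanishes on this span but not on \<open>I\<close> is then found by extending a basis.\<close>

lemma ideal_functional:
  assumes nil: "lie_nilpotent br" and I: "subspace I" "I \<noteq> {0}"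
    and ideal: "\<And>x y. y \<in> I \<Longrightarrow> br x y \<in> I"
  shows "\<exists>f z. linear f \<and> z \<in> I \<and> f z = (1::real) \<and> (\<forall>x. \<forall>y\<in>I. f (br x y) = 0)"
proof -
  define J where "J = span {br x y |x y. y \<in> I}"
  have JI: "J \<subseteq> I" unfolding J_def by (rule span_minimal) (use I ideal in auto)
  have "J \<noteq> I"
  proof
    assume "J = I"
    have sub: "I \<subseteq> lower_central_series br k" for k
    proof (induction k)
      case (Suc k)
      have "J \<subseteq> lower_central_series br (Suc k)"
        unfolding J_def lower_central_series.simps by (rule span_mono) (use Suc in blast)
      then show ?case using \<open>J = I\<close> by simp
    qed simp
    obtain k where "lower_central_series br k = {0}" using nil unfolding lie_nilpotent_def by blast
    then have "I \<subseteq> {0}" using sub[of k] by simp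
    then show False using I subspace_0[OF I(1)] by blast
  qed
  then obtain z where z: "z \<in> I" "z \<notin> J" using JI by blast
  obtain B where B: "B \<subseteq> J" "independent B" "J \<subseteq> span B" by (rule basis_exists)
  have sB: "span B = J" using B span_minimal[OF B(1)] by (auto simp: J_def)
  have "independent (insert z B)" using z(2) B(2) sB by (simp add: independent_insertI)
  from linear_independent_extend[OF this, of "\<lambda>x. if x = z then 1 else (0::real)"]
  obtain f where f: "linear f" "\<forall>x\<in>insert z B. f x = (if x = z then 1 else (0::real))"
    by blast
  have "f x = 0" if "x \<in> B" for x
    using f(2) that z(2) B(1) by auto
  then have "f x = 0" if "x \<in> J" for x
    using linear_eq_0_on_span[OF f(1)] that sB by blast
  then have "f (br x y) = 0" if "y \<in> I" for x y
    using that span_base[of "br x y" "{br x y |x y. y \<in> I}"] unfolding J_def by blast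
  then have "linear f \<and> z \<in> I \<and> f z = 1 \<and> (\<forall>x. \<forall>y\<in>I. f (br x y) = 0)" using f z(1) by simp
  then show ?thesis by blast
qed

text \<open>The common kernels of the first i functionals form a descending chain of ideals, and
  bracketing with the whole algebra moves each one into the next. The vector \<open>z i\<close> lies
  in the i-th ideal and outside the next; indices start at 0.\<close>

definition flag :: "nat \<Rightarrow> (nat \<Rightarrow> 'v \<Rightarrow> real) \<Rightarrow> (nat \<Rightarrow> 'v) \<Rightarrow> bool" where
  "flag n f z \<longleftrightarrow> (\<forall>i<n. linear (f i) \<and> f i (z i) = 1 \<and> (\<forall>j<i. f j (z i) = 0) \<and>
     (\<forall>x y. (\<forall>j<i. f j y = 0) \<longrightarrow> f i (br x y) = 0))"

lemma flag_extend:
  assumes nil: "lie_nilpotent br" and fl: "flag n f z" and y: "\<forall>j<n. f j y = 0" "y \<noteq> 0"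
  shows "\<exists>f' z'. flag (Suc n) f' z'"
proof -
  define I where "I = {x. \<forall>j<n. f j x = 0}"
  have I: "subspace I"
    using fl by (auto simp: subspace_def I_def flag_def linear_0 linear_add linear_scale)
  have ideal: "br x y \<in> I" if "y \<in> I" for x y
    using fl that unfolding I_def flag_def by simp
  have ne: "I \<noteq> {0}" using y by (auto simp: I_def)
  have "\<exists>g w. linear g \<and> w \<in> I \<and> g w = (1::real) \<and> (\<forall>x. \<forall>y\<in>I. g (br x y) = 0)"
    by (rule ideal_functional[OF nil I ne]) (rule ideal)
  then obtain g w where g: "linear g" "w \<in> I" "g w = (1::real)" "\<And>x y. y \<in> I \<Longrightarrow> g (br x y) = 0"
    by blast
  have "flag (Suc n) (f(n := g)) (z(n := w))"
    unfolding flag_def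
  proof (rule allI, rule impI)
    fix i assume i: "i < Suc n"
    show "linear ((f(n := g)) i) \<and> (f(n := g)) i ((z(n := w)) i) = 1 \<and>
        (\<forall>j<i. (f(n := g)) j ((z(n := w)) i) = 0) \<and>
        (\<forall>x y. (\<forall>j<i. (f(n := g)) j y = 0) \<longrightarrow> (f(n := g)) i (br x y) = 0)"
    proof (cases "i = n")
      case True
      then show ?thesis using g(1-3) g(4)[unfolded I_def] by (simp add: I_def)
    next
      case False
      then have "i < n" using i by simp
      then show ?thesis using fl unfolding flag_def by simp
    qed
  qed
  then show ?thesis by blast
qed

text \<open>\<open>f i\<close> takes the value 1 at \<open>z i\<close> and 0 at all later vectors,
  so independence is built up from the end of the list.\<close>

lemma flag_independent:
  assumes "flag n f z"
  shows "independent (z ` {..<n})" "inj_on z {..<n}"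
proof -
  show inj: "inj_on z {..<n}"
  proof (rule linorder_inj_onI)
    fix i j assume "i < j" "i \<in> {..<n}" "j \<in> {..<n}"
    then have "f i (z i) = 1" "f i (z j) = 0" using assms by (auto simp: flag_def)
    then show "z i \<noteq> z j" by auto
  qed auto
  have "independent (z ` {n - k..<n})" if "k \<le> n" for k
    using that
  proof (induction k)
    case (Suc k)
    have "{n - Suc k..<n} = insert (n - Suc k) {n - k..<n}" using Suc.prems by auto
    moreover have "z (n - Suc k) \<notin> span (z ` {n - k..<n})"
    proof
      assume "z (n - Suc k) \<in> span (z ` {n - k..<n})"
      moreover have "linear (f (n - Suc k))" "f (n - Suc k) (z (n - Suc k)) = 1"
        "\<And>x. x \<in> z ` {n - k..<n} \<Longrightarrow> f (n - Suc k) x = 0"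
        using assms Suc.prems by (auto simp: flag_def)
      ultimately show False using linear_eq_0_on_span[of "f (n - Suc k)"] by fastforce
    qed
    ultimately show ?case using Suc by (simp add: independent_insertI)
  qed (simp add: independent_empty)
  from this[of n] show "independent (z ` {..<n})" by (simp add: atLeast0LessThan)
qed

text \<open>Elimination by triangularity: earlier functionals vanish on \<open>z n\<close>, so
  correcting the last equation by a multiple of \<open>z n\<close> leaves the others intact.\<close>

lemma flag_kernel:
  assumes fl: "flag n f z"
  shows "\<exists>s\<in>span (z ` {..<n}). \<forall>j<n. f j (x - s) = 0"
  using fl
proof (induction n)
  case (Suc n)
  then have "flag n f z" by (auto simp: flag_def)
  then obtain s where s: "s \<in> span (z ` {..<n})" "\<forall>j<n. f j (x - s) = 0" using Suc.IH by blast
  define s' where "s' = s + f n (x - s) *\<^sub>R z n"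
  have "z ` {..<n} \<subseteq> z ` {..<Suc n}" by auto
  then have "s \<in> span (z ` {..<Suc n})" using s(1) span_mono by blast
  then have "s' \<in> span (z ` {..<Suc n})"
    unfolding s'_def by (intro span_add span_scale) (auto intro: span_base)
  moreover have "f j (x - s') = 0" if "j < Suc n" for j
  proof -
    have "linear (f j)" "f j (z n) = (if j = n then 1 else 0)"
      using Suc.prems that by (auto simp: flag_def less_Suc_eq)
    moreover from this(1) have "f j (x - s') = f j (x - s) - f n (x - s) * f j (z n)"
      by (simp add: s'_def linear_diff linear_add linear_scale)
    ultimately show ?thesis using s(2) that by (auto simp: less_Suc_eq)
  qed
  ultimately show ?case by blast
qed (auto intro: span_zero)

lemma flag_exists:
  assumes nil: "lie_nilpotent br" and "n \<le> 6"
  shows "\<exists>f z. flag n f z"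
  using assms(2)
proof (induction n)
  case (Suc n)
  then obtain f z where fl: "flag n f z" by auto
  have "\<exists>y. y \<noteq> 0 \<and> (\<forall>j<n. f j y = 0)"
  proof (rule ccontr)
    assume no: "\<not> (\<exists>y. y \<noteq> 0 \<and> (\<forall>j<n. f j y = 0))"
    have "x \<in> span (z ` {..<n})" for x
    proof -
      obtain s where s: "s \<in> span (z ` {..<n})" "\<forall>j<n. f j (x - s) = 0"
        using flag_kernel[OF fl, of x] by blast
      then have "x - s = 0" using no by blast
      then show ?thesis using s(1) by simp
    qed
    then have "dim (UNIV :: 'v set) \<le> card (z ` {..<n})" by (intro dim_le_card) auto
    also have "\<dots> \<le> n" using card_image_le[of "{..<n}" z] by simp
    finally show False using dim6 Suc.prems by simp
  qed
  then show ?case using flag_extend[OF nil fl] by blast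
next
  case 0
  have "flag 0 f z" for f z by (simp add: flag_def)
  then show ?case by blast
qed

lemma nilpotent_has_pure_frame:
  assumes nil: "lie_nilpotent br"
  shows "has_pure_frame br"
proof -
  obtain f z where fl: "flag 6 f z" using flag_exists[OF nil] by blast
  have lin: "linear (f i)" if "i < 6" for i using fl that by (auto simp: flag_def)
  have cf: "coframe (f 0) (f 1) (f 2) (f 3) (f 4) (f 5)"
  proof (rule coframeI)
    fix x assume "f 0 x = 0" "f 1 x = 0" "f 2 x = 0" "f 3 x = 0" "f 4 x = 0" "f 5 x = 0"
    then have x: "\<forall>j<6. f j x = 0" by (simp add: All_less_Suc numeral_eq_Suc)
    \<comment> \<open>A nonzero vector in the common kernel would prolong the flag to length 7 and
      give 7 independent vectors in dimension 6.\<close>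
    show "x = 0"
    proof (rule ccontr)
      assume "x \<noteq> 0"
      then obtain f' z' where fl': "flag 7 f' z'" using flag_extend[OF nil fl x] by (simp add:
          numeral_eq_Suc) blast
      obtain B :: "'v set" where B: "independent B" "UNIV \<subseteq> span B" "card B = 6"
        using basis_exists[of "UNIV :: 'v set"] dim6 by metis
      have "finite B" using B(3) by (metis card.infinite zero_neq_numeral)
      then have "card (z' ` {..<7}) \<le> card B"
        using independent_span_bound[OF _ flag_independent(1)[OF fl'], of B] B(2) by auto
      then show False using B(3) flag_independent(2)[OF fl'] by (simp add: card_image)
    qed
  qed (simp_all add: lin)
  note l = coframeD[OF cf]
  obtain b1 b2 b3 b4 b5 b6 where "dual_frame (f 0) (f 1) (f 2) (f 3) (f 4) (f 5) b1 b2 b3 b4 b5 b6"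
    using ex_dual_frame[OF dim6 cf] by blast
  note D = dual_frameD[OF this]
  have expand: "x = f 0 x *\<^sub>R b1 + f 1 x *\<^sub>R b2 + f 2 x *\<^sub>R b3 + f 3 x *\<^sub>R b4 + f 4 x *\<^sub>R b5
      + f 5 x *\<^sub>R b6" for x
    by (subst eq_iff_diff_eq_0) (intro l, simp_all add: l linear_diff linear_add linear_scale D
        del: One_nat_def)
  have K: "f i (br x y) = 0" if "i < 6" "\<forall>j<i. f j y = 0" for i x y
    using fl that by (auto simp: flag_def)
  have nums: "(\<forall>j<1::nat. P j) = P 0" "(\<forall>j<2::nat. P j) = (P 0 \<and> P 1)"
    "(\<forall>j<3::nat. P j) = (P 0 \<and> P 1 \<and> P 2)" "(\<forall>j<4::nat. P j) = (P 0 \<and> P 1 \<and> P 2 \<and> P 3)"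
    "(\<forall>j<5::nat. P j) = (P 0 \<and> P 1 \<and> P 2 \<and> P 3 \<and> P 4)" for P
    by (simp_all add: All_less_Suc numeral_eq_Suc conj_ac)
  have two_form: "g (br x y) = g (br b1 b2) * wedge (f 0) (f 1) x y
      + g (br b1 b3) * wedge (f 0) (f 2) x y
        + g (br b1 b4) * wedge (f 0) (f 3) x y + g (br b1 b5) * wedge (f 0) (f 4) x y
        + g (br b1 b6) * wedge (f 0) (f 5) x y + g (br b2 b3) * wedge (f 1) (f 2) x y
        + g (br b2 b4) * wedge (f 1) (f 3) x y + g (br b2 b5) * wedge (f 1) (f 4) x y
        + g (br b2 b6) * wedge (f 1) (f 5) x y + g (br b3 b4) * wedge (f 2) (f 3) x y
        + g (br b3 b5) * wedge (f 2) (f 4) x y + g (br b3 b6) * wedge (f 2) (f 5) x y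
        + g (br b4 b5) * wedge (f 3) (f 4) x y + g (br b4 b6) * wedge (f 3) (f 5) x y
        + g (br b5 b6) * wedge (f 4) (f 5) x y"
    if g: "linear g" for g :: "'v \<Rightarrow> real" and x y
  proof -
    have r: "g (br b y) = f 0 y * g (br b b1) + f 1 y * g (br b b2) + f 2 y * g (br b b3)
        + f 3 y * g (br b b4) + f 4 y * g (br b b5) + f 5 y * g (br b b6)" for b y
      using arg_cong[OF expand[of y], of "\<lambda>v. g (br b v)"]
      unfolding br_add_right br_scale_right linear_add[OF g] linear_scale[OF g] by simp
    have anti: "g (br b2 b1) = - g (br b1 b2)" "g (br b3 b1) = - g (br b1 b3)" "g (br b3 b2) =
        - g (br b2 b3)" "g (br b4 b1) = - g (br b1 b4)" "g (br b4 b2) = - g (br b2 b4)"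
        "g (br b4 b3) = - g (br b3 b4)" "g (br b5 b1) = - g (br b1 b5)" "g (br b5 b2) =
        - g (br b2 b5)" "g (br b5 b3) = - g (br b3 b5)" "g (br b5 b4) = - g (br b4 b5)"
        "g (br b6 b1) = - g (br b1 b6)" "g (br b6 b2) = - g (br b2 b6)" "g (br b6 b3) =
        - g (br b3 b6)" "g (br b6 b4) = - g (br b4 b6)" "g (br b6 b5) = - g (br b5 b6)"
      by (simp_all only: br_anti[of b2 b1] br_anti[of b3 b1] br_anti[of b3 b2] br_anti[of b4 b1]
          br_anti[of b4 b2]
          br_anti[of b4 b3] br_anti[of b5 b1] br_anti[of b5 b2] br_anti[of b5 b3] br_anti[of b5
              b4] br_anti[of b6 b1]
          br_anti[of b6 b2] br_anti[of b6 b3] br_anti[of b6 b4] br_anti[of b6 b5] linear_neg[OF g])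
    have self: "g (br b b) = 0" for b by (simp add: br_self linear_0[OF g])
    have "g (br x y) = f 0 x * g (br b1 y) + f 1 x * g (br b2 y) + f 2 x * g (br b3 y)
        + f 3 x * g (br b4 y)
        + f 4 x * g (br b5 y) + f 5 x * g (br b6 y)"
      using arg_cong[OF expand[of x], of "\<lambda>v. g (br v y)"]
      unfolding br_add_left br_scale_left linear_add[OF g] linear_scale[OF g] by simp
    then show ?thesis
      unfolding r[of _ y] anti self wedge_def by (simp add: algebra_simps)
  qed
  \<comment> \<open>The dual vectors count from 1 and the flag from 0: \<open>f i\<close> kills
    every bracket with the (i+1)-st dual vector or a later one, since those lie in the common kernel
    of the functionals before \<open>f i\<close>.\<close>
  have Z: "f 1 (br u b2) = 0" "f 1 (br u b3) = 0" "f 1 (br u b4) = 0" "f 1 (br u b5) = 0"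
      "f 1 (br u b6) = 0" "f 2 (br u b3) = 0" "f 2 (br u b4) = 0" "f 2 (br u b5) = 0"
      "f 2 (br u b6) = 0" "f 3 (br u b4) = 0" "f 3 (br u b5) = 0" "f 3 (br u b6) = 0"
      "f 4 (br u b5) = 0" "f 4 (br u b6) = 0" "f 5 (br u b6) = 0" for u
    by (rule K, simp, simp only: nums D simp_thms)+
  \<comment> \<open>Every pair of distinct dual vectors contains one different from
    \<open>b1\<close>, so the second functional is closed as well.\<close>
  have k: "f 0 (br x y) = 0" "f 1 (br x y) = 0" for x y
  proof -
    show "f 0 (br x y) = 0" by (rule K) simp_all
    show "f 1 (br x y) = 0" unfolding two_form[OF l(2), of x y] Z by simp
  qed
  show ?thesis
  proof (rule triangular_coframe[OF cf k(1) k(2), of "f 2 (br b1 b2)" "f 3 (br b1 b2)"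
      "f 3 (br b1 b3)" "f 3 (br b2 b3)"
      "f 4 (br b1 b2)" "f 4 (br b1 b3)" "f 4 (br b1 b4)" "f 4 (br b2 b3)" "f 4 (br b2 b4)"
          "f 4 (br b3 b4)"
      "f 5 (br b1 b2)" "f 5 (br b1 b3)" "f 5 (br b1 b4)" "f 5 (br b1 b5)" "f 5 (br b2 b3)"
          "f 5 (br b2 b4)" "f 5 (br b2 b5)"
      "f 5 (br b3 b4)" "f 5 (br b3 b5)" "f 5 (br b4 b5)"], goal_cases)
    case (1 x y)
    show ?case unfolding two_form[OF l(3), of x y] Z by simp
  next
    case (2 x y)
    show ?case unfolding two_form[OF l(4), of x y] Z by simp
  next
    case (3 x y)
    show ?case unfolding two_form[OF l(5), of x y] Z by simp
  next
    case (4 x y)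
    show ?case unfolding two_form[OF l(6), of x y] Z by simp
  qed
qed

end

section \<open>Smooth functions and tangent vectors\<close>

lemma Ck_on_Suc_imp: "Ck_on (Suc k) S f \<Longrightarrow> Ck_on k S f"
proof (induction k arbitrary: f)
  case 0
  then show ?case
    by (auto intro!: continuous_at_imp_continuous_on differentiable_imp_continuous_within)
next
  case (Suc k)
  then show ?case by (metis Ck_on.simps(2))
qed

lemma Ck_on_subset: "Ck_on k S f \<Longrightarrow> T \<subseteq> S \<Longrightarrow> Ck_on k T f"
  by (induction k arbitrary: f) (auto intro: continuous_on_subset)

lemma frechet_derivative_cong_open:
  assumes "open S" "s \<in> S" "\<And>s. s \<in> S \<Longrightarrow> f s = g s"
  shows "f differentiable (at s) \<longleftrightarrow> g differentiable (at s)"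
    and "frechet_derivative f (at s) = frechet_derivative g (at s)"
proof -
  have "(f has_derivative D) (at s) \<longleftrightarrow> (g has_derivative D) (at s)" for D
    using assms has_derivative_transform_within_open[of f D s UNIV S g]
      has_derivative_transform_within_open[of g D s UNIV S f] by auto
  then show "f differentiable (at s) \<longleftrightarrow> g differentiable (at s)"
    and "frechet_derivative f (at s) = frechet_derivative g (at s)"
    by (simp_all add: differentiable_def frechet_derivative_def)
qed

lemma Ck_on_cong:
  assumes "open S" "\<And>s. s \<in> S \<Longrightarrow> f s = g s" "Ck_on k S f"
  shows "Ck_on k S g"
  using assms(2,3)
proof (induction k arbitrary: f g)
  case 0
  then show ?case by (auto cong: continuous_on_cong)
next
  case (Suc k)
  note c = frechet_derivative_cong_open[OF assms(1) _ Suc.prems(1)]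
  have "g differentiable (at s)" if "s \<in> S" for s using c(1)[OF that] Suc.prems(2) that by auto
  moreover have "Ck_on k S (\<lambda>s. frechet_derivative g (at s) v)" for v
    by (rule Suc.IH[of "\<lambda>s. frechet_derivative f (at s) v"]) (use c(2) Suc.prems(2) in auto)
  ultimately show ?case by simp
qed

lemma Ck_on_local:
  assumes "open S" "\<And>s. s \<in> S \<Longrightarrow> \<exists>T. open T \<and> s \<in> T \<and> T \<subseteq> S \<and> Ck_on k T f"
  shows "Ck_on k S f"
  using assms(2)
proof (induction k arbitrary: f)
  case 0
  have "continuous (at s) f" if s: "s \<in> S" for s
  proof -
    obtain T where "open T" "s \<in> T" "continuous_on T f" using 0[OF s] by auto
    then show ?thesis by (simp add: continuous_on_eq_continuous_at)
  qed
  then show ?case by (simp add: continuous_at_imp_continuous_on)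
next
  case (Suc k)
  have "f differentiable (at s)" if "s \<in> S" for s using Suc.prems[OF that] by auto
  moreover have "Ck_on k S (\<lambda>s. frechet_derivative f (at s) v)" for v
    by (rule Suc.IH) (use Suc.prems in \<open>fastforce\<close>)
  ultimately show ?case by simp
qed

lemma Ck_on_const: "Ck_on k S (\<lambda>_. c)"
  by (induction k arbitrary: c) simp_all

lemma frechet_derivative_add_real:
  fixes f g :: "'e::euclidean_space \<Rightarrow> real"
  assumes "f differentiable (at s)" "g differentiable (at s)"
  shows "frechet_derivative (\<lambda>s. f s + g s) (at s) v =
     frechet_derivative f (at s) v + frechet_derivative g (at s) v"
  using frechet_derivative_at[OF has_derivative_add[OF assms[unfolded frechet_derivative_works]],
      symmetric]
  by (simp add: fun_eq_iff)

lemma Ck_on_add: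
  fixes f g :: "'e::euclidean_space \<Rightarrow> real"
  assumes "open S" "Ck_on k S f" "Ck_on k S g"
  shows "Ck_on k S (\<lambda>s. f s + g s)"
  using assms(2,3)
proof (induction k arbitrary: f g)
  case 0
  then show ?case by (auto intro: continuous_intros)
next
  case (Suc k)
  have "Ck_on k S (\<lambda>s. frechet_derivative (\<lambda>s. f s + g s) (at s) v)" for v
  proof (rule Ck_on_cong[OF assms(1)])
    show "Ck_on k S (\<lambda>s. frechet_derivative f (at s) v + frechet_derivative g (at s) v)"
      using Suc by simp
  qed (use Suc.prems in \<open>simp add: frechet_derivative_add_real\<close>)
  then show ?case using Suc.prems by simp
qed

lemma frechet_derivative_mult_real:
  fixes f g :: "'e::euclidean_space \<Rightarrow> real"
  assumes "f differentiable (at s)" "g differentiable (at s)"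
  shows "frechet_derivative (\<lambda>s. f s * g s) (at s) v =
     f s * frechet_derivative g (at s) v + frechet_derivative f (at s) v * g s"
  using frechet_derivative_at[OF has_derivative_mult[OF assms[unfolded frechet_derivative_works]],
      symmetric]
  by (simp add: fun_eq_iff)

lemma Ck_on_mult:
  fixes f g :: "'e::euclidean_space \<Rightarrow> real"
  assumes "open S" "Ck_on k S f" "Ck_on k S g"
  shows "Ck_on k S (\<lambda>s. f s * g s)"
  using assms(2,3)
proof (induction k arbitrary: f g)
  case 0
  then show ?case by (auto intro: continuous_intros)
next
  case (Suc k)
  have "Ck_on k S (\<lambda>s. frechet_derivative (\<lambda>s. f s * g s) (at s) v)" for v
  proof (rule Ck_on_cong[OF assms(1)])
    show "Ck_on k S (\<lambda>s. f s * frechet_derivative g (at s) v + frechet_derivative f (at s) v * g s)"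
      by (intro Ck_on_add assms(1) Suc.IH) (use Suc.prems Ck_on_Suc_imp in auto)
  qed (use Suc.prems in \<open>simp add: frechet_derivative_mult_real\<close>)
  then show ?case using Suc.prems by simp
qed

lemma Ck_on_inverse:
  fixes f :: "'e::euclidean_space \<Rightarrow> real"
  assumes "open S" "Ck_on k S f" "\<And>s. s \<in> S \<Longrightarrow> f s \<noteq> 0"
  shows "Ck_on k S (\<lambda>s. inverse (f s))"
  using assms(2)
proof (induction k)
  case 0
  then show ?case using assms(3) by (auto intro: continuous_intros)
next
  case (Suc k)
  \<comment> \<open>The derivative of the reciprocal contains the reciprocal again, at one order
    less; hence the induction on \<open>k\<close> keeps \<open>f\<close> fixed.\<close>
  have inv: "Ck_on k S (\<lambda>s. inverse (f s))" using Suc Ck_on_Suc_imp by blast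
  have der: "((\<lambda>s. inverse (f s)) has_derivative
      (\<lambda>v. - (inverse (f s) * frechet_derivative f (at s) v * inverse (f s)))) (at s)" if
          "s \<in> S" for s
    using that Suc.prems assms(3)
    by (intro Deriv.has_derivative_inverse) (auto simp: frechet_derivative_works[symmetric])
  have "Ck_on k S (\<lambda>s. frechet_derivative (\<lambda>s. inverse (f s)) (at s) v)" for v
  proof (rule Ck_on_cong[OF assms(1)])
    show "Ck_on k S (\<lambda>s. (- 1) * (inverse (f s) * frechet_derivative f (at s) v * inverse (f s)))"
      by (intro Ck_on_mult Ck_on_const assms(1) inv) (use Suc.prems in auto)
  qed (use frechet_derivative_at[OF der, symmetric] in simp)
  then show ?case using der by (auto simp: differentiable_def)
qed

text \<open>Smoothness on a part of the manifold is needed because frame coefficients arise as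
  quotients that make sense only where a determinant is nonzero.\<close>

definition smooth_near ::
  "('a::topological_space, 'e::euclidean_space) chart set \<Rightarrow> 'a set \<Rightarrow> ('a \<Rightarrow> real) \<Rightarrow> bool" where
  "smooth_near A N f \<longleftrightarrow> (\<forall>(U, x)\<in>A. smooth_on (x ` (U \<inter> N)) (\<lambda>s. f (inv_into U x s)))"

lemma chart_facts:
  assumes "smooth_atlas A" "(U, x) \<in> A"
  shows "open U" "open (x ` U)" "inj_on x U" "continuous_on U x"
      "continuous_on (x ` U) (inv_into U x)"
    and "\<And>N. open N \<Longrightarrow> open (x ` (U \<inter> N))"
proof -
  have c: "open U" "open (x ` U)" and h: "homeomorphism U (x ` U) x (inv_into U x)"
    using assms unfolding smooth_atlas_def is_chart_def by auto
  show "open U" "open (x ` U)" by (fact c)+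
  show "continuous_on U x" "continuous_on (x ` U) (inv_into U x)" using h by (auto simp:
      homeomorphism_def)
  show "inj_on x U" using h by (auto simp: homeomorphism_def intro!: inj_on_inverseI[where g =
      "inv_into U x"])
  fix N :: "'a set" assume "open N"
  then have "openin (top_of_set U) (U \<inter> N)" by (simp add: openin_open_Int)
  then have "openin (top_of_set (x ` U)) (x ` (U \<inter> N))" by (rule homeomorphism_imp_open_map[OF h])
  then show "open (x ` (U \<inter> N))" using c(2) by (simp add: openin_open_eq)
qed

lemma chart_at:
  assumes "smooth_atlas A"
  obtains U x where "(U, x) \<in> A" "p \<in> U"
  using assms unfolding smooth_atlas_def by blast

lemma smooth_near_UNIV_continuous:
  fixes f :: "'a::t2_space \<Rightarrow> real"
  assumes A: "smooth_atlas A" and f: "smooth_near A UNIV f"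
  shows "continuous_on UNIV f"
proof -
  have "continuous (at p) f" for p
  proof -
    obtain U x where c: "(U, x) \<in> A" "p \<in> U" using chart_at[OF A] .
    note cf = chart_facts[OF A c(1)]
    have "Ck_on 0 (x ` (U \<inter> UNIV)) (\<lambda>s. f (inv_into U x s))"
      using f c(1) unfolding smooth_near_def smooth_on_def by blast
    then have "continuous_on (x ` U) (\<lambda>s. f (inv_into U x s))" by simp
    then have "continuous_on U (\<lambda>q. f (inv_into U x (x q)))"
      using continuous_on_compose2[OF _ cf(4)] by blast
    then have "continuous_on U f" using cf(3) by (simp cong: continuous_on_cong)
    then show ?thesis using cf(1) c(2) by (simp add: continuous_on_eq_continuous_at)
  qed
  then show ?thesis by (simp add: continuous_at_imp_continuous_on)
qed

lemma smooth_fun_iff: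
  fixes f :: "'a::t2_space \<Rightarrow> real"
  assumes A: "smooth_atlas A"
  shows "smooth_fun A f \<longleftrightarrow> smooth_near A UNIV f"
proof -
  have "smooth_fun A f \<longleftrightarrow> continuous_on UNIV f \<and> smooth_near A UNIV f"
    unfolding smooth_fun_def smooth_map_def smooth_near_def by simp
  then show ?thesis using smooth_near_UNIV_continuous[OF A] by blast
qed

lemma smooth_near_mono: "smooth_near A N f \<Longrightarrow> M \<subseteq> N \<Longrightarrow> smooth_near A M f"
  unfolding smooth_near_def smooth_on_def by (fastforce intro: Ck_on_subset)

lemma smooth_near_cong:
  assumes "smooth_atlas A" "open N" "\<And>q. q \<in> N \<Longrightarrow> f q = g q" "smooth_near A N f"
  shows "smooth_near A N g"
  unfolding smooth_near_def smooth_on_def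
proof safe
  fix U x k assume c: "(U, x) \<in> A"
  note cf = chart_facts[OF assms(1) c]
  show "Ck_on k (x ` (U \<inter> N)) (\<lambda>s. g (inv_into U x s))"
  proof (rule Ck_on_cong[OF cf(6)[OF assms(2)]])
    show "Ck_on k (x ` (U \<inter> N)) (\<lambda>s. f (inv_into U x s))"
      using assms(4) c unfolding smooth_near_def smooth_on_def by blast
  qed (use cf(3) assms(3) in auto)
qed

lemma smooth_near_locally:
  assumes A: "smooth_atlas A" and "\<And>p. \<exists>N. open N \<and> p \<in> N \<and> smooth_near A N f"
  shows "smooth_near A UNIV f"
  unfolding smooth_near_def smooth_on_def
proof safe
  fix U x k assume c: "(U, x) \<in> A"
  note cf = chart_facts[OF A c]
  show "Ck_on k (x ` (U \<inter> UNIV)) (\<lambda>s. f (inv_into U x s))"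
  proof (rule Ck_on_local)
    fix s assume "s \<in> x ` (U \<inter> UNIV)"
    then obtain p where p: "p \<in> U" "s = x p" by blast
    obtain N where N: "open N" "p \<in> N" "smooth_near A N f" using assms(2) by blast
    then show "\<exists>T. open T \<and> s \<in> T \<and> T \<subseteq> x ` (U \<inter> UNIV) \<and> Ck_on k T (\<lambda>s. f (inv_into U x s))"
      using cf(6)[OF N(1)] p c unfolding smooth_near_def smooth_on_def
      by (intro exI[of _ "x ` (U \<inter> N)"]) auto
  qed (use cf in simp)
qed

lemma smooth_near_const: "smooth_near A N (\<lambda>_. c)"
  unfolding smooth_near_def smooth_on_def by (auto intro: Ck_on_const)

lemma smooth_near_add:
  assumes "smooth_atlas A" "open N" "smooth_near A N f" "smooth_near A N g"
  shows "smooth_near A N (\<lambda>q. f q + g q)"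
  using assms(3,4) chart_facts(6)[OF assms(1) _ assms(2)] unfolding smooth_near_def smooth_on_def
  by (fast intro: Ck_on_add)

lemma smooth_near_mult:
  assumes "smooth_atlas A" "open N" "smooth_near A N f" "smooth_near A N g"
  shows "smooth_near A N (\<lambda>q. f q * g q)"
  using assms(3,4) chart_facts(6)[OF assms(1) _ assms(2)] unfolding smooth_near_def smooth_on_def
  by (fast intro: Ck_on_mult)

lemma smooth_near_inverse:
  assumes "smooth_atlas A" "open N" "smooth_near A N f" "\<And>q. q \<in> N \<Longrightarrow> f q \<noteq> 0"
  shows "smooth_near A N (\<lambda>q. inverse (f q))"
  unfolding smooth_near_def smooth_on_def
proof safe
  fix U x k assume c: "(U, x) \<in> A"
  show "Ck_on k (x ` (U \<inter> N)) (\<lambda>s. inverse (f (inv_into U x s)))"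
  proof (rule Ck_on_inverse[OF chart_facts(6)[OF assms(1) c assms(2)]])
    show "Ck_on k (x ` (U \<inter> N)) (\<lambda>s. f (inv_into U x s))"
      using assms(3) c unfolding smooth_near_def smooth_on_def by blast
  qed (use assms(4) chart_facts(3)[OF assms(1) c] in auto)
qed

lemma smooth_near_sum:
  assumes "smooth_atlas A" "open N" "\<And>i. i \<in> I \<Longrightarrow> smooth_near A N (f i)"
  shows "smooth_near A N (\<lambda>q. \<Sum>i\<in>I. f i q)"
  using assms(3)
  by (induction I rule: infinite_finite_induct)
    (auto intro: smooth_near_const smooth_near_add[OF assms(1,2)])

lemma smooth_near_prod:
  assumes "smooth_atlas A" "open N" "\<And>i. i \<in> I \<Longrightarrow> smooth_near A N (f i)"
  shows "smooth_near A N (\<lambda>q. \<Prod>i\<in>I. f i q)"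
  using assms(3)
  by (induction I rule: infinite_finite_induct)
    (auto intro: smooth_near_const smooth_near_mult[OF assms(1,2)])

text \<open>Determinants are polynomials in their entries; this prepares Cramer's rule in
  \<open>smooth_coef\<close>.\<close>

lemma smooth_near_det:
  fixes M :: "'a::t2_space \<Rightarrow> real^'n^'n"
  assumes "smooth_atlas A" "open N" "\<And>i j. smooth_near A N (\<lambda>q. M q $ i $ j)"
  shows "smooth_near A N (\<lambda>q. det (M q))"
  unfolding det_def
  by (intro smooth_near_sum smooth_near_mult smooth_near_prod smooth_near_const assms)

section \<open>Smooth functions and tangent vectors as derivations\<close>

lemma smooth_fun_differentiable:
  fixes f :: "'a::t2_space \<Rightarrow> real"
  assumes A: "smooth_atlas A" and f: "smooth_fun A f" and c: "(U, x) \<in> A" "p \<in> U"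
  shows "(\<lambda>s. f (inv_into U x s)) differentiable (at (x p))"
proof -
  have "Ck_on (Suc 0) (x ` (U \<inter> UNIV)) (\<lambda>s. f (inv_into U x s))"
    using f c(1) unfolding smooth_fun_iff[OF A] smooth_near_def smooth_on_def by blast
  then show ?thesis using c(2) by simp
qed

lemma smooth_fun_const:
  fixes c :: real
  shows "smooth_atlas A \<Longrightarrow> smooth_fun (A :: ('a::t2_space, 'e::euclidean_space) chart set) (\<lambda>_. c)"
  by (simp add: smooth_fun_iff smooth_near_const)

lemma smooth_fun_add:
  fixes f g :: "'a::t2_space \<Rightarrow> real"
  shows "smooth_atlas A \<Longrightarrow> smooth_fun A f \<Longrightarrow> smooth_fun A g \<Longrightarrow> smooth_fun A (\<lambda>q. f q + g q)"
  by (simp add: smooth_fun_iff smooth_near_add)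

lemma smooth_fun_mult:
  fixes f g :: "'a::t2_space \<Rightarrow> real"
  shows "smooth_atlas A \<Longrightarrow> smooth_fun A f \<Longrightarrow> smooth_fun A g \<Longrightarrow> smooth_fun A (\<lambda>q. f q * g q)"
  by (simp add: smooth_fun_iff smooth_near_mult)

lemma smooth_fun_sum:
  fixes f :: "'i \<Rightarrow> 'a::t2_space \<Rightarrow> real"
  shows "smooth_atlas A \<Longrightarrow> (\<And>i. i \<in> I \<Longrightarrow> smooth_fun A (f i)) \<Longrightarrow> smooth_fun A (\<lambda>q. \<Sum>i\<in>I. f i q)"
  by (simp add: smooth_fun_iff smooth_near_sum)

lemma tangent_chart:
  fixes A :: "('a::t2_space, 'e::euclidean_space) chart set"
  assumes "u \<in> tangent_space A p"
  shows "\<exists>U x w. (U, x) \<in> A \<and> p \<in> U \<and>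
    (\<forall>f. smooth_fun A f \<longrightarrow> u f = frechet_derivative (\<lambda>s. f (inv_into U x s)) (at (x p)) w)"
proof -
  obtain U x w where *: "(U, x) \<in> A" "p \<in> U"
    "u = (\<lambda>f. if smooth_fun A f then frechet_derivative (\<lambda>s. f (inv_into U x s)) (at (x p)) w else
        0)"
    using assms unfolding tangent_space_def by blast
  then show ?thesis by (intro exI[of _ U] exI[of _ x] exI[of _ w]) simp
qed

lemma tangent_nonsmooth: "u \<in> tangent_space A p \<Longrightarrow> \<not> smooth_fun A f \<Longrightarrow> u f = 0"
  unfolding tangent_space_def by auto

lemma tangent_const:
  fixes A :: "('a::t2_space, 'e::euclidean_space) chart set"
  assumes "smooth_atlas A" "u \<in> tangent_space A p"
  shows "u (\<lambda>_. c) = 0"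
proof -
  obtain U x w where "(U, x) \<in> A" "p \<in> U"
    and u: "\<And>f. smooth_fun A f \<Longrightarrow> u f = frechet_derivative (\<lambda>s. f (inv_into U x s)) (at (x p)) w"
    using tangent_chart[OF assms(2)] by blast
  show ?thesis unfolding u[OF smooth_fun_const[OF assms(1)]] by (simp add: frechet_derivative_const)
qed

lemma tangent_add:
  fixes A :: "('a::t2_space, 'e::euclidean_space) chart set"
  assumes A: "smooth_atlas A" and u: "u \<in> tangent_space A p" and f: "smooth_fun A f" and g:
      "smooth_fun A g"
  shows "u (\<lambda>q. f q + g q) = u f + u g"
proof -
  obtain U x w where c: "(U, x) \<in> A" "p \<in> U"
    and u: "\<And>f. smooth_fun A f \<Longrightarrow> u f = frechet_derivative (\<lambda>s. f (inv_into U x s)) (at (x p)) w"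
    using tangent_chart[OF u] by blast
  show ?thesis
    unfolding u[OF f] u[OF g] u[OF smooth_fun_add[OF A f g]]
    by (rule frechet_derivative_add_real) (rule smooth_fun_differentiable[OF A _ c], fact)+
qed

lemma tangent_mult:
  fixes A :: "('a::t2_space, 'e::euclidean_space) chart set"
  assumes A: "smooth_atlas A" and u: "u \<in> tangent_space A p" and f: "smooth_fun A f" and g:
      "smooth_fun A g"
  shows "u (\<lambda>q. f q * g q) = f p * u g + g p * u f"
proof -
  obtain U x w where c: "(U, x) \<in> A" "p \<in> U"
    and u: "\<And>f. smooth_fun A f \<Longrightarrow> u f = frechet_derivative (\<lambda>s. f (inv_into U x s)) (at (x p)) w"
    using tangent_chart[OF u] by blast
  have "frechet_derivative (\<lambda>s. f (inv_into U x s) * g (inv_into U x s)) (at (x p)) w =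
      f (inv_into U x (x p)) * frechet_derivative (\<lambda>s. g (inv_into U x s)) (at (x p)) w +
      frechet_derivative (\<lambda>s. f (inv_into U x s)) (at (x p)) w * g (inv_into U x (x p))"
    by (rule frechet_derivative_mult_real) (rule smooth_fun_differentiable[OF A _ c], fact)+
  then show ?thesis
    unfolding u[OF f] u[OF g] u[OF smooth_fun_mult[OF A f g]]
    using chart_facts(3)[OF A c(1)] c(2) by simp
qed

lemma tangent_sum:
  fixes A :: "('a::t2_space, 'e::euclidean_space) chart set"
  assumes A: "smooth_atlas A" and u: "u \<in> tangent_space A p" and f: "\<And>i. i \<in> I \<Longrightarrow> smooth_fun A (f i)"
  shows "u (\<lambda>q. \<Sum>i\<in>I. f i q) = (\<Sum>i\<in>I. u (f i))"
  using f
proof (induction I rule: infinite_finite_induct)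
  case (insert i I)
  then show ?case by (simp add: tangent_add[OF A u] smooth_fun_sum[OF A])
qed (simp_all add: tangent_const[OF A u])

lemma tangent_cmult:
  fixes A :: "('a::t2_space, 'e::euclidean_space) chart set"
  assumes A: "smooth_atlas A" and u: "u \<in> tangent_space A p" and f: "smooth_fun A f"
  shows "u (\<lambda>q. c * f q) = c * u f"
  using tangent_mult[OF A u smooth_fun_const[OF A, of c] f] tangent_const[OF A u] by simp

section \<open>The Levi-Civita connection of an orthonormal frame with constant structure\<close>

text \<open>A pointwise basis of smooth fields whose brackets have constant coefficients
  \<open>c\<close>, as for left-invariant fields. Independence is that of functionals on functions,
  matching the encoding of tangent vectors.\<close>

locale smooth_frame =
  fixes A :: "('a::t2_space, 'e::euclidean_space) chart set"
    and e :: "'n::finite \<Rightarrow> 'a vector_field"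
    and c :: "'n \<Rightarrow> 'n \<Rightarrow> 'n \<Rightarrow> real"
  assumes atlas: "smooth_atlas A"
    and frame_smooth: "\<And>i. smooth_vector_field A (e i)"
    and frame_span: "\<And>p u. u \<in> tangent_space A p \<Longrightarrow> \<exists>a. u = (\<lambda>f. \<Sum>i\<in>UNIV. a i * e i p f)"
    and frame_tangent: "\<And>p a. (\<lambda>f. \<Sum>i\<in>UNIV. a i * e i p f) \<in> tangent_space A p"
    and frame_independent: "\<And>p a i. (\<And>f. (\<Sum>i\<in>UNIV. a i * e i p f) = 0) \<Longrightarrow> a i = 0"
    and frame_bracket: "\<And>i j. vf_bracket (e i) (e j) = (\<lambda>p f. \<Sum>k\<in>UNIV. c i j k * e k p f)"
begin

definition comb :: "'a \<Rightarrow> ('n \<Rightarrow> real) \<Rightarrow> 'a tangent" where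
  "comb p a = (\<lambda>f. \<Sum>i\<in>UNIV. a i * e i p f)"

definition coef :: "'a \<Rightarrow> 'a tangent \<Rightarrow> 'n \<Rightarrow> real" where
  "coef p u = (SOME a. u = comb p a)"

lemma comb_eqD: "comb p a = comb p b \<Longrightarrow> a = b"
proof
  fix i assume "comb p a = comb p b"
  then have "(\<Sum>i\<in>UNIV. (a i - b i) * e i p f) = 0" for f
    by (simp add: comb_def left_diff_distrib sum_subtractf fun_eq_iff)
  from frame_independent[of "\<lambda>i. a i - b i", OF this, of i] show "a i = b i" by simp
qed

lemma coef_comb: "coef p (comb p a) = a"
  unfolding coef_def by (rule someI2[of _ a]) (auto dest: comb_eqD)

lemma coef_eqI: "(\<And>f. u f = (\<Sum>i\<in>UNIV. a i * e i p f)) \<Longrightarrow> coef p u = a"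
proof -
  assume "\<And>f. u f = (\<Sum>i\<in>UNIV. a i * e i p f)"
  then have "u = comb p a" by (simp add: comb_def fun_eq_iff)
  then show ?thesis by (simp add: coef_comb)
qed

lemma comb_coef: "u \<in> tangent_space A p \<Longrightarrow> comb p (coef p u) = u"
  using frame_span[of u p] coef_comb[of p] by (auto simp: comb_def[symmetric])

lemma expand: "u \<in> tangent_space A p \<Longrightarrow> u f = (\<Sum>i\<in>UNIV. coef p u i * e i p f)"
  using comb_coef[of u p] by (simp add: comb_def fun_eq_iff)

lemma frame_in_tangent: "e i p \<in> tangent_space A p"
  using frame_smooth unfolding smooth_vector_field_def by blast

lemma coef_frame: "coef p (e i p) = (\<lambda>j. if i = j then 1 else 0)"
  by (rule coef_eqI) (simp add: if_distrib[of "\<lambda>x. x * _"] cong: if_cong)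

lemma coef_tangent_comb:
  assumes "u \<in> tangent_space A p" "v \<in> tangent_space A p"
  shows "coef p (tangent_comb a u b v) = (\<lambda>i. a * coef p u i + b * coef p v i)"
  by (rule coef_eqI) (simp add: tangent_comb_def expand[OF assms(1)] expand[OF assms(2)]
      sum_distrib_left sum.distrib algebra_simps)

lemma coef_scale:
  assumes "u \<in> tangent_space A p"
  shows "coef p (\<lambda>f. a * u f) = (\<lambda>i. a * coef p u i)"
  by (rule coef_eqI) (simp add: expand[OF assms] sum_distrib_left algebra_simps)

lemma structure_constants_antisym: "c j i k = - c i j k"
proof -
  \<comment> \<open>Any point serves, because the coefficients are constant.\<close>
  fix p :: 'a
  have "vf_bracket (e i) (e j) p f + vf_bracket (e j) (e i) p f = 0" for f
    by (simp add: vf_bracket_def)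
  then have "(\<Sum>k\<in>UNIV. (c i j k + c j i k) * e k p f) = 0" for f
    by (simp add: frame_bracket distrib_right sum.distrib)
  from frame_independent[of "\<lambda>k. c i j k + c j i k", OF this, of k] show ?thesis by simp
qed

text \<open>The frame vectors are independent as functionals on smooth functions, so a dual system of
  smooth functions exists by linear algebra; no bump functions are needed.\<close>

lemma dual_functions:
  "\<exists>f. (\<forall>j. smooth_fun A (f j)) \<and> (\<forall>i j. e i p (f j) = (if i = j then 1 else 0))"
proof -
  define E :: "('a \<Rightarrow> real) \<Rightarrow> real^'n" where "E f = (\<chi> i. e i p f)" for f
  define S where "S = E ` {f. smooth_fun A f}"
  note t = frame_in_tangent
  have sub: "subspace S"
    unfolding subspace_def
  proof safe
    have "E (\<lambda>_. 0) = 0" by (simp add: E_def vec_eq_iff tangent_const[OF atlas t])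
    then show "0 \<in> S" unfolding S_def using smooth_fun_const[OF atlas, of 0] by force
  next
    fix x y assume "x \<in> S" "y \<in> S"
    then obtain f g where fg: "x = E f" "y = E g" "smooth_fun A f"
        "smooth_fun A g" by (auto simp: S_def)
    have "x + y = E (\<lambda>q. f q + g q)"
      by (simp add: fg E_def vec_eq_iff tangent_add[OF atlas t fg(3,4)])
    then show "x + y \<in> S" unfolding S_def using smooth_fun_add[OF atlas fg(3,4)] by blast
  next
    fix a x assume "x \<in> S"
    then obtain f where f: "x = E f" "smooth_fun A f" by (auto simp: S_def)
    have "a *\<^sub>R x = E (\<lambda>q. a * f q)"
      by (simp add: f E_def vec_eq_iff tangent_cmult[OF atlas t f(2)])
    then show "a *\<^sub>R x \<in> S"
      unfolding S_def using smooth_fun_mult[OF atlas smooth_fun_const[OF atlas] f(2), of a] by blast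
  qed
  \<comment> \<open>A nonzero normal vector of a proper subspace \<open>S\<close> would be a
    relation among the \<open>e i p\<close> on smooth functions, and then on all functions, since
    tangent vectors vanish on the others.\<close>
  have "S = UNIV"
  proof (rule ccontr)
    assume "S \<noteq> UNIV"
    then have "dim S < DIM(real^'n)"
      using sub dim_eq_full[of S] dim_subset_UNIV[of S] span_eq_iff[of S] by fastforce
    then obtain a where a: "a \<noteq> 0" "\<And>y. y \<in> span S \<Longrightarrow> orthogonal a y"
      using orthogonal_to_subspace_exists by blast
    have "(\<Sum>i\<in>UNIV. a $ i * e i p f) = 0" for f
    proof (cases "smooth_fun A f")
      case True
      then have "E f \<in> span S" by (auto simp: S_def intro: span_base)
      then show ?thesis using a(2)[of "E f"] by (simp add: orthogonal_def inner_vec_def E_def)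
    next
      case False
      then show ?thesis by (simp add: tangent_nonsmooth[OF t])
    qed
    from frame_independent[of "\<lambda>i. a $ i", OF this] show False using a(1) by (simp add: vec_eq_iff)
  qed
  have "\<exists>f. smooth_fun A f \<and> E f = axis j 1" for j
  proof -
    have "axis j 1 \<in> S" using \<open>S = UNIV\<close> by simp
    then show ?thesis by (auto simp: S_def)
  qed
  then have "\<exists>f. \<forall>j. smooth_fun A (f j) \<and> E (f j) = axis j 1" by (rule choice[OF allI])
  then obtain f where f: "\<And>j. smooth_fun A (f j)" "\<And>j. E (f j) = axis j 1" by blast
  have "e i p (f j) = (if i = j then 1 else 0)" for i j
    using arg_cong[OF f(2)[of j], of "\<lambda>v. v $ i"] by (simp add: E_def axis_def)
  then show ?thesis using f(1) by blast
qed

text \<open>Near a point \<open>p0\<close> the coefficients solve a linear system whose matrix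
  consists of the smooth functions \<open>e i q (f j)\<close> and is the identity at
  \<open>p0\<close>. Cramer's rule expresses them as quotients of smooth determinants.\<close>

lemma smooth_coef:
  assumes X: "smooth_vector_field A X"
  shows "smooth_fun A (\<lambda>p. coef p (X p) k)"
  unfolding smooth_fun_iff[OF atlas]
proof (rule smooth_near_locally[OF atlas])
  fix p0
  obtain f where f: "\<And>j. smooth_fun A (f j)" "\<And>i j. e i p0 (f j) = (if i = j then 1 else 0)"
    using dual_functions[of p0] by blast
  define M :: "'a \<Rightarrow> real^'n^'n" where "M q = (\<chi> j i. e i q (f j))" for q
  define B :: "'a \<Rightarrow> real^'n^'n" where "B q = (\<chi> j i. if i = k then X q (f j) else e i q (f j))"
      for q
  have Xt: "X q \<in> tangent_space A q" for q using X by (simp add: smooth_vector_field_def)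
  have sX: "smooth_near A UNIV (\<lambda>q. X q (f j))" "smooth_near A UNIV (\<lambda>q. e i q (f j))" for i j
    using X frame_smooth f(1) unfolding smooth_vector_field_def smooth_fun_iff[OF atlas] by blast+
  have sM: "smooth_near A UNIV (\<lambda>q. det (M q))"
    by (rule smooth_near_det[OF atlas]) (simp_all add: M_def sX)
  have sB: "smooth_near A UNIV (\<lambda>q. det (B q))"
  proof (rule smooth_near_det[OF atlas])
    show "smooth_near A UNIV (\<lambda>q. B q $ j $ i)" for j i
      by (cases "i = k") (simp_all add: B_def sX)
  qed simp
  define N where "N = {q. det (M q) \<noteq> 0}"
  have "M p0 = mat 1" by (simp add: M_def f(2) mat_def vec_eq_iff)
  then have p0: "p0 \<in> N" by (simp add: N_def det_I)
  have N: "open N"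
    unfolding N_def using smooth_near_UNIV_continuous[OF atlas sM]
    by (intro open_Collect_neq continuous_on_const)
  have "smooth_near A N (\<lambda>q. det (B q) * inverse (det (M q)))"
    by (intro smooth_near_mult smooth_near_inverse atlas N)
      (use sB sM smooth_near_mono[of A UNIV _ N] in \<open>auto simp: N_def\<close>)
  then have "smooth_near A N (\<lambda>p. coef p (X p) k)"
  proof (rule smooth_near_cong[OF atlas N, rotated])
    fix q assume "q \<in> N"
    then have q: "det (M q) \<noteq> 0" by (simp add: N_def)
    have "M q *v (\<chi> i. coef q (X q) i) = (\<chi> j. X q (f j))"
      by (simp add: vec_eq_iff matrix_vector_mult_def M_def expand[OF Xt] mult.commute)
    then have "(\<chi> i. coef q (X q) i) = (\<chi> k. det (\<chi> i j. if j = k then (\<chi> j. X q (f j)) $ i else M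
        q $ i $ j) / det (M q))"
      using cramer[OF q] by blast
    then have "coef q (X q) k = det (\<chi> i j. if j = k then (\<chi> j. X q (f j)) $ i else M q $ i $ j) /
        det (M q)"
      by (simp add: vec_eq_iff)
    moreover have "(\<chi> i j. if j = k then (\<chi> j. X q (f j)) $ i else M q $ i $ j) = B q"
      by (simp add: B_def M_def vec_eq_iff)
    ultimately show "det (B q) * inverse (det (M q)) = coef q (X q) k" by (simp add: divide_inverse)
  qed
  then show "\<exists>N. open N \<and> p0 \<in> N \<and> smooth_near A N (\<lambda>p. coef p (X p) k)"
    using N p0 by blast
qed

end

lemma is_levi_civita_smooth:
  assumes "is_levi_civita A g n" "smooth_vector_field A X" "smooth_vector_field A Y"
  shows "smooth_vector_field A (n X Y)"
  using conjunct1[OF assms(1)[unfolded is_levi_civita_def]] assms(2,3) by simp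

lemma is_levi_civita_torsion:
  assumes "is_levi_civita A g n" "smooth_vector_field A X" "smooth_vector_field A Y"
  shows "vf_comb (\<lambda>_. 1) (n X Y) (\<lambda>_. - 1) (n Y X) = vf_bracket X Y"
  using conjunct1[OF assms(1)[unfolded is_levi_civita_def]] assms(2,3) by simp

lemma is_levi_civita_metric:
  assumes "is_levi_civita A g n" "smooth_vector_field A X" "smooth_vector_field A Y"
      "smooth_vector_field A Z"
  shows "X p (\<lambda>q. g q (Y q) (Z q)) = g p (n X Y p) (Z p) + g p (Y p) (n X Z p)"
  using conjunct1[OF conjunct2[OF assms(1)[unfolded is_levi_civita_def]]] assms(2-4) by simp

lemma sum_swap_product:
  fixes F :: "'n::finite \<Rightarrow> 'n \<Rightarrow> real"
  shows "(\<Sum>i\<in>UNIV. \<Sum>j\<in>UNIV. F i j * (\<Sum>k\<in>UNIV. G i j k * E k)) =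
    (\<Sum>k\<in>UNIV. (\<Sum>i\<in>UNIV. \<Sum>j\<in>UNIV. F i j * G i j k) * E k)"
proof -
  have "(\<Sum>i\<in>UNIV. \<Sum>j\<in>UNIV. F i j * (\<Sum>k\<in>UNIV. G i j k * E k)) =
      (\<Sum>i\<in>UNIV. \<Sum>j\<in>UNIV. \<Sum>k\<in>UNIV. F i j * G i j k * E k)"
    by (simp add: sum_distrib_left mult.assoc)
  also have "\<dots> = (\<Sum>i\<in>UNIV. \<Sum>k\<in>UNIV. \<Sum>j\<in>UNIV. F i j * G i j k * E k)"
    by (intro sum.cong refl sum.swap)
  also have "\<dots> = (\<Sum>k\<in>UNIV. \<Sum>i\<in>UNIV. \<Sum>j\<in>UNIV. F i j * G i j k * E k)"
    by (rule sum.swap)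
  finally show ?thesis by (simp add: sum_distrib_right)
qed

context smooth_frame
begin

lemma vf_tangent: "smooth_vector_field A X \<Longrightarrow> X p \<in> tangent_space A p"
  by (simp add: smooth_vector_field_def)

lemma smooth_apply: "smooth_vector_field A X \<Longrightarrow> smooth_fun A f \<Longrightarrow> smooth_fun A (\<lambda>p. X p f)"
  by (simp add: smooth_vector_field_def)

lemma smooth_combination:
  assumes "\<And>i. smooth_fun A (\<lambda>p. a p i)"
  shows "smooth_vector_field A (\<lambda>p. comb p (a p))"
  unfolding smooth_vector_field_def
  by (auto intro!: frame_tangent smooth_fun_sum[OF atlas] smooth_fun_mult[OF atlas] assms
      smooth_apply[OF frame_smooth] simp: comb_def)

section \<open>The metric and connection determined by a frame\<close>

definition frame_metric :: "'a metric" where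
  "frame_metric p u v = (\<Sum>i\<in>UNIV. coef p u i * coef p v i)"

lemma frame_metric_orthonormal: "frame_metric p (e i p) (e j p) = (if i = j then 1 else 0)"
  by (simp add: frame_metric_def coef_frame if_distrib[of "\<lambda>x. x * _"] cong: if_cong)

lemma frame_metric_right: "frame_metric p u (e k p) = coef p u k"
  by (simp add: frame_metric_def coef_frame if_distrib[of "\<lambda>x. _ * x"] cong: if_cong)

lemma riemannian_frame_metric: "riemannian_metric A frame_metric"
  unfolding riemannian_metric_def
proof (intro conjI allI ballI impI)
  fix p u v assume u: "u \<in> tangent_space A p" and v: "v \<in> tangent_space A p"
  show "frame_metric p u v = frame_metric p v u" by (simp add: frame_metric_def mult.commute)
  show "frame_metric p u u > 0" if "u \<noteq> (\<lambda>_. 0)"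
  proof -
    have "\<exists>i. coef p u i \<noteq> 0"
    proof (rule ccontr)
      assume "\<nexists>i. coef p u i \<noteq> 0"
      then have "u f = 0" for f using expand[OF u, of f] by simp
      then show False using that by blast
    qed
    then obtain i where "coef p u i \<noteq> 0" by blast
    then have "0 < coef p u i * coef p u i" using not_real_square_gt_zero by blast
    then show ?thesis unfolding frame_metric_def by (intro sum_pos2[of UNIV i]) auto
  qed
  show "frame_metric p (tangent_comb a u b v) w = a * frame_metric p u w + b * frame_metric p v w"
    if "w \<in> tangent_space A p" for w a b
    by (simp add: frame_metric_def coef_tangent_comb[OF u v] sum_distrib_left sum.distrib
        algebra_simps)
next
  fix X Y assume "smooth_vector_field A X" "smooth_vector_field A Y"
  then show "smooth_fun A (\<lambda>p. frame_metric p (X p) (Y p))"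
    unfolding frame_metric_def
    by (intro smooth_fun_sum[OF atlas] smooth_fun_mult[OF atlas] smooth_coef)
qed

text \<open>The Koszul formula in an orthonormal frame, where the derivatives of the metric
  coefficients vanish.\<close>

definition christoffel :: "'n \<Rightarrow> 'n \<Rightarrow> 'n \<Rightarrow> real" where
  "christoffel i j k = (c i j k - c j k i + c k i j) / 2"

lemma christoffel_antisym: "christoffel i k j = - christoffel i j k"
  using structure_constants_antisym[of i j k] structure_constants_antisym[of i k j]
    structure_constants_antisym[of j k i]
  by (simp add: christoffel_def field_simps)

lemma christoffel_torsion: "christoffel i j k - christoffel j i k = c i j k"
  using structure_constants_antisym[of i j k] structure_constants_antisym[of k j i]
    structure_constants_antisym[of i k j]
  by (simp add: christoffel_def field_simps)

definition covariant :: "'a vector_field \<Rightarrow> 'a vector_field \<Rightarrow> 'a \<Rightarrow> 'n \<Rightarrow> real" where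
  "covariant X Y p k = X p (\<lambda>q. coef q (Y q) k) +
     (\<Sum>i\<in>UNIV. \<Sum>j\<in>UNIV. coef p (X p) i * coef p (Y p) j * christoffel i j k)"

definition frame_connection :: "'a vector_field \<Rightarrow> 'a vector_field \<Rightarrow> 'a vector_field" where
  "frame_connection X Y = (\<lambda>p. comb p (covariant X Y p))"

text \<open>By the Leibniz rule the iterated derivatives of \<open>f\<close> along frame fields
  enter the difference only antisymmetrically, where they are brackets of the frame.\<close>

lemma bracket_expand:
  assumes X: "smooth_vector_field A X" and Y: "smooth_vector_field A Y"
  shows "vf_bracket X Y p = comb p (\<lambda>k. X p (\<lambda>q. coef q (Y q) k) - Y p (\<lambda>q. coef q (X q) k) +
     (\<Sum>i\<in>UNIV. \<Sum>j\<in>UNIV. coef p (X p) i * coef p (Y p) j * c i j k))"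
proof
  fix f
  note t = vf_tangent[OF X, of p] vf_tangent[OF Y, of p]
  show "vf_bracket X Y p f = comb p (\<lambda>k. X p (\<lambda>q. coef q (Y q) k) - Y p (\<lambda>q. coef q (X q) k) +
     (\<Sum>i\<in>UNIV. \<Sum>j\<in>UNIV. coef p (X p) i * coef p (Y p) j * c i j k)) f"
  proof (cases "smooth_fun A f")
    case False
    have "X q f = 0" "Y q f = 0" "e i q f = 0" for q i
      using False tangent_nonsmooth vf_tangent[OF X] vf_tangent[OF Y] frame_in_tangent by blast+
    then show ?thesis
      by (simp add: vf_bracket_def comb_def tangent_const[OF atlas t(1)] tangent_const[OF atlas
          t(2)])
  next
    case True
    have second: "Z p (\<lambda>q. W q f) = (\<Sum>k\<in>UNIV. Z p (\<lambda>q. coef q (W q) k) * e k p f) +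
        (\<Sum>j\<in>UNIV. \<Sum>i\<in>UNIV. coef p (W p) j * coef p (Z p) i * e i p (\<lambda>q. e j q f))"
      if Z: "smooth_vector_field A Z" and W: "smooth_vector_field A W" for Z W
    proof -
      have sm: "smooth_fun A (\<lambda>q. coef q (W q) k)" "smooth_fun A (\<lambda>q. e k q f)" for k
        using smooth_coef[OF W] smooth_apply[OF frame_smooth True] by blast+
      have "Z p (\<lambda>q. W q f) = Z p (\<lambda>q. \<Sum>k\<in>UNIV. coef q (W q) k * e k q f)"
        using expand[OF vf_tangent[OF W]] by simp
      also have "\<dots> = (\<Sum>k\<in>UNIV. Z p (\<lambda>q. coef q (W q) k * e k q f))"
        by (intro tangent_sum[OF atlas vf_tangent[OF Z]] smooth_fun_mult[OF atlas] sm)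
      also have "\<dots> = (\<Sum>k\<in>UNIV. coef p (W p) k * Z p (\<lambda>q. e k q f)
          + e k p f * Z p (\<lambda>q. coef q (W q) k))"
        by (intro sum.cong refl tangent_mult[OF atlas vf_tangent[OF Z]] sm)
      also have "\<dots> = (\<Sum>k\<in>UNIV. Z p (\<lambda>q. coef q (W q) k) * e k p f) +
          (\<Sum>j\<in>UNIV. coef p (W p) j * Z p (\<lambda>q. e j q f))"
        by (simp add: sum.distrib mult.commute)
      also have "(\<Sum>j\<in>UNIV. coef p (W p) j * Z p (\<lambda>q. e j q f)) =
          (\<Sum>j\<in>UNIV. \<Sum>i\<in>UNIV. coef p (W p) j * coef p (Z p) i * e i p (\<lambda>q. e j q f))"
        by (simp add: expand[OF vf_tangent[OF Z], of p "\<lambda>q. e _ q f"] sum_distrib_left mult.assoc)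
      finally show ?thesis .
    qed
    have br: "e i p (\<lambda>q. e j q f) - e j p (\<lambda>q. e i q f) = (\<Sum>k\<in>UNIV. c i j k * e k p f)" for i j
      using frame_bracket[of i j] by (simp add: vf_bracket_def fun_eq_iff)
    have "(\<Sum>j\<in>UNIV. \<Sum>i\<in>UNIV. coef p (Y p) j * coef p (X p) i * e i p (\<lambda>q. e j q f)) =
        (\<Sum>i\<in>UNIV. \<Sum>j\<in>UNIV. coef p (X p) i * coef p (Y p) j * e i p (\<lambda>q. e j q f))"
      by (subst sum.swap) (intro sum.cong refl, simp)
    moreover have "(\<Sum>j\<in>UNIV. \<Sum>i\<in>UNIV. coef p (X p) j * coef p (Y p) i * e i p (\<lambda>q. e j q f)) =
        (\<Sum>i\<in>UNIV. \<Sum>j\<in>UNIV. coef p (X p) i * coef p (Y p) j * e j p (\<lambda>q. e i q f))"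
      by simp
    ultimately have "(\<Sum>j\<in>UNIV. \<Sum>i\<in>UNIV. coef p (Y p) j * coef p (X p) i * e i p (\<lambda>q. e j q f)) -
        (\<Sum>j\<in>UNIV. \<Sum>i\<in>UNIV. coef p (X p) j * coef p (Y p) i * e i p (\<lambda>q. e j q f)) =
        (\<Sum>i\<in>UNIV. \<Sum>j\<in>UNIV. coef p (X p) i * coef p (Y p) j * (\<Sum>k\<in>UNIV. c i j k * e k p f))"
      unfolding br[symmetric] by (simp only: sum_subtractf right_diff_distrib)
    also have "\<dots> = (\<Sum>k\<in>UNIV. (\<Sum>i\<in>UNIV. \<Sum>j\<in>UNIV. coef p (X p) i * coef p (Y p) j * c i j k) * e k p
        f)"
      by (rule sum_swap_product)
    finally show ?thesis
      unfolding vf_bracket_def second[OF X Y] second[OF Y X] comb_def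
      by (simp add: left_diff_distrib distrib_right sum.distrib sum_subtractf)
  qed
qed

lemma smooth_covariant:
  assumes "smooth_vector_field A X" "smooth_vector_field A Y"
  shows "smooth_fun A (\<lambda>p. covariant X Y p k)"
proof -
  have "smooth_fun A (\<lambda>p. X p (\<lambda>q. coef q (Y q) k))"
    by (rule smooth_apply[OF assms(1) smooth_coef[OF assms(2)]])
  moreover have "smooth_fun A (\<lambda>p. coef p (X p) i * coef p (Y p) j * christoffel i j k)" for i j
    by (rule smooth_fun_mult[OF atlas smooth_fun_mult[OF atlas smooth_coef[OF assms(1)]
        smooth_coef[OF assms(2)]]
          smooth_fun_const[OF atlas]])
  ultimately show ?thesis
    unfolding covariant_def by (intro smooth_fun_add[OF atlas] smooth_fun_sum[OF atlas])
qed

text \<open>\<open>levi_civita\<close> is a \<open>SOME\<close>-choice, so a connection with the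
  defining properties must be exhibited before any property of the chosen one is available.\<close>

lemma frame_connection_levi_civita: "is_levi_civita A frame_metric frame_connection"
  unfolding is_levi_civita_def
proof (intro conjI allI impI)
  fix X Y assume X: "smooth_vector_field A X" and Y: "smooth_vector_field A Y"
  show "smooth_vector_field A (frame_connection X Y)"
    unfolding frame_connection_def
    using smooth_combination[of "covariant X Y", OF smooth_covariant[OF X Y]] .
  show "vf_comb (\<lambda>_. 1) (frame_connection X Y) (\<lambda>_. - 1) (frame_connection Y X) = vf_bracket X Y"
  proof
    fix p
    have "(\<Sum>i\<in>UNIV. \<Sum>j\<in>UNIV. coef p (X p) i * coef p (Y p) j * christoffel i j k) -
        (\<Sum>i\<in>UNIV. \<Sum>j\<in>UNIV. coef p (Y p) i * coef p (X p) j * christoffel i j k) =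
        (\<Sum>i\<in>UNIV. \<Sum>j\<in>UNIV. coef p (X p) i * coef p (Y p) j * c i j k)" for k
    proof -
      have "(\<Sum>i\<in>UNIV. \<Sum>j\<in>UNIV. coef p (Y p) i * coef p (X p) j * christoffel i j k) =
          (\<Sum>i\<in>UNIV. \<Sum>j\<in>UNIV. coef p (X p) i * coef p (Y p) j * christoffel j i k)"
        by (subst sum.swap) (intro sum.cong refl, simp)
      moreover have "coef p (X p) i * coef p (Y p) j * c i j k =
          coef p (X p) i * coef p (Y p) j * christoffel i j k
              - coef p (X p) i * coef p (Y p) j * christoffel j i k" for i j
        by (simp only: right_diff_distrib[symmetric] christoffel_torsion)
      ultimately show ?thesis by (simp only: sum_subtractf)
    qed
    then have cov: "covariant X Y p k - covariant Y X p k = X p (\<lambda>q. coef q (Y q) k)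
        - Y p (\<lambda>q. coef q (X q) k) +
        (\<Sum>i\<in>UNIV. \<Sum>j\<in>UNIV. coef p (X p) i * coef p (Y p) j * c i j k)" for k
      unfolding covariant_def by (simp add: algebra_simps)
    show "vf_comb (\<lambda>_. 1) (frame_connection X Y) (\<lambda>_.
        - 1) (frame_connection Y X) p = vf_bracket X Y p"
      unfolding bracket_expand[OF X Y] cov[symmetric]
      by (simp add: vf_comb_def tangent_comb_def frame_connection_def comb_def sum_subtractf
          left_diff_distrib)
  qed
next
  fix X Y Z assume X: "smooth_vector_field A X" and Y: "smooth_vector_field A Y" and Z:
      "smooth_vector_field A Z"
  note t = vf_tangent[OF X] vf_tangent[OF Y] vf_tangent[OF Z]
  have cov: "covariant (vf_comb (\<lambda>_. 1) X (\<lambda>_. 1) Y) Z p k = covariant X Z p k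
      + covariant Y Z p k" for p k
    unfolding covariant_def vf_comb_def coef_tangent_comb[OF t(1,2)]
    by (simp add: tangent_comb_def sum.distrib distrib_right)
  show "frame_connection (vf_comb (\<lambda>_. 1) X (\<lambda>_. 1) Y) Z =
      vf_comb (\<lambda>_. 1) (frame_connection X Z) (\<lambda>_. 1) (frame_connection Y Z)"
    unfolding frame_connection_def comb_def cov
    by (simp add: vf_comb_def tangent_comb_def sum.distrib distrib_right)
  have add: "X p (\<lambda>q. coef q (Y q) k + coef q (Z q) k) = X p (\<lambda>q. coef q (Y q) k)
      + X p (\<lambda>q. coef q (Z q) k)" for p k
    by (intro tangent_add[OF atlas t(1)] smooth_coef Y Z)
  have cov': "covariant X (vf_comb (\<lambda>_. 1) Y (\<lambda>_. 1) Z) p k = covariant X Y p k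
      + covariant X Z p k" for p k
    unfolding covariant_def vf_comb_def coef_tangent_comb[OF t(2,3)]
    by (simp add: add sum.distrib distrib_right distrib_left)
  show "frame_connection X (vf_comb (\<lambda>_. 1) Y (\<lambda>_. 1) Z) =
      vf_comb (\<lambda>_. 1) (frame_connection X Y) (\<lambda>_. 1) (frame_connection X Z)"
    unfolding frame_connection_def comb_def cov'
    by (simp add: vf_comb_def tangent_comb_def sum.distrib distrib_right)
  fix p
  let ?x = "coef p (X p)" and ?y = "coef p (Y p)" and ?z = "coef p (Z p)"
  have "X p (\<lambda>q. frame_metric q (Y q) (Z q)) = (\<Sum>k\<in>UNIV. X p (\<lambda>q. coef q (Y q) k * coef q (Z q) k))"
    unfolding frame_metric_def
    by (intro tangent_sum[OF atlas t(1)] smooth_fun_mult[OF atlas] smooth_coef Y Z)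
  also have "\<dots> = (\<Sum>k\<in>UNIV. ?y k * X p (\<lambda>q. coef q (Z q) k) + ?z k * X p (\<lambda>q. coef q (Y q) k))"
    by (intro sum.cong refl tangent_mult[OF atlas t(1)] smooth_coef Y Z)
  finally have lhs: "X p (\<lambda>q. frame_metric q (Y q) (Z q)) = \<dots>" .
  have yz: "(\<Sum>k\<in>UNIV. (\<Sum>i\<in>UNIV. \<Sum>j\<in>UNIV. ?x i * ?y j * christoffel i j k) * ?z k) =
      (\<Sum>i\<in>UNIV. \<Sum>j\<in>UNIV. \<Sum>k\<in>UNIV. ?x i * ?y j * (christoffel i j k * ?z k))"
    unfolding sum_swap_product[symmetric] by (simp only: sum_distrib_left)
  have zy: "(\<Sum>k\<in>UNIV. (\<Sum>i\<in>UNIV. \<Sum>j\<in>UNIV. ?x i * ?z j * christoffel i j k) * ?y k) =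
      (\<Sum>i\<in>UNIV. \<Sum>j\<in>UNIV. \<Sum>k\<in>UNIV. ?x i * ?z j * (christoffel i j k * ?y k))"
    unfolding sum_swap_product[symmetric] by (simp only: sum_distrib_left)
  \<comment> \<open>Antisymmetry in the last two indices cancels the algebraic terms and leaves only
    the Leibniz part: this is metric compatibility.\<close>
  have term_antisym: "?x i * ?z j * (christoffel i j k * ?y k) =
      - (?x i * ?y k * (christoffel i k j * ?z j))" for i j k
    by (simp add: christoffel_antisym[of i k j])
  have "(\<Sum>j\<in>UNIV. \<Sum>k\<in>UNIV. ?x i * ?z j * (christoffel i j k * ?y k)) =
      (\<Sum>k\<in>UNIV. \<Sum>j\<in>UNIV. - (?x i * ?y k * (christoffel i k j * ?z j)))" for i
    unfolding term_antisym by (rule sum.swap)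
  then have "(\<Sum>k\<in>UNIV. (\<Sum>i\<in>UNIV. \<Sum>j\<in>UNIV. ?x i * ?z j * christoffel i j k) * ?y k) =
      - (\<Sum>k\<in>UNIV. (\<Sum>i\<in>UNIV. \<Sum>j\<in>UNIV. ?x i * ?y j * christoffel i j k) * ?z k)"
    unfolding yz zy by (simp only: sum_negf)
  then have "(\<Sum>k\<in>UNIV. ?y k * X p (\<lambda>q. coef q (Z q) k) + ?z k * X p (\<lambda>q. coef q (Y q) k)) =
      (\<Sum>k\<in>UNIV. ?y k * X p (\<lambda>q. coef q (Z q) k) + ?z k * X p (\<lambda>q. coef q (Y q) k)) +
      (\<Sum>k\<in>UNIV. (\<Sum>i\<in>UNIV. \<Sum>j\<in>UNIV. ?x i * ?y j * christoffel i j k) * ?z k) +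
      (\<Sum>k\<in>UNIV. (\<Sum>i\<in>UNIV. \<Sum>j\<in>UNIV. ?x i * ?z j * christoffel i j k) * ?y k)"
    by simp
  also have "\<dots> = (\<Sum>k\<in>UNIV. covariant X Y p k * ?z k) + (\<Sum>k\<in>UNIV. ?y k * covariant X Z p k)"
    unfolding covariant_def sum.distrib[symmetric] by (intro sum.cong refl) (simp only:
        algebra_simps)
  finally show "X p (\<lambda>q. frame_metric q (Y q) (Z q)) =
      frame_metric p (frame_connection X Y p) (Z p) + frame_metric p (Y p) (frame_connection X Z p)"
    unfolding lhs unfolding frame_metric_def frame_connection_def coef_comb .
next
  fix h :: "'a \<Rightarrow> real" and X Y assume h: "smooth_fun A h" and X: "smooth_vector_field A X" and Y:
      "smooth_vector_field A Y"
  note t = vf_tangent[OF X] vf_tangent[OF Y]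
  have cov: "covariant (\<lambda>p f. h p * X p f) Y p k = h p * covariant X Y p k" for p k
    unfolding covariant_def coef_scale[OF t(1)]
    by (simp add: distrib_left sum_distrib_left mult.assoc)
  show "frame_connection (\<lambda>p f. h p * X p f) Y = (\<lambda>p f. h p * frame_connection X Y p f)"
    unfolding frame_connection_def comb_def cov by (simp add: sum_distrib_left mult.assoc)
  have leibniz: "X p (\<lambda>q. h q * coef q (Y q) k) = h p * X p (\<lambda>q. coef q (Y q) k)
      + coef p (Y p) k * X p h" for p k
    by (intro tangent_mult[OF atlas t(1)] smooth_coef Y h)
  have cov': "covariant X (\<lambda>p f. h p * Y p f) p k = X p h * coef p (Y p) k
      + h p * covariant X Y p k" for p k
    unfolding covariant_def coef_scale[OF t(2)] leibniz
    by (simp add: distrib_left sum_distrib_left mult.left_commute mult.assoc)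
  have "(\<Sum>k\<in>UNIV. (X p h * coef p (Y p) k + h p * covariant X Y p k) * e k p f) =
      X p h * (\<Sum>k\<in>UNIV. coef p (Y p) k * e k p f)
          + h p * (\<Sum>k\<in>UNIV. covariant X Y p k * e k p f)" for p f
    by (simp add: sum_distrib_left sum.distrib distrib_right mult.assoc)
  then show "frame_connection X (\<lambda>p f. h p * Y p f) = (\<lambda>p f. X p h * Y p f
      + h p * frame_connection X Y p f)"
    unfolding frame_connection_def comb_def cov' expand[OF t(2), symmetric] by simp
qed

text \<open>The uniqueness argument of Koszul: the torsion and metric identities for permuted
  indices are linear equations that determine the components of whichever connection was
  chosen.\<close>

lemma levi_civita_frame:
  "frame_metric p (levi_civita A frame_metric (e i) (e j) p) (e k p) = christoffel i j k"
proof -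
  define L where "L = levi_civita A frame_metric"
  have L: "is_levi_civita A frame_metric L"
    unfolding L_def levi_civita_def using someI[of
        "is_levi_civita A frame_metric", OF frame_connection_levi_civita] by simp
  define G where "G i j k = frame_metric p (L (e i) (e j) p) (e k p)" for i j k
  note sm = frame_smooth
  have t: "L (e i) (e j) p \<in> tangent_space A p" for i j
    by (intro vf_tangent is_levi_civita_smooth[OF L] sm)
  have tor: "G i j k - G j i k = c i j k" for i j k
  proof -
    have "vf_comb (\<lambda>_. 1) (L (e i) (e j)) (\<lambda>_. - 1) (L (e j) (e i)) p = vf_bracket (e i) (e j) p"
      by (simp add: is_levi_civita_torsion[OF L sm sm])
    then have "coef p (tangent_comb 1 (L (e i) (e j) p) (- 1) (L (e j) (e i) p)) = coef p (comb p
        (c i j))"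
      by (simp add: vf_comb_def frame_bracket comb_def)
    then show ?thesis
      by (simp add: coef_tangent_comb[OF t t] coef_comb G_def frame_metric_right fun_eq_iff)
  qed
  have met: "G i j k + G i k j = 0" for i j k
  proof -
    have "e i p (\<lambda>q. frame_metric q (e j q) (e k q)) =
        frame_metric p (L (e i) (e j) p) (e k p) + frame_metric p (e j p) (L (e i) (e k) p)"
      by (rule is_levi_civita_metric[OF L sm sm sm])
    moreover have "frame_metric p (e j p) (L (e i) (e k) p) = G i k j"
      by (simp add: G_def frame_metric_def mult.commute)
    ultimately show ?thesis
      by (simp add: G_def frame_metric_orthonormal tangent_const[OF atlas frame_in_tangent])
  qed
  have "G i j k = christoffel i j k"
    using tor[of i j k] tor[of j k i] tor[of k i j] met[of i j k] met[of j k i] met[of k i j]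
      met[of j i k] unfolding christoffel_def by (simp add: field_simps)
  then show ?thesis by (simp add: G_def L_def)
qed

end

section \<open>Left-invariant frames\<close>

text \<open>The chain rule through the transition map: a vector given in another chart is
  represented in this one by its image under the derivative of the change of coordinates.\<close>

lemma tangent_space_chart:
  fixes A :: "('a::t2_space, 'e::euclidean_space) chart set"
  assumes A: "smooth_atlas A" and c: "(U, x) \<in> A" "p \<in> U" and u: "u \<in> tangent_space A p"
  shows "\<exists>w. u = (\<lambda>f. if smooth_fun A f then frechet_derivative (\<lambda>s. f (inv_into U x s)) (at (x
      p)) w else 0)"
proof -
  obtain V y w where d: "(V, y) \<in> A" "p \<in> V"
    and w: "u = (\<lambda>f. if smooth_fun A f then frechet_derivative (\<lambda>s. f (inv_into V y s)) (at (y p))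
        w else 0)"
    using u unfolding tangent_space_def by blast
  note cU = chart_facts[OF A c(1)] and cV = chart_facts[OF A d(1)]
  define h where "h s = x (inv_into V y s)" for s
  define T where "T = y ` (V \<inter> U)"
  have T: "open T" "y p \<in> T" using cV(6)[OF cU(1)] c d by (auto simp: T_def)
  have "smooth_on T h"
    using A c(1) d(1) unfolding smooth_atlas_def T_def h_def by fast
  then have "Ck_on (Suc 0) T h" unfolding smooth_on_def by blast
  then have dh: "h differentiable (at (y p))" using T(2) by simp
  have hp: "h (y p) = x p" using cV(3) d(2) by (simp add: h_def)
  have "frechet_derivative (\<lambda>s. f (inv_into V y s)) (at (y p)) w =
      frechet_derivative (\<lambda>s. f (inv_into U x s)) (at (x p)) (frechet_derivative h (at (y p)) w)"
    if f: "smooth_fun A f" for f :: "'a \<Rightarrow> real"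
  proof -
    define F where "F s = f (inv_into U x s)" for s
    have dF: "F differentiable (at (h (y p)))"
      unfolding hp F_def[abs_def] by (rule smooth_fun_differentiable[OF A f c])
    have "f (inv_into V y s) = (F \<circ> h) s" if "s \<in> T" for s
      using that cU(3) cV(3) by (auto simp: T_def F_def h_def)
    then have "frechet_derivative (\<lambda>s. f (inv_into V y s)) (at (y p)) = frechet_derivative (F \<circ> h)
        (at (y p))"
      by (intro frechet_derivative_cong_open(2)[OF T]) auto
    also have "\<dots> = frechet_derivative F (at (h (y p))) \<circ> frechet_derivative h (at (y p))"
      by (rule frechet_derivative_compose[OF dh dF])
    finally show ?thesis by (simp add: hp F_def[abs_def])
  qed
  then have "u = (\<lambda>f. if smooth_fun A f then frechet_derivative (\<lambda>s. f (inv_into U x s)) (at (x p))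
      (frechet_derivative h (at (y p)) w) else 0)"
    unfolding w by (auto simp: fun_eq_iff)
  then show ?thesis by blast
qed

text \<open>In one chart, tangent vectors come from coordinate vectors. As many independent ones as
  there are coordinates lift to a basis of the coordinate space, so they span.\<close>

lemma independent_tangents_span:
  fixes A :: "('a::t2_space, real ^ 'n) chart set" and e :: "'n::finite \<Rightarrow> 'a tangent"
  assumes A: "smooth_atlas A" and e: "\<And>i. e i \<in> tangent_space A p"
    and ind: "\<And>a i. (\<And>f. (\<Sum>i\<in>UNIV. a i * e i f) = 0) \<Longrightarrow> a i = 0"
    and u: "u \<in> tangent_space A p"
  shows "\<exists>a. u = (\<lambda>f. \<Sum>i\<in>UNIV. a i * e i f)"
proof -
  obtain U x where c: "(U, x) \<in> A" "p \<in> U" using chart_at[OF A] .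
  define \<tau> where "\<tau> w f = (if smooth_fun A f then frechet_derivative (\<lambda>s. f (inv_into U x s)) (at
      (x p)) w else 0)"
    for w and f :: "'a \<Rightarrow> real"
  have lin: "linear (\<lambda>w. \<tau> w f)" for f
    using smooth_fun_differentiable[OF A _ c, of f] linear_frechet_derivative[of
        "\<lambda>s. f (inv_into U x s)"]
    by (cases "smooth_fun A f") (auto simp: \<tau>_def linear_zero)
  have ex: "\<exists>w. v = \<tau> w" if "v \<in> tangent_space A p" for v
    using tangent_space_chart[OF A c that] unfolding \<tau>_def[abs_def] .
  obtain W where W: "\<And>i. e i = \<tau> (W i)" using ex[OF e] by metis
  define T where "T a = (\<Sum>i\<in>UNIV. a $ i *\<^sub>R W i)" for a :: "real^'n"
  have tT: "\<tau> (T a) f = (\<Sum>i\<in>UNIV. a $ i * e i f)" for a f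
    unfolding T_def linear_sum[OF lin] linear_scale[OF lin] by (simp add: W)
  have linT: "linear T"
    by (rule linearI) (simp_all add: T_def scaleR_left_distrib sum.distrib scaleR_sum_right)
  have "a = 0" if "T a = 0" for a
  proof -
    have "(\<Sum>i\<in>UNIV. a $ i * e i f) = 0" for f
      using tT[of a f] that linear_0[OF lin] by simp
    from ind[of "\<lambda>i. a $ i", OF this] show "a = 0" by (simp add: vec_eq_iff)
  qed
  then have "inj T" using linear_injective_0[OF linT] by blast
  then have "surj T" using linear_injective_imp_surjective[OF linT] by blast
  obtain w where "u = \<tau> w" using ex[OF u] by blast
  moreover obtain a where "w = T a" using \<open>surj T\<close> by (metis surjD)
  ultimately have "u = (\<lambda>f. \<Sum>i\<in>UNIV. a $ i * e i f)" using tT by auto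
  then show ?thesis by (intro exI[of _ "\<lambda>i. a $ i"])
qed

text \<open>The basis \<open>b\<close> is carried over to left-invariant fields. Independence holds
  at every point because a left-invariant field that vanishes at one point is translated to 0
  everywhere.\<close>

lemma left_invariant_frame:
  fixes G :: "('a::t2_space) monoid" and A :: "('a, real ^ 'n::finite) chart set"
    and br :: "'v::real_vector \<Rightarrow> 'v \<Rightarrow> 'v" and f :: "'n \<Rightarrow> 'v \<Rightarrow> real" and b :: "'n \<Rightarrow> 'v"
  assumes G: "lie_group G A" and br: "has_lie_algebra G A br"
    and f: "\<And>i. linear (f i)" "\<And>i j. f i (b j) = (if i = j then 1 else 0)"
      "\<And>x. (\<And>i. f i x = 0) \<Longrightarrow> x = 0"
  shows "\<exists>e. (\<forall>i. left_invariant_vf G A (e i)) \<and> smooth_frame A e (\<lambda>i j k. f k (br (b i) (b j)))"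
proof -
  obtain \<iota> where bij: "bij_betw \<iota> UNIV {X. left_invariant_vf G A X}"
    and \<iota>: "\<And>u v a b. \<iota> (a *\<^sub>R u + b *\<^sub>R v) = vf_comb (\<lambda>_. a) (\<iota> u) (\<lambda>_. b) (\<iota> v)"
    and \<iota>br: "\<And>u v. \<iota> (br u v) = vf_bracket (\<iota> u) (\<iota> v)"
    using br unfolding has_lie_algebra_def by blast
  define e where "e i = \<iota> (b i)" for i
  have A: "smooth_atlas A" and grp: "group G" and car: "carrier G = UNIV"
    using G unfolding lie_group_def by auto
  have inv: "left_invariant_vf G A (\<iota> v)" for v using bij unfolding bij_betw_def by blast
  have sm: "smooth_vector_field A (\<iota> v)" for v using inv unfolding left_invariant_vf_def by blast
  have lin: "linear (\<lambda>v. \<iota> v p h)" for p h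
  proof (rule linearI)
    show "\<iota> (u + v) p h = \<iota> u p h + \<iota> v p h" for u v
      using \<iota>[of 1 u 1 v] by (simp add: vf_comb_def tangent_comb_def)
    show "\<iota> (a *\<^sub>R u) p h = a *\<^sub>R \<iota> u p h" for a u
      using \<iota>[of a u 0 u] by (simp add: vf_comb_def tangent_comb_def)
  qed
  have sum: "\<iota> (\<Sum>i\<in>UNIV. a i *\<^sub>R b i) p h = (\<Sum>i\<in>UNIV. a i * e i p h)" for a p h
    unfolding linear_sum[OF lin] linear_scale[OF lin] by (simp add: e_def)
  have fsum: "f j (\<Sum>i\<in>UNIV. a i *\<^sub>R b i) = a j" for a j
    unfolding linear_sum[OF f(1)] linear_scale[OF f(1)]
    by (simp add: f(2) if_distrib[of "\<lambda>x. _ * x"] cong: if_cong)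
  have expand: "v = (\<Sum>i\<in>UNIV. f i v *\<^sub>R b i)" for v
    by (subst eq_iff_diff_eq_0, rule f(3)) (simp add: linear_diff[OF f(1)] fsum)
  have zero: "v = 0" if "\<iota> v p = (\<lambda>_. 0)" for v p
  proof -
    have "\<iota> v q = (\<lambda>_. 0)" for q
    proof -
      have "q = (q \<otimes>\<^bsub>G\<^esub> inv\<^bsub>G\<^esub> p) \<otimes>\<^bsub>G\<^esub> p"
        using grp car by (simp add: group.inv_solve_right group.inv_closed group.is_monoid
            monoid.m_closed
            monoid.m_assoc group.l_inv)
      then have "\<iota> v q = left_translate G (q \<otimes>\<^bsub>G\<^esub> inv\<^bsub>G\<^esub> p) (\<iota> v p)"
        using inv[of v] unfolding left_invariant_vf_def by metis
      then show ?thesis by (simp add: that left_translate_def)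
    qed
    then have "\<iota> v = \<iota> 0"
      using linear_0[OF lin] by (auto simp: fun_eq_iff)
    then show ?thesis using bij unfolding bij_betw_def by (simp add: inj_eq)
  qed
  have ind: "a i = 0" if "\<And>h. (\<Sum>i\<in>UNIV. a i * e i p h) = 0" for a i p
  proof -
    have "(\<Sum>i\<in>UNIV. a i *\<^sub>R b i) = 0" by (rule zero[of _ p]) (simp add: fun_eq_iff sum that)
    then show ?thesis using fsum[of i a] linear_0[OF f(1)] by simp
  qed
  have tan: "\<iota> v p \<in> tangent_space A p" for v p using sm[of v] by (simp add:
      smooth_vector_field_def)
  have "smooth_frame A e (\<lambda>i j k. f k (br (b i) (b j)))"
  proof
    show "smooth_atlas A" by (rule A)
    show "smooth_vector_field A (e i)" for i unfolding e_def by (rule sm)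
    show "a i = 0" if "\<And>h. (\<Sum>i\<in>UNIV. a i * e i p h) = 0" for p a i by (rule ind[OF that])
    show "\<exists>a. u = (\<lambda>h. \<Sum>i\<in>UNIV. a i * e i p h)" if "u \<in> tangent_space A p" for p u
    proof (rule independent_tangents_span[OF A, of "\<lambda>i. e i p" p])
      show "e i p \<in> tangent_space A p" for i by (simp add: e_def tan)
      show "a i = 0" if "\<And>h. (\<Sum>i\<in>UNIV. a i * e i p h) = 0" for a i by (rule ind[OF that])
    qed (rule that)
    show "(\<lambda>h. \<Sum>i\<in>UNIV. a i * e i p h) \<in> tangent_space A p" for p a
      using tan[of "\<Sum>i\<in>UNIV. a i *\<^sub>R b i" p] by (simp add: sum[symmetric])
    show "vf_bracket (e i) (e j) = (\<lambda>p h. \<Sum>k\<in>UNIV. f k (br (b i) (b j)) * e k p h)" for i j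
      using expand[of "br (b i) (b j)"] by (simp add: e_def[of i] e_def[of j] \<iota>br[symmetric]
          sum[symmetric])
  qed
  moreover have "left_invariant_vf G A (e i)" for i unfolding e_def by (rule inv)
  ultimately show ?thesis by blast
qed

context smooth_frame
begin

text \<open>Left translation maps frame vectors to frame vectors and therefore preserves
  coefficients in the frame.\<close>

lemma left_invariant_frame_metric:
  assumes e: "\<And>i. left_invariant_vf G A (e i)"
  shows "left_invariant_metric G A frame_metric"
proof -
  have "coef (a \<otimes>\<^bsub>G\<^esub> p) (left_translate G a u) = coef p u" if u: "u \<in> tangent_space A p" for a p u
  proof (rule coef_eqI)
    fix h
    have "e i (a \<otimes>\<^bsub>G\<^esub> p) h = e i p (\<lambda>q. h (a \<otimes>\<^bsub>G\<^esub> q))" for i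
      using e[of i] by (simp add: left_invariant_vf_def left_translate_def)
    then show "left_translate G a u h = (\<Sum>i\<in>UNIV. coef p u i * e i (a \<otimes>\<^bsub>G\<^esub> p) h)"
      by (simp add: left_translate_def expand[OF u])
  qed
  then show ?thesis
    unfolding left_invariant_metric_def using riemannian_frame_metric by (simp add:
        frame_metric_def)
qed

end

section \<open>Pure spinors\<close>

lemma less_6: "(0::6) < 1" "(0::6) < 2" "(0::6) < 3" "(0::6) < 4" "(0::6) < 5" "(1::6) < 2"
    "(1::6) < 3" "(1::6) < 4" "(1::6) < 5" "(2::6) < 3" "(2::6) < 4" "(2::6) < 5" "(3::6) < 4"
    "(3::6) < 5" "(4::6) < 5"
  by (simp_all add: less_bit0_def bit0.Rep_0 bit0.Rep_1 bit0.Rep_numeral)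

lemmas neq_6 = less_6[THEN less_imp_neq] less_6[THEN less_imp_neq, symmetric]
lemmas not_less_6 = less_6[THEN less_not_sym]

lemma UNIV_6: "(UNIV :: 6 set) = {0, 1, 2, 3, 4, 5}"
proof -
  have "card {0, 1, 2, 3, 4, 5 :: 6} = CARD(6)" by (simp add: neq_6)
  then show ?thesis using card_subset_eq[of "UNIV :: 6 set" "{0, 1, 2, 3, 4, 5}"] by simp
qed

lemma sum_6:
  fixes F :: "6 \<Rightarrow> 'w::comm_monoid_add"
  shows "(\<Sum>i\<in>UNIV. F i) = F 0 + F 1 + F 2 + F 3 + F 4 + F 5"
  unfolding UNIV_6 by (simp add: neq_6 add.assoc)

lemma sum_pairs_6:
  fixes F :: "6 \<Rightarrow> 6 \<Rightarrow> 'w::comm_monoid_add"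
  shows "(\<Sum>(j, k) | j < k. F j k) = F 0 1 + F 0 2 + F 0 3 + F 0 4 + F 0 5 + F 1 2 + F 1 3 + F 1 4
      + F 1 5 + F 2 3 + F 2 4 + F 2 5 + F 3 4 + F 3 5 + F 4 5"
proof -
  have "(\<Sum>(j, k) | j < k. F j k) = (\<Sum>p\<in>UNIV. if fst p < snd p then F (fst p) (snd p) else 0)"
    by (subst sum.inter_filter[symmetric]) (simp_all add: case_prod_unfold)
  also have "\<dots> = (\<Sum>j\<in>UNIV. \<Sum>k\<in>UNIV. if j < k then F j k else 0)"
    unfolding UNIV_Times_UNIV[symmetric] sum.cartesian_product by (simp add: case_prod_unfold)
  also have "\<dots> = F 0 1 + F 0 2 + F 0 3 + F 0 4 + F 0 5 + F 1 2 + F 1 3 + F 1 4 + F 1 5 + F 2 3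
      + F 2 4 + F 2 5 + F 3 4 + F 3 5 + F 4 5"
    unfolding sum_6 by (simp only: less_6 not_less_6 less_irrefl if_True if_False add_0_left
        add_0_right add.assoc)
  finally show ?thesis .
qed

section \<open>Clifford action of six generators\<close>

locale clifford_action6 =
  fixes E :: "6 \<Rightarrow> 'w::real_vector \<Rightarrow> 'w"
  assumes lin: "\<And>i. linear (E i)"
    and square: "\<And>i x. E i (E i x) = - x"
    and anticommute: "\<And>i j x. i \<noteq> j \<Longrightarrow> E i (E j x) = - E j (E i x)"
begin

lemmas arith = linear_add[OF lin] linear_diff[OF lin] linear_neg[OF lin] linear_scale[OF lin]
    linear_0[OF lin]

lemma sort:
  "E 1 (E 0 x) = - E 0 (E 1 x)"
  "E 2 (E 0 x) = - E 0 (E 2 x)"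
  "E 3 (E 0 x) = - E 0 (E 3 x)"
  "E 4 (E 0 x) = - E 0 (E 4 x)"
  "E 5 (E 0 x) = - E 0 (E 5 x)"
  "E 2 (E 1 x) = - E 1 (E 2 x)"
  "E 3 (E 1 x) = - E 1 (E 3 x)"
  "E 4 (E 1 x) = - E 1 (E 4 x)"
  "E 5 (E 1 x) = - E 1 (E 5 x)"
  "E 3 (E 2 x) = - E 2 (E 3 x)"
  "E 4 (E 2 x) = - E 2 (E 4 x)"
  "E 5 (E 2 x) = - E 2 (E 5 x)"
  "E 4 (E 3 x) = - E 3 (E 4 x)"
  "E 5 (E 3 x) = - E 3 (E 5 x)"
  "E 5 (E 4 x) = - E 4 (E 5 x)"
  by (rule anticommute, simp add: neq_6)+

text \<open>The involutions \<open>e\<^sub>0e\<^sub>1e\<^sub>2e\<^sub>3\<close>, \<open>e\<^sub>0e\<^sub>1e\<^sub>4e\<^sub>5\<close> and \<open>e\<^sub>0e\<^sub>2e\<^sub>4\<close> commute; each is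
  anticommuted by an element commuting with the previous ones, so all joint signs of eigenvalues
  occur.\<close>

lemma pure_spinor_exists:
  fixes w0 :: 'w
  assumes "w0 \<noteq> 0"
  obtains w where "w \<noteq> 0" "E 2 (E 3 w) = E 0 (E 1 w)" "E 4 (E 5 w) = E 0 (E 1 w)"
      "E 0 (E 2 (E 4 w)) = w"
proof -
  \<comment> \<open>The difference of \<open>w0\<close> and its image under the involution has
    eigenvalue -1, unless it is 0; then \<open>w0\<close> has eigenvalue 1 and \<open>E 0\<close>
    flips the sign. The next two steps repeat this for the other involutions.\<close>
  have step1: "\<exists>w. w \<noteq> 0 \<and> E 0 (E 1 (E 2 (E 3 w))) = - w"
  proof (cases "w0 = E 0 (E 1 (E 2 (E 3 w0)))")
    case True
    have "E 0 w0 \<noteq> 0" using square[of 0 w0] assms by (auto simp: arith)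
    moreover have "E 0 (E 1 (E 2 (E 3 (E 0 w0)))) = - E 0 (E 0 (E 1 (E 2 (E 3 w0))))"
      by (simp add: sort square arith)
    ultimately show ?thesis using True by (intro exI[of _ "E 0 w0"]) simp
  next
    case False
    then show ?thesis
      by (intro exI[of _ "w0 - E 0 (E 1 (E 2 (E 3 w0)))"]) (simp add: sort square arith)
  qed
  then obtain w1 where w1: "w1 \<noteq> 0" "E 0 (E 1 (E 2 (E 3 w1))) = - w1" by blast
  \<comment> \<open>\<open>E 4\<close> commutes with the first involution and anticommutes with the
    second.\<close>
  have step2: "\<exists>w. w \<noteq> 0 \<and> E 0 (E 1 (E 2 (E 3 w))) = - w \<and> E 0 (E 1 (E 4 (E 5 w))) = - w"
  proof (cases "w1 = E 0 (E 1 (E 4 (E 5 w1)))")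
    case True
    have "E 4 w1 \<noteq> 0" using square[of 4 w1] w1(1) by (auto simp: arith)
    moreover have "E 0 (E 1 (E 2 (E 3 (E 4 w1)))) = E 4 (E 0 (E 1 (E 2 (E 3 w1))))"
      "E 0 (E 1 (E 4 (E 5 (E 4 w1)))) = - E 4 (E 0 (E 1 (E 4 (E 5 w1))))"
      by (simp_all add: sort square arith)
    ultimately show ?thesis using True w1(2) by (intro exI[of _ "E 4 w1"]) (simp add: arith)
  next
    case False
    have "E 0 (E 1 (E 2 (E 3 (E 0 (E 1 (E 4 (E 5 w1))))))) = E 0 (E 1 (E 4 (E 5 (E 0 (E 1 (E 2 (E
        3 w1)))))))"
      by (simp add: sort square arith)
    then have "E 0 (E 1 (E 2 (E 3 (E 0 (E 1 (E 4 (E 5 w1))))))) = - E 0 (E 1 (E 4 (E 5 w1)))"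
      by (simp add: w1(2) arith)
    moreover have "E 0 (E 1 (E 4 (E 5 (E 0 (E 1 (E 4 (E 5 w1))))))) = w1"
      by (simp add: sort square arith)
    ultimately show ?thesis using False w1(2)
      by (intro exI[of _ "w1 - E 0 (E 1 (E 4 (E 5 w1)))"]) (simp only: arith, simp)
  qed
  then obtain w2 where w2: "w2 \<noteq> 0" "E 0 (E 1 (E 2 (E 3 w2))) = - w2" "E 0 (E 1 (E 4 (E 5 w2))) =
      - w2" by blast
  \<comment> \<open>The product of \<open>E 0\<close> and \<open>E 1\<close> commutes with the first
    two involutions and anticommutes with the third.\<close>
  have step3: "\<exists>w. w \<noteq> 0 \<and> E 0 (E 1 (E 2 (E 3 w))) = - w \<and> E 0 (E 1 (E 4 (E 5 w))) = - w
      \<and> E 0 (E 2 (E 4 w)) = w"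
  proof (cases "w2 = - E 0 (E 2 (E 4 w2))")
    case True
    let ?w = "E 0 (E 1 w2)"
    have "E 0 (E 1 (E 0 (E 1 w2))) = - w2" by (simp add: sort square arith)
    then have "?w \<noteq> 0" using w2(1) by (auto simp: arith)
    moreover have "E 0 (E 1 (E 2 (E 3 ?w))) = E 0 (E 1 (E 0 (E 1 (E 2 (E 3 w2)))))"
      "E 0 (E 1 (E 4 (E 5 ?w))) = E 0 (E 1 (E 0 (E 1 (E 4 (E 5 w2)))))"
      "E 0 (E 2 (E 4 ?w)) = - E 0 (E 1 (E 0 (E 2 (E 4 w2))))"
      by (simp_all add: sort square arith)
    moreover have "E 0 (E 2 (E 4 w2)) = - w2" using True by (metis minus_minus)
    ultimately show ?thesis using w2(2,3) by (intro exI[of _ ?w]) (simp add: arith)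
  next
    case False
    let ?u = "E 0 (E 2 (E 4 w2))"
    have "E 0 (E 1 (E 2 (E 3 ?u))) = E 0 (E 2 (E 4 (E 0 (E 1 (E 2 (E 3 w2))))))"
      "E 0 (E 1 (E 4 (E 5 ?u))) = E 0 (E 2 (E 4 (E 0 (E 1 (E 4 (E 5 w2))))))"
      "E 0 (E 2 (E 4 ?u)) = w2"
      by (simp_all add: sort square arith)
    then have u: "E 0 (E 1 (E 2 (E 3 ?u))) = - ?u" "E 0 (E 1 (E 4 (E 5 ?u))) = - ?u"
        "E 0 (E 2 (E 4 ?u)) = w2"
      by (simp_all only: w2 arith)
    have "w2 + ?u \<noteq> 0" using False by (metis eq_neg_iff_add_eq_0)
    then show ?thesis
      by (intro exI[of _ "w2 + ?u"]) (simp only: arith u w2, simp)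
  qed
  then obtain w where w: "w \<noteq> 0" "E 0 (E 1 (E 2 (E 3 w))) = - w" "E 0 (E 1 (E 4 (E 5 w))) = - w"
    "E 0 (E 2 (E 4 w)) = w" by blast
  have "E 0 (E 1 (E 0 (E 1 x))) = - x" for x by (simp add: sort square arith)
  from this[of "E 2 (E 3 w)"] this[of "E 4 (E 5 w)"] show thesis
    by (intro that[OF w(1) _ _ w(4)]) (simp_all add: w arith)
qed

context
  fixes w :: 'w
  assumes w1: "E 2 (E 3 w) = E 0 (E 1 w)" and w2: "E 4 (E 5 w) = E 0 (E 1 w)" and w3:
      "E 0 (E 2 (E 4 w)) = w"
begin

text \<open>On \<open>w\<close> the three products \<open>E 0 E 1\<close>, \<open>E 2 E 3\<close>,
  \<open>E 4 E 5\<close> agree and act as a complex unit. With the companion table, each generator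
  sends each of the eight vectors \<open>w\<close>, \<open>E 0 (E 1 w)\<close>, \<open>E i w\<close>
  to plus or minus one of them.\<close>

lemma pure_spinor_table_diagonal:
  "E 1 (E 0 w) = - E 0 (E 1 w)"
  "E 2 (E 3 w) = E 0 (E 1 w)"
  "E 3 (E 2 w) = - E 0 (E 1 w)"
  "E 4 (E 5 w) = E 0 (E 1 w)"
  "E 5 (E 4 w) = - E 0 (E 1 w)"
  "E 0 (E 0 (E 1 w)) = - E 1 w"
  "E 1 (E 0 (E 1 w)) = E 0 w"
  "E 2 (E 0 (E 1 w)) = - E 3 w"
  "E 3 (E 0 (E 1 w)) = E 2 w"
  "E 4 (E 0 (E 1 w)) = - E 5 w"
  "E 5 (E 0 (E 1 w)) = E 4 w"
proof -
  show "E 1 (E 0 w) = - E 0 (E 1 w)" "E 2 (E 3 w) = E 0 (E 1 w)" "E 3 (E 2 w) = - E 0 (E 1 w)"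
    "E 4 (E 5 w) = E 0 (E 1 w)" "E 5 (E 4 w) = - E 0 (E 1 w)"
    by (simp_all add: sort w1 w2)
  show "E 0 (E 0 (E 1 w)) = - E 1 w" "E 1 (E 0 (E 1 w)) = E 0 w"
    by (simp_all add: sort square arith)
  show "E 2 (E 0 (E 1 w)) = - E 3 w" "E 3 (E 0 (E 1 w)) = E 2 w"
    unfolding w1[symmetric] by (simp_all add: sort square arith)
  show "E 4 (E 0 (E 1 w)) = - E 5 w" "E 5 (E 0 (E 1 w)) = E 4 w"
    unfolding w2[symmetric] by (simp_all add: sort square arith)
qed

lemma pure_spinor_table:
  "E 0 (E 2 w) = - E 4 w"
  "E 0 (E 3 w) = E 5 w"
  "E 0 (E 4 w) = E 2 w"
  "E 0 (E 5 w) = - E 3 w"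
  "E 1 (E 2 w) = E 5 w"
  "E 1 (E 3 w) = E 4 w"
  "E 1 (E 4 w) = - E 3 w"
  "E 1 (E 5 w) = - E 2 w"
  "E 2 (E 0 w) = E 4 w"
  "E 2 (E 1 w) = - E 5 w"
  "E 2 (E 4 w) = - E 0 w"
  "E 2 (E 5 w) = E 1 w"
  "E 3 (E 0 w) = - E 5 w"
  "E 3 (E 1 w) = - E 4 w"
  "E 3 (E 4 w) = E 1 w"
  "E 3 (E 5 w) = E 0 w"
  "E 4 (E 0 w) = - E 2 w"
  "E 4 (E 1 w) = E 3 w"
  "E 4 (E 2 w) = E 0 w"
  "E 4 (E 3 w) = - E 1 w"
  "E 5 (E 0 w) = E 3 w"
  "E 5 (E 1 w) = E 2 w"
  "E 5 (E 2 w) = - E 1 w"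
  "E 5 (E 3 w) = - E 0 w"
proof -
  have t: "E 2 (E 4 w) = - E 0 w" using arg_cong[OF w3, of
      "E 0"] by (simp add: square minus_equation_iff)
  have t': "E 0 (E 4 w) = E 2 w"
    using arg_cong[OF w3, of "E 2"] by (simp add: sort square arith)
  have t'': "E 0 (E 2 w) = - E 4 w"
    using arg_cong[OF w3, of "E 4"] by (simp add: sort square arith minus_equation_iff)
  note d = pure_spinor_table_diagonal
  have e1: "E 0 (E 3 w) = E 5 w"
  proof -
    have "E 0 (E 3 w) = - E 0 (E 2 (E 4 (E 5 w)))" unfolding d by (simp add: arith d)
    also have "\<dots> = E 5 (E 0 (E 2 (E 4 w)))" by (simp add: sort arith)
    finally show ?thesis by (simp add: w3)
  qed
  have e2: "E 0 (E 5 w) = - E 3 w"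
    using arg_cong[OF e1, of "E 0"] by (simp add: square)
  have e3: "E 3 (E 5 w) = E 0 w"
    using arg_cong[OF e1, of "E 3"] by (simp add: sort square arith)
  have f1: "E 1 (E 2 w) = E 5 w"
  proof -
    have "E 1 (E 2 w) = - E 2 (E 1 w)" by (simp add: sort)
    also have "E 1 w = - E 0 (E 0 (E 1 w))" by (simp add: square)
    also have "E 0 (E 1 w) = E 4 (E 5 w)" by (rule w2[symmetric])
    also have "- E 2 (- E 0 (E 4 (E 5 w))) = E 5 (E 0 (E 2 (E 4 w)))" by (simp add: sort arith)
    finally show ?thesis by (simp add: w3)
  qed
  have f2: "E 1 (E 5 w) = - E 2 w"
    using arg_cong[OF f1, of "E 1"] by (simp add: square)
  have f3: "E 2 (E 5 w) = E 1 w"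
    using arg_cong[OF f1, of "E 2"] by (simp add: sort square arith)
  have g1: "E 1 (E 3 w) = E 4 w"
  proof -
    have "E 1 (E 3 w) = - E 3 (E 1 w)" by (simp add: sort)
    also have "E 1 w = - E 0 (E 0 (E 1 w))" by (simp add: square)
    also have "E 0 (E 1 w) = E 2 (E 3 w)" by (rule w1[symmetric])
    also have "- E 3 (- E 0 (E 2 (E 3 w))) = - E 0 (E 2 w)" by (simp add: sort square arith)
    finally show ?thesis by (simp add: t'')
  qed
  have g2: "E 1 (E 4 w) = - E 3 w"
    using arg_cong[OF g1, of "E 1"] by (simp add: square)
  have g3: "E 3 (E 4 w) = E 1 w"
    using arg_cong[OF g1, of "E 3"] by (simp add: sort square arith)
  show "E 0 (E 2 w) = - E 4 w" "E 0 (E 3 w) = E 5 w" "E 0 (E 4 w) = E 2 w" "E 0 (E 5 w) = - E 3 w"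
      "E 1 (E 2 w) = E 5 w" "E 1 (E 3 w) = E 4 w" "E 1 (E 4 w) = - E 3 w" "E 1 (E 5 w) = - E 2 w"
      "E 2 (E 0 w) = E 4 w" "E 2 (E 1 w) = - E 5 w" "E 2 (E 4 w) = - E 0 w" "E 2 (E 5 w) = E 1 w"
      "E 3 (E 0 w) = - E 5 w" "E 3 (E 1 w) = - E 4 w" "E 3 (E 4 w) = E 1 w" "E 3 (E 5 w) = E 0 w"
      "E 4 (E 0 w) = - E 2 w" "E 4 (E 1 w) = E 3 w" "E 4 (E 2 w) = E 0 w" "E 4 (E 3 w) = - E 1 w"
      "E 5 (E 0 w) = E 3 w" "E 5 (E 1 w) = E 2 w" "E 5 (E 2 w) = - E 1 w" "E 5 (E 3 w) = - E 0 w"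
    by (simp_all add: sort t t' t'' e1 e2 e3 f1 f2 f3 g1 g2 g3)
qed

text \<open>With Christoffel symbols for \<open>g\<close> the left side is twice the Dirac operator
  on the constant spinor \<open>w\<close>. The coefficients of \<open>w\<close> and
  \<open>E 0 (E 1 w)\<close> come from the (3,0) part of the 3-form, the other six from its
  contraction with the Kaehler form and from traces.\<close>

lemma pure_spinor_expansion:
  "(\<Sum>i\<in>UNIV. E i (\<Sum>(j, k) | j < k. g i j k *\<^sub>R E j (E k w))) =
     (g 0 2 4 - g 0 3 5 - g 1 2 5 - g 1 3 4 - g 2 0 4 + g 2 1 5 + g 3 0 5 + g 3 1 4 + g 4 0 2
         - g 4 1 3 - g 5 0 3 - g 5 1 2) *\<^sub>R w
     + (g 0 2 5 + g 0 3 4 + g 1 2 4 - g 1 3 5 - g 2 0 5 - g 2 1 4 - g 3 0 4 + g 3 1 5 + g 4 0 3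
         + g 4 1 2 + g 5 0 2 - g 5 1 3) *\<^sub>R E 0 (E 1 w)
     + (g 1 0 1 + g 1 2 3 + g 1 4 5 + g 2 0 2 - g 2 1 3 + g 3 0 3 + g 3 1 2 + g 4 0 4 - g 4 1 5
         + g 5 0 5 + g 5 1 4) *\<^sub>R E 0 w
     + (- g 0 0 1 - g 0 2 3 - g 0 4 5 + g 2 0 3 + g 2 1 2 - g 3 0 2 + g 3 1 3 + g 4 0 5 + g 4 1 4
         - g 5 0 4 + g 5 1 5) *\<^sub>R E 1 w
     + (- g 0 0 2 + g 0 1 3 - g 1 0 3 - g 1 1 2 + g 3 0 1 + g 3 2 3 + g 3 4 5 + g 4 2 4 - g 4 3 5
         + g 5 2 5 + g 5 3 4) *\<^sub>R E 2 w
     + (- g 0 0 3 - g 0 1 2 + g 1 0 2 - g 1 1 3 - g 2 0 1 - g 2 2 3 - g 2 4 5 + g 4 2 5 + g 4 3 4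
         - g 5 2 4 + g 5 3 5) *\<^sub>R E 3 w
     + (- g 0 0 4 + g 0 1 5 - g 1 0 5 - g 1 1 4 - g 2 2 4 + g 2 3 5 - g 3 2 5 - g 3 3 4 + g 5 0 1
         + g 5 2 3 + g 5 4 5) *\<^sub>R E 4 w
     + (- g 0 0 5 - g 0 1 4 + g 1 0 4 - g 1 1 5 - g 2 2 5 - g 2 3 4 + g 3 2 4 - g 3 3 5 - g 4 0 1
         - g 4 2 3 - g 4 4 5) *\<^sub>R E 5 w"
  unfolding sum_6 sum_pairs_6
  by (simp only: arith pure_spinor_table pure_spinor_table_diagonal square scaleR_minus_right
      minus_minus
      scaleR_left_distrib scaleR_left_diff_distrib scaleR_minus_left) (simp only:
          diff_conv_add_uminus minus_add_distrib minus_minus add_ac)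

end

end

section \<open>Harmonic spinors\<close>

lemma clifford_action6_representation:
  fixes \<rho> :: "6 clifford \<Rightarrow> 'w::real_normed_vector \<Rightarrow>\<^sub>L 'w"
  assumes "clifford_representation \<rho>"
  shows "clifford_action6 (\<lambda>i. blinfun_apply (\<rho> (clifford_gen i)))"
proof -
  have lin: "linear \<rho>" and one: "\<rho> clifford_one = id_blinfun"
    and mult: "\<And>a b. \<rho> (clifford_mult a b) = \<rho> a o\<^sub>L \<rho> b"
    using assms unfolding clifford_representation_def by blast+
  have rel: "\<rho> (clifford_gen i) (\<rho> (clifford_gen j) x) + \<rho> (clifford_gen j) (\<rho> (clifford_gen i) x) =
      (if i = j then - 2 else 0) *\<^sub>R x" for i j x
  proof -
    have "\<rho> (clifford_mult (clifford_gen i) (clifford_gen j)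
        + clifford_mult (clifford_gen j) (clifford_gen i)) =
        (if i = j then - 2 else 0) *\<^sub>R id_blinfun"
      unfolding clifford_relation linear_scale[OF lin] one ..
    then have "(\<rho> (clifford_gen i) o\<^sub>L \<rho> (clifford_gen j))
        + (\<rho> (clifford_gen j) o\<^sub>L \<rho> (clifford_gen i)) =
        (if i = j then - 2 else 0) *\<^sub>R id_blinfun"
      unfolding linear_add[OF lin] mult .
    from arg_cong[OF this, of "\<lambda>T. blinfun_apply T x"] show ?thesis
      by (simp add: blinfun.add_left blinfun.scaleR_left)
  qed
  show ?thesis
  proof (rule clifford_action6.intro)
    show "linear (blinfun_apply (\<rho> (clifford_gen i)))" for i
      by (rule bounded_linear.linear) (rule blinfun.bounded_linear_right)
    show "\<rho> (clifford_gen i) (\<rho> (clifford_gen i) x) = - x" for i x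
    proof -
      have "2 *\<^sub>R \<rho> (clifford_gen i) (\<rho> (clifford_gen i) x) = 2 *\<^sub>R (- x)"
        using rel[of i i x] by (simp add: scaleR_2)
      then show ?thesis unfolding scaleR_cancel_left by simp
    qed
    show "\<rho> (clifford_gen i) (\<rho> (clifford_gen j) x) = - \<rho> (clifford_gen j) (\<rho> (clifford_gen i) x)"
      if "i \<noteq> j" for i j x
      using rel[of i j x] that by (simp add: eq_neg_iff_add_eq_0)
  qed
qed

lemma smooth_fun_constant: "smooth_fun A (\<lambda>_. w)"
  unfolding smooth_fun_def smooth_map_def smooth_on_def by (auto intro: Ck_on_const)

lemma pure_frame_harmonic_spinor:
  fixes G :: "('a::t2_space) monoid" and A :: "('a, real ^ 6) chart set"
    and br :: "'v::real_vector \<Rightarrow> 'v \<Rightarrow> 'v"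
    and \<rho> :: "6 clifford \<Rightarrow> 'w::euclidean_space \<Rightarrow>\<^sub>L 'w"
  assumes G: "lie_group G A" "has_lie_algebra G A br" and lie: "lie_algebra6 br"
    and pure: "has_pure_frame br" and \<rho>: "clifford_representation \<rho>"
  shows "\<exists>g e. left_invariant_metric G A g \<and> left_invariant_orthonormal_frame G A g e \<and>
           (\<exists>\<phi>. spinor G A \<Gamma> \<phi> \<and> left_invariant_spinor \<phi> \<and> (\<exists>p. \<phi> p \<noteq> 0) \<and>
                harmonic_spinor A g e \<rho> \<phi>)"
proof -
  obtain f1 f2 f3 f4 f5 f6 b1 b2 b3 b4 b5 b6 where
    cf: "coframe f1 f2 f3 f4 f5 f6" and dual: "dual_frame f1 f2 f3 f4 f5 f6 b1 b2 b3 b4 b5 b6"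
    and uni: "unimodular_frame br f1 f2 f3 f4 f5 f6 b1 b2 b3 b4 b5 b6"
    and pf: "pure_frame br f1 f2 f3 f4 f5 f6 b1 b2 b3 b4 b5 b6"
    using pure unfolding has_pure_frame_def by blast
  \<comment> \<open>The index type 6 counts from 0, so \<open>f 0\<close> is the first form of the
    coframe.\<close>
  define f :: "6 \<Rightarrow> 'v \<Rightarrow> real" where "f i = (if i = 0 then f1 else if i = 1 then f2 else if i = 2
      then f3
      else if i = 3 then f4 else if i = 4 then f5 else f6)" for i
  define b :: "6 \<Rightarrow> 'v" where "b i = (if i = 0 then b1 else if i = 1 then b2 else if i = 2 then b3
      else if i = 3 then b4 else if i = 4 then b5 else b6)" for i
  have fs: "f 0 = f1" "f 1 = f2" "f 2 = f3" "f 3 = f4" "f 4 = f5" "f 5 = f6"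
    and bs: "b 0 = b1" "b 1 = b2" "b 2 = b3" "b 3 = b4" "b 4 = b5" "b 5 = b6"
    by (simp_all add: f_def b_def neq_6)
  have all6: "P i" if "P 0" "P 1" "P 2" "P 3" "P 4" "P 5" for P and i :: 6
  proof -
    have "i \<in> {0, 1, 2, 3, 4, 5}" by (simp only: UNIV_6[symmetric] UNIV_I)
    then show ?thesis using that by (elim insertE emptyE) simp_all
  qed
  have f_lin: "linear (f i)" for i
    by (rule all6) (simp_all only: fs coframeD[OF cf])
  have f_dual: "f i (b j) = (if i = j then 1 else 0)" for i j
  proof -
    have "\<forall>j. f i (b j) = (if i = j then 1 else 0)"
      by (rule all6[of _ i]; rule allI; rule all6) (simp_all only: fs bs dual_frameD[OF dual]
          neq_6 if_True if_False refl)
    then show ?thesis by blast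
  qed
  have f_inj: "x = 0" if "\<And>i. f i x = 0" for x
    using coframeD(7)[OF cf, of x] that[of 0] that[of 1] that[of 2] that[of 3] that[of 4] that[of
        5] by (simp add: fs)
  define c where "c i j k = f k (br (b i) (b j))" for i j k
  obtain e where inv: "\<And>i. left_invariant_vf G A (e i)" and fr:
      "smooth_frame A e (\<lambda>i j k. f k (br (b i) (b j)))"
    using left_invariant_frame[OF G, of f b, OF f_lin f_dual f_inj] by blast
  have "(\<lambda>i j k. f k (br (b i) (b j))) = c" by (simp add: c_def fun_eq_iff)
  then interpret F: smooth_frame A e c using fr by simp
  define E where "E i = blinfun_apply (\<rho> (clifford_gen i))" for i
  interpret C: clifford_action6 E
    unfolding E_def by (rule clifford_action6_representation[OF \<rho>])
  obtain w0 :: 'w where "w0 \<noteq> 0" using nonzero_Basis nonempty_Basis by blast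
  then obtain w where w: "w \<noteq> 0" "E 2 (E 3 w) = E 0 (E 1 w)" "E 4 (E 5 w) = E 0 (E 1 w)"
      "E 0 (E 2 (E 4 w)) = w"
    by (rule C.pure_spinor_exists)
  have inv_metric: "left_invariant_metric G A F.frame_metric"
    by (rule F.left_invariant_frame_metric[OF inv])
  have on: "left_invariant_orthonormal_frame G A F.frame_metric e"
    unfolding left_invariant_orthonormal_frame_def by (simp add: inv F.frame_metric_orthonormal)
  \<comment> \<open>The derivative of a constant spinor vanishes, so only the connection term
    remains.\<close>
  have dirac: "dirac A F.frame_metric e \<rho> (\<lambda>_. w) p =
      (1 / 2) *\<^sub>R (\<Sum>i\<in>UNIV. E i (\<Sum>(j, k) | j < k. F.christoffel i j k *\<^sub>R E j (E k w)))" for p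
  proof -
    have "spinor_derivative (e i) (\<lambda>_. w) p = 0" for i
      by (simp add: spinor_derivative_def tangent_const[OF F.atlas F.frame_in_tangent])
    then show ?thesis
      unfolding dirac_def spinor_connection_def F.levi_civita_frame E_def[symmetric]
      by (simp add: C.arith flip: scaleR_sum_right)
  qed
  have anti: "c j i k = - c i j k" for i j k by (rule F.structure_constants_antisym)
  have self: "c i i k = 0" for i k using anti[of i i k] by simp
  have sort: "c 1 0 k = - c 0 1 k"
    "c 2 0 k = - c 0 2 k"
    "c 3 0 k = - c 0 3 k"
    "c 4 0 k = - c 0 4 k"
    "c 5 0 k = - c 0 5 k"
    "c 2 1 k = - c 1 2 k"
    "c 3 1 k = - c 1 3 k"
    "c 4 1 k = - c 1 4 k"
    "c 5 1 k = - c 1 5 k"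
    "c 3 2 k = - c 2 3 k"
    "c 4 2 k = - c 2 4 k"
    "c 5 2 k = - c 2 5 k"
    "c 4 3 k = - c 3 4 k"
    "c 5 3 k = - c 3 5 k"
    "c 5 4 k = - c 4 5 k" for k
    by (rule anti)+
  have uni': "c 0 0 0 + c 0 1 1 + c 0 2 2 + c 0 3 3 + c 0 4 4 + c 0 5 5 = 0"
    "c 1 0 0 + c 1 1 1 + c 1 2 2 + c 1 3 3 + c 1 4 4 + c 1 5 5 = 0"
    "c 2 0 0 + c 2 1 1 + c 2 2 2 + c 2 3 3 + c 2 4 4 + c 2 5 5 = 0"
    "c 3 0 0 + c 3 1 1 + c 3 2 2 + c 3 3 3 + c 3 4 4 + c 3 5 5 = 0"
    "c 4 0 0 + c 4 1 1 + c 4 2 2 + c 4 3 3 + c 4 4 4 + c 4 5 5 = 0"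
    "c 5 0 0 + c 5 1 1 + c 5 2 2 + c 5 3 3 + c 5 4 4 + c 5 5 5 = 0"
    using uni unfolding unimodular_frame_def by (simp_all add: c_def fs bs)
  have pure': "(c 2 3 0 + c 3 0 2 + c 0 2 3) + (c 4 5 0 + c 5 0 4 + c 0 4 5) = 0"
    "(c 2 3 1 + c 3 1 2 + c 1 2 3) + (c 4 5 1 + c 5 1 4 + c 1 4 5) = 0"
    "(c 1 2 0 + c 2 0 1 + c 0 1 2) + (c 4 5 2 + c 5 2 4 + c 2 4 5) = 0"
    "(c 1 3 0 + c 3 0 1 + c 0 1 3) + (c 4 5 3 + c 5 3 4 + c 3 4 5) = 0"
    "(c 1 4 0 + c 4 0 1 + c 0 1 4) + (c 3 4 2 + c 4 2 3 + c 2 3 4) = 0"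
    "(c 1 5 0 + c 5 0 1 + c 0 1 5) + (c 3 5 2 + c 5 2 3 + c 2 3 5) = 0"
    "(c 2 4 0 + c 4 0 2 + c 0 2 4) - (c 3 5 0 + c 5 0 3 + c 0 3 5) - (c 2 5 1 + c 5 1 2 + c 1 2 5)
        - (c 3 4 1 + c 4 1 3 + c 1 3 4) = 0"
    "(c 2 5 0 + c 5 0 2 + c 0 2 5) + (c 3 4 0 + c 4 0 3 + c 0 3 4) + (c 2 4 1 + c 4 1 2 + c 1 2 4)
        - (c 3 5 1 + c 5 1 3 + c 1 3 5) = 0"
    using pf unfolding pure_frame_def cyc_def by (simp_all add: c_def fs bs)
  note H = uni'[unfolded sort self] pure'[unfolded sort self]
  have "(\<Sum>i\<in>UNIV. E i (\<Sum>(j, k) | j < k. F.christoffel i j k *\<^sub>R E j (E k w))) = 0"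
  proof -
    \<comment> \<open>Expanded in structure constants, the first two expressions are halves of the
      last two equations of \<open>pure_frame\<close>; each other one combines, up to sign, a trace
      of \<open>ad\<close> with half of one contraction equation.\<close>
    have "F.christoffel 0 2 4 - F.christoffel 0 3 5 - F.christoffel 1 2 5 - F.christoffel 1 3 4
        - F.christoffel 2 0 4 + F.christoffel 2 1 5 + F.christoffel 3 0 5 + F.christoffel 3 1 4
        + F.christoffel 4 0 2 - F.christoffel 4 1 3 - F.christoffel 5 0 3 - F.christoffel 5 1 2 = 0"
      "F.christoffel 0 2 5 + F.christoffel 0 3 4 + F.christoffel 1 2 4 - F.christoffel 1 3 5
          - F.christoffel 2 0 5 - F.christoffel 2 1 4 - F.christoffel 3 0 4 + F.christoffel 3 1 5
          + F.christoffel 4 0 3 + F.christoffel 4 1 2 + F.christoffel 5 0 2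
          - F.christoffel 5 1 3 = 0"
      "F.christoffel 1 0 1 + F.christoffel 1 2 3 + F.christoffel 1 4 5 + F.christoffel 2 0 2
          - F.christoffel 2 1 3 + F.christoffel 3 0 3 + F.christoffel 3 1 2 + F.christoffel 4 0 4
          - F.christoffel 4 1 5 + F.christoffel 5 0 5 + F.christoffel 5 1 4 = 0"
      "- F.christoffel 0 0 1 - F.christoffel 0 2 3 - F.christoffel 0 4 5 + F.christoffel 2 0 3
          + F.christoffel 2 1 2 - F.christoffel 3 0 2 + F.christoffel 3 1 3 + F.christoffel 4 0 5
          + F.christoffel 4 1 4 - F.christoffel 5 0 4 + F.christoffel 5 1 5 = 0"
      "- F.christoffel 0 0 2 + F.christoffel 0 1 3 - F.christoffel 1 0 3 - F.christoffel 1 1 2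
          + F.christoffel 3 0 1 + F.christoffel 3 2 3 + F.christoffel 3 4 5 + F.christoffel 4 2 4
          - F.christoffel 4 3 5 + F.christoffel 5 2 5 + F.christoffel 5 3 4 = 0"
      "- F.christoffel 0 0 3 - F.christoffel 0 1 2 + F.christoffel 1 0 2 - F.christoffel 1 1 3
          - F.christoffel 2 0 1 - F.christoffel 2 2 3 - F.christoffel 2 4 5 + F.christoffel 4 2 5
          + F.christoffel 4 3 4 - F.christoffel 5 2 4 + F.christoffel 5 3 5 = 0"
      "- F.christoffel 0 0 4 + F.christoffel 0 1 5 - F.christoffel 1 0 5 - F.christoffel 1 1 4
          - F.christoffel 2 2 4 + F.christoffel 2 3 5 - F.christoffel 3 2 5 - F.christoffel 3 3 4
          + F.christoffel 5 0 1 + F.christoffel 5 2 3 + F.christoffel 5 4 5 = 0"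
      "- F.christoffel 0 0 5 - F.christoffel 0 1 4 + F.christoffel 1 0 4 - F.christoffel 1 1 5
          - F.christoffel 2 2 5 - F.christoffel 2 3 4 + F.christoffel 3 2 4 - F.christoffel 3 3 5
          - F.christoffel 4 0 1 - F.christoffel 4 2 3 - F.christoffel 4 4 5 = 0"
      unfolding F.christoffel_def sort self using H by argo+
    then show ?thesis
      unfolding C.pure_spinor_expansion[OF w(2-4)] by simp
  qed
  then have "harmonic_spinor A F.frame_metric e \<rho> (\<lambda>_. w)"
    unfolding harmonic_spinor_def dirac by simp
  moreover have "spinor G A \<Gamma> (\<lambda>_. w)"
    unfolding spinor_def by (simp add: smooth_fun_constant)
  moreover have "left_invariant_spinor (\<lambda>_. w)"
    unfolding left_invariant_spinor_def by blast
  ultimately show ?thesis using inv_metric on w(1) by blast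
qed

theorem mainTheorem4:
  fixes br :: "'v::real_vector \<Rightarrow> 'v \<Rightarrow> 'v"
    and G :: "('a::{t2_space,second_countable_topology}) monoid"
    and A :: "('a, real ^ 6) chart set"
    and \<Gamma> :: "'a set"
    and \<rho> :: "6 clifford \<Rightarrow> (real ^ 8) \<Rightarrow>\<^sub>L (real ^ 8)"
  assumes "lie_algebra_on UNIV br"
    and "dim (UNIV :: 'v set) = 6"
    and "lie_nilpotent br"
    and "\<not> lie_decomposable br"
    and "lie_group G A"
    and "connected (UNIV :: 'a set)"
    and "simply_connected (UNIV :: 'a set)"
    and "has_lie_algebra G A br"
    and "subgroup \<Gamma> G"
    and "discrete \<Gamma>"
    and "irreducible_clifford_representation \<rho>"
  shows "\<exists>g e. left_invariant_metric G A g \<and> left_invariant_orthonormal_frame G A g e \<and>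
           (\<exists>\<phi>. spinor G A \<Gamma> \<phi> \<and> left_invariant_spinor \<phi> \<and> (\<exists>p. \<phi> p \<noteq> 0) \<and>
                harmonic_spinor A g e \<rho> \<phi>)"
proof -
  interpret L: indecomposable_lie_algebra6 br
    using assms(1,2,4) by unfold_locales
  have "clifford_representation \<rho>"
    using assms(11) unfolding irreducible_clifford_representation_def by blast
  then show ?thesis
    using pure_frame_harmonic_spinor[OF assms(5,8) L.lie_algebra6_axioms
        L.nilpotent_has_pure_frame[OF assms(3)]] by blast
qed

end
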